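(* Let $M$ be an analytic and regular surface in the Minkowski space $\mathbb R^3_1$ and let ${\rm p}_0\in M$ be an umbilic point (spacelike, timelike or lightlike). Then $m_u({\rm p}_0)=1$ if, and only if, the Monge-Taylor map $\theta$ is transverse to the umbilic stratum $\mathcal U$ at ${\rm p}_0$.
   Context: $\mathbb R^3_1$ is $\mathbb R^3$ with the pseudo-scalar product $\langle u,v\rangle=u_0v_0+u_1v_1-u_2v_2$; $\langle u\times v,w\rangle=\det(u,v,w)$. For a local parametrisation $\mathbf x(u,v)$ of $M$, put $E=\langle \mathbf x_u,\mathbf x_u\rangle$, $F=\langle \mathbf x_u,\mathbf x_v\rangle$, $G=\langle \mathbf x_v,\mathbf x_v\rangle$, $\bar l=\langle \mathbf x_u\times \mathbf x_v,\mathbf x_{uu}\rangle$, $\bar m=\langle \mathbf x_u\times \mathbf x_v,\mathbf x_{uv}\rangle$, $\bar n=\langle \mathbf x_u\times \mathbf x_v,\mathbf x_{vv}\rangle$, $\mathfrak a=F\bar n-G\bar m$, $\mathfrak b=E\bar n-G\bar l$, $\mathfrak c=E\bar m-F\bar l$. The induced metric is Riemannian, Lorentzian or degenerate where $F^2-EG$ is $<0$, $>0$, $=0$; the degenerate locus is called $LD$. A point ${\rm p}=\mathbf x(q)$ is an umbilic point if $\mathfrak a(q)=\mathfrak b(q)=\mathfrak c(q)=0$; it is spacelike (resp. timelike, lightlike) if the metric at ${\rm p}$ is Riemannian (resp. Lorentzian, degenerate). Multiplicity: with $\mathcal O_2$ the ring of germs (at $q$) of holomorphic functions in two variables and $m(h,k)=\dim_{\mathbb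 C}\mathcal O_2/\langle h,k\rangle$ (real analytic germs complexified), $m_u({\rm p})=m(\mathfrak b,\mathfrak c)$ if $E(q)\neq0$, $m(\mathfrak a,\mathfrak c)$ if $F(q)\ne 0$, $m(\mathfrak a,\mathfrak b)$ if $G(q)\neq 0$ (at least one of these holds). Monge-Taylor map ($k\ge 2$ a fixed integer; $J^k(2,1)$ is the space of polynomials in two variables of degree $\le k$ without constant term; $j^kg$ is the Taylor polynomial of order $k$ of $g$ at the origin without its constant term; write its elements with coefficients $(a_{si})$, $j^kg=\sum_{s=1}^k\sum_{i=0}^s a_{si}x^{s-i}y^i$). (a) Near a point where the metric is nondegenerate, choose at each ${\rm p}$ a Lorentzian orthonormal frame, varying smoothly with ${\rm p}$, with one vector normal to $M$. In the coordinates of this frame centred at ${\rm p}$, $M$ is the graph over its tangent plane, in the normal direction, of a function $f_{\rm p}$ with $j^1f_{\rm p}=0$ (graph $z=f_{\rm p}(x,y)$ with $z$ timelike in the Riemannian region, $y=f_{\rm p}(x,z)$ with $x$ spacelike and $z$ timelike in the Lorentzian region). Let $\mathcal V\subset J^k(2,1)$ be the space of polynomials with all terms of degree between $2$ and $k$, and $\theta({\rm p})=j^kf_{\rm p}\in\mathcal V$. (b) Near a point ${\rm p}_0\in LD$, choose a fixed frame $\{\mathbf u,\mathbf v,\mathbf w\}$ with $\mathbf w$ transverse to $M$ in a neighbourhood $W$ of ${\rm p}_0$ in $M$. For ${\rm p}\in W$, in the coordinates of this frame centred at ${\rm p}$, $M$ is parametrised by $(x,y)\mapsto(x,y,f_{\rm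 p}(x,y))$ with $f_{\rm p}(0,0)=0$; put $\theta({\rm p})=j^kf_{\rm p}\in J^k(2,1)$. Umbilic stratum: the set $\mathcal U$ in $\mathcal V$ (case (a)) or $J^k(2,1)$ (case (b)) of jets for which the corresponding graph has an umbilic point at the origin, so that ${\rm p}$ is an umbilic point if and only if $\theta({\rm p})\in\mathcal U$. Explicitly: $a_{21}=0,\ a_{20}-a_{22}=0$ for the Riemannian case; $a_{21}=0,\ a_{20}+a_{22}=0$ for the Lorentzian case; and for the lightlike case with the standard coordinates of $\mathbb R^3_1$ (graph $z=f(x,y)$), writing $a_{10},a_{01}$ for the coefficients of $x$ and $y$: $(a_{01}^2-1)a_{21}-2a_{10}a_{01}a_{22}=0$, $(a_{01}^2-1)a_{20}-(a_{10}^2-1)a_{22}=0$, $(a_{10}^2-1)a_{21}-2a_{10}a_{01}a_{20}=0$. Near the relevant points $\mathcal U$ has codimension $2$. *)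

theory Defs
  imports "HOL-Analysis.Analysis" "HOL-Library.Extended_Nat"
begin

section \<open>Minkowski 3-space\<close>

text \<open>The coordinates $(u_0,u_1,u_2)$ are the components 1, 2, 3; the last one is timelike.\<close>

definition mink :: "real^3 \<Rightarrow> real^3 \<Rightarrow> real" where
  "mink u v = u $ 1 * v $ 1 + u $ 2 * v $ 2 - u $ 3 * v $ 3"

definition mcross :: "real^3 \<Rightarrow> real^3 \<Rightarrow> real^3" where
  "mcross u v = vector [cross3 u v $ 1, cross3 u v $ 2, - (cross3 u v $ 3)]"

text \<open>The defining property of the pseudo-vector product:\<close>

lemma mink_mcross: "mink (mcross u v) w = det (vector [u, v, w])"
  by (simp add: mink_def mcross_def cross3_def det_3 vector_3 algebra_simps)


section \<open>Derivatives and smoothness in two real variables\<close>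

definition pdu :: "(real \<times> real \<Rightarrow> 'a::real_normed_vector) \<Rightarrow> real \<times> real \<Rightarrow> 'a" where
  "pdu f z = vector_derivative (\<lambda>t. f (t, snd z)) (at (fst z))"

definition pdv :: "(real \<times> real \<Rightarrow> 'a::real_normed_vector) \<Rightarrow> real \<times> real \<Rightarrow> 'a" where
  "pdv f z = vector_derivative (\<lambda>t. f (fst z, t)) (at (snd z))"

text \<open>Infinitely differentiable on the open set \<open>S\<close>.  Partial derivatives in a different order need
  not be listed: as the first partial derivatives are differentiable, the mixed second ones agree.\<close>

definition smooth2_on :: "(real \<times> real) set \<Rightarrow> (real \<times> real \<Rightarrow> 'a::real_normed_vector) \<Rightarrow> bool" where
  "smooth2_on S f \<longleftrightarrow> (\<forall>m n. ((pdu ^^ m) ((pdv ^^ n) f)) differentiable_on S)"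


section \<open>Analytic germs in two variables and multiplicity\<close>

text \<open>Near \<open>q\<close>, the function is the sum of a (necessarily absolutely) convergent power series
  centred at \<open>q\<close>.  For \<open>'a = complex\<close> this says that \<open>f\<close> represents a holomorphic germ at \<open>q\<close>, for
  \<open>'a = real\<close> a real analytic one.\<close>

definition analytic2_at :: "('a::real_normed_field \<times> 'a \<Rightarrow> 'a) \<Rightarrow> 'a \<times> 'a \<Rightarrow> bool" where
  "analytic2_at f q \<longleftrightarrow> (\<exists>c. \<forall>\<^sub>F z in nhds q.
     ((\<lambda>(i, j). c i j * (fst z - fst q) ^ i * (snd z - snd q) ^ j) has_sum f z) (UNIV :: (nat \<times> nat) set))"

text \<open>Representatives of the germs in $\mathcal O_2$ at \<open>q\<close>, and of the germs in the ideal
  $\langle h,k\rangle$.  All functions with zero germ belong to \<open>germ_ideal h k q\<close>, so that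
  $\mathcal O_2/\langle h,k\rangle$ is the quotient of \<open>holo_germs q\<close> by \<open>germ_ideal h k q\<close>.\<close>

definition holo_germs :: "complex \<times> complex \<Rightarrow> (complex \<times> complex \<Rightarrow> complex) set" where
  "holo_germs q = {f. analytic2_at f q}"

definition germ_ideal ::
  "(complex \<times> complex \<Rightarrow> complex) \<Rightarrow> (complex \<times> complex \<Rightarrow> complex) \<Rightarrow> complex \<times> complex
     \<Rightarrow> (complex \<times> complex \<Rightarrow> complex) set" where
  "germ_ideal h k q = {f \<in> holo_germs q. \<exists>\<alpha>\<in>holo_germs q. \<exists>\<beta>\<in>holo_germs q.
     \<forall>\<^sub>F z in nhds q. f z = \<alpha> z * h z + \<beta> z * k z}"

text \<open>\<open>B\<close> is a finite set of representatives of a basis of the complex vector space \<open>V / I\<close>.\<close>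

definition quotient_basis :: "('b \<Rightarrow> complex) set \<Rightarrow> ('b \<Rightarrow> complex) set \<Rightarrow> ('b \<Rightarrow> complex) set \<Rightarrow> bool" where
  "quotient_basis V I B \<longleftrightarrow> finite B \<and> B \<subseteq> V \<and>
     (\<forall>c. (\<lambda>z. \<Sum>b\<in>B. c b * b z) \<in> I \<longrightarrow> (\<forall>b\<in>B. c b = 0)) \<and>
     (\<forall>f\<in>V. \<exists>c. (\<lambda>z. f z - (\<Sum>b\<in>B. c b * b z)) \<in> I)"

text \<open>All bases have the same size; without a finite basis the value is the infimum of the empty
  set, i.e. \<open>\<infinity>\<close>.\<close>

definition quotient_dim :: "('b \<Rightarrow> complex) set \<Rightarrow> ('b \<Rightarrow> complex) set \<Rightarrow> enat" where
  "quotient_dim V I = Inf {enat (card B) | B. quotient_basis V I B}"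

definition complex_point :: "real \<times> real \<Rightarrow> complex \<times> complex" where
  "complex_point z = (complex_of_real (fst z), complex_of_real (snd z))"

text \<open>The germ at \<open>complex_point q\<close> of the result is uniquely determined if \<open>f\<close> is analytic at \<open>q\<close>.\<close>

definition complexification :: "(real \<times> real \<Rightarrow> real) \<Rightarrow> real \<times> real \<Rightarrow> complex \<times> complex \<Rightarrow> complex" where
  "complexification f q = (SOME F. analytic2_at F (complex_point q) \<and>
     (\<forall>\<^sub>F z in nhds q. F (complex_point z) = complex_of_real (f z)))"

definition multiplicity2 :: "(real \<times> real \<Rightarrow> real) \<Rightarrow> (real \<times> real \<Rightarrow> real) \<Rightarrow> real \<times> real \<Rightarrow> enat" where
  "multiplicity2 h k q = quotient_dim (holo_germs (complex_point q))
     (germ_ideal (complexification h q) (complexification k q) (complex_point q))"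


section \<open>Parametrised surfaces and umbilic points\<close>

definition fffE :: "(real \<times> real \<Rightarrow> real^3) \<Rightarrow> real \<times> real \<Rightarrow> real" where
  "fffE x z = mink (pdu x z) (pdu x z)"

definition fffF :: "(real \<times> real \<Rightarrow> real^3) \<Rightarrow> real \<times> real \<Rightarrow> real" where
  "fffF x z = mink (pdu x z) (pdv x z)"

definition fffG :: "(real \<times> real \<Rightarrow> real^3) \<Rightarrow> real \<times> real \<Rightarrow> real" where
  "fffG x z = mink (pdv x z) (pdv x z)"

definition lbar :: "(real \<times> real \<Rightarrow> real^3) \<Rightarrow> real \<times> real \<Rightarrow> real" where
  "lbar x z = mink (mcross (pdu x z) (pdv x z)) (pdu (pdu x) z)"

definition mbar :: "(real \<times> real \<Rightarrow> real^3) \<Rightarrow> real \<times> real \<Rightarrow> real" where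
  "mbar x z = mink (mcross (pdu x z) (pdv x z)) (pdv (pdu x) z)"

definition nbar :: "(real \<times> real \<Rightarrow> real^3) \<Rightarrow> real \<times> real \<Rightarrow> real" where
  "nbar x z = mink (mcross (pdu x z) (pdv x z)) (pdv (pdv x) z)"

definition umb_a :: "(real \<times> real \<Rightarrow> real^3) \<Rightarrow> real \<times> real \<Rightarrow> real" where
  "umb_a x z = fffF x z * nbar x z - fffG x z * mbar x z"

definition umb_b :: "(real \<times> real \<Rightarrow> real^3) \<Rightarrow> real \<times> real \<Rightarrow> real" where
  "umb_b x z = fffE x z * nbar x z - fffG x z * lbar x z"

definition umb_c :: "(real \<times> real \<Rightarrow> real^3) \<Rightarrow> real \<times> real \<Rightarrow> real" where
  "umb_c x z = fffE x z * mbar x z - fffF x z * lbar x z"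

definition riemannian_at :: "(real \<times> real \<Rightarrow> real^3) \<Rightarrow> real \<times> real \<Rightarrow> bool" where
  "riemannian_at x q \<longleftrightarrow> (fffF x q)\<^sup>2 - fffE x q * fffG x q < 0"

definition lorentzian_at :: "(real \<times> real \<Rightarrow> real^3) \<Rightarrow> real \<times> real \<Rightarrow> bool" where
  "lorentzian_at x q \<longleftrightarrow> (fffF x q)\<^sup>2 - fffE x q * fffG x q > 0"

definition degenerate_at :: "(real \<times> real \<Rightarrow> real^3) \<Rightarrow> real \<times> real \<Rightarrow> bool" where
  "degenerate_at x q \<longleftrightarrow> (fffF x q)\<^sup>2 - fffE x q * fffG x q = 0"

definition umbilic_at :: "(real \<times> real \<Rightarrow> real^3) \<Rightarrow> real \<times> real \<Rightarrow> bool" where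
  "umbilic_at x q \<longleftrightarrow> umb_a x q = 0 \<and> umb_b x q = 0 \<and> umb_c x q = 0"

text \<open>At least one of the three conditions holds at a regular point, and where several hold the
  prescribed values agree.\<close>

definition umbilic_multiplicity :: "(real \<times> real \<Rightarrow> real^3) \<Rightarrow> real \<times> real \<Rightarrow> enat" where
  "umbilic_multiplicity x q = (THE m.
     (fffE x q \<noteq> 0 \<longrightarrow> m = multiplicity2 (umb_b x) (umb_c x) q) \<and>
     (fffF x q \<noteq> 0 \<longrightarrow> m = multiplicity2 (umb_a x) (umb_c x) q) \<and>
     (fffG x q \<noteq> 0 \<longrightarrow> m = multiplicity2 (umb_a x) (umb_b x) q))"


section \<open>Regular analytic surfaces\<close>

definition local_param :: "(real^3) set \<Rightarrow> (real \<times> real) set \<Rightarrow> (real \<times> real \<Rightarrow> real^3) \<Rightarrow> bool" where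
  "local_param M D x \<longleftrightarrow> open D \<and>
     (\<forall>z\<in>D. \<forall>i. analytic2_at (\<lambda>w. x w $ i) z) \<and>
     (\<forall>z\<in>D. \<forall>\<alpha> \<beta>. \<alpha> *\<^sub>R pdu x z + \<beta> *\<^sub>R pdv x z = 0 \<longrightarrow> \<alpha> = 0 \<and> \<beta> = 0) \<and>
     openin (top_of_set M) (x ` D) \<and> (\<exists>g. homeomorphism D (x ` D) x g)"

definition regular_analytic_surface :: "(real^3) set \<Rightarrow> bool" where
  "regular_analytic_surface M \<longleftrightarrow> (\<forall>p\<in>M. \<exists>D x. local_param M D x \<and> p \<in> x ` D)"

definition tangent_plane :: "(real^3) set \<Rightarrow> real^3 \<Rightarrow> (real^3) set" where
  "tangent_plane M p =
     {w. \<exists>D y r. local_param M D y \<and> r \<in> D \<and> y r = p \<and> w \<in> span {pdu y r, pdv y r}}"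

text \<open>Smooth maps on a relatively open subset \<open>W\<close> of \<open>M\<close>.\<close>

definition smooth_on_surface :: "(real^3) set \<Rightarrow> (real^3) set \<Rightarrow> (real^3 \<Rightarrow> real^3) \<Rightarrow> bool" where
  "smooth_on_surface M W e \<longleftrightarrow> (\<forall>D y. local_param M D y \<longrightarrow> smooth2_on (D \<inter> y -` W) (e \<circ> y))"


section \<open>Jets\<close>

text \<open>The polynomial $\sum_{s=1}^k\sum_{i=0}^s a_{si}x^{s-i}y^i$ is given by its family of
  coefficients \<open>a s i\<close>, extended by zero.\<close>

type_synonym jet = "nat \<Rightarrow> nat \<Rightarrow> real"

definition jet_space :: "nat \<Rightarrow> jet set" where
  "jet_space k = {a. \<forall>s i. a s i \<noteq> 0 \<longrightarrow> 1 \<le> s \<and> s \<le> k \<and> i \<le> s}"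

definition jet_space2 :: "nat \<Rightarrow> jet set" where
  "jet_space2 k = {a. \<forall>s i. a s i \<noteq> 0 \<longrightarrow> 2 \<le> s \<and> s \<le> k \<and> i \<le> s}"

definition jet_poly :: "nat \<Rightarrow> jet \<Rightarrow> real \<times> real \<Rightarrow> real" where
  "jet_poly k a z = (\<Sum>s=1..k. \<Sum>i\<le>s. a s i * fst z ^ (s - i) * snd z ^ i)"

definition taylor_jet :: "nat \<Rightarrow> (real \<times> real \<Rightarrow> real) \<Rightarrow> jet" where
  "taylor_jet k f = (\<lambda>s i. if 1 \<le> s \<and> s \<le> k \<and> i \<le> s
     then (pdu ^^ (s - i)) ((pdv ^^ i) f) (0, 0) / (fact (s - i) * fact i) else 0)"


section \<open>Monge-Taylor maps and the umbilic stratum\<close>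

definition frame_graph :: "real^3 \<Rightarrow> real^3 \<Rightarrow> real^3 \<Rightarrow> (real \<times> real \<Rightarrow> real) \<Rightarrow> real \<times> real \<Rightarrow> real^3" where
  "frame_graph u v w f z = fst z *\<^sub>R u + snd z *\<^sub>R v + f z *\<^sub>R w"

text \<open>In the coordinates of the frame \<open>u, v, w\<close> centred at \<open>p\<close>, the surface is, near \<open>p\<close>, the graph
  of \<open>f\<close>.\<close>

definition monge_function ::
  "(real^3) set \<Rightarrow> real^3 \<Rightarrow> real^3 \<Rightarrow> real^3 \<Rightarrow> real^3 \<Rightarrow> (real \<times> real \<Rightarrow> real) \<Rightarrow> bool" where
  "monge_function M p u v w f \<longleftrightarrow> f (0, 0) = 0 \<and> analytic2_at f (0, 0) \<and>
     (\<exists>N D. open N \<and> p \<in> N \<and> open D \<and> (0, 0) \<in> D \<and>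
        M \<inter> N = (\<lambda>z. p + frame_graph u v w f z) ` D)"

definition umbilic_stratum :: "nat \<Rightarrow> real^3 \<Rightarrow> real^3 \<Rightarrow> real^3 \<Rightarrow> jet set \<Rightarrow> jet set" where
  "umbilic_stratum k u v w J = {a \<in> J. umbilic_at (frame_graph u v w (jet_poly k a)) (0, 0)}"

text \<open>Orthonormal frame at \<open>p\<close> with \<open>e1, e2\<close> tangent and \<open>e3\<close> normal to \<open>M\<close>.  For \<open>\<epsilon> = 1\<close> the
  tangent plane is spacelike and \<open>e3\<close> timelike; for \<open>\<epsilon> = -1\<close> the vector \<open>e2\<close> is timelike and \<open>e3\<close>
  spacelike.\<close>

definition adapted_frame :: "(real^3) set \<Rightarrow> real \<Rightarrow> real^3 \<Rightarrow> real^3 \<Rightarrow> real^3 \<Rightarrow> real^3 \<Rightarrow> bool" where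
  "adapted_frame M \<epsilon> p e1 e2 e3 \<longleftrightarrow>
     mink e1 e1 = 1 \<and> mink e2 e2 = \<epsilon> \<and> mink e3 e3 = - \<epsilon> \<and>
     mink e1 e2 = 0 \<and> mink e1 e3 = 0 \<and> mink e2 e3 = 0 \<and>
     (\<forall>t\<in>tangent_plane M p. mink e3 t = 0)"

definition moving_monge_taylor ::
  "(real^3) set \<Rightarrow> nat \<Rightarrow> real \<Rightarrow> real^3 \<Rightarrow> (real^3 \<Rightarrow> jet) \<Rightarrow> bool" where
  "moving_monge_taylor M k \<epsilon> p0 \<theta> \<longleftrightarrow> (\<exists>W e1 e2 e3.
     openin (top_of_set M) W \<and> p0 \<in> W \<and>
     smooth_on_surface M W e1 \<and> smooth_on_surface M W e2 \<and> smooth_on_surface M W e3 \<and>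
     (\<forall>p\<in>W. adapted_frame M \<epsilon> p (e1 p) (e2 p) (e3 p) \<and>
       (\<exists>f. monge_function M p (e1 p) (e2 p) (e3 p) f \<and> \<theta> p = taylor_jet k f)))"

definition fixed_monge_taylor ::
  "(real^3) set \<Rightarrow> nat \<Rightarrow> real^3 \<Rightarrow> real^3 \<Rightarrow> real^3 \<Rightarrow> real^3 \<Rightarrow> (real^3 \<Rightarrow> jet) \<Rightarrow> bool" where
  "fixed_monge_taylor M k u v w p0 \<theta> \<longleftrightarrow> det (vector [u, v, w] :: real^3^3) \<noteq> 0 \<and> (\<exists>W.
     openin (top_of_set M) W \<and> p0 \<in> W \<and>
     (\<forall>p\<in>W. w \<notin> tangent_plane M p \<and>
       (\<exists>f. monge_function M p u v w f \<and> \<theta> p = taylor_jet k f)))"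

text \<open>\<open>\<theta>\<close> is a Monge-Taylor map near \<open>x q\<close> with values in \<open>J\<close>, and \<open>S\<close> is the umbilic stratum in \<open>J\<close>.
  The graphs defining the stratum are $z=f(x,y)$ in the Riemannian case, $y=f(x,z)$ in the
  Lorentzian case, and graphs in the chosen fixed frame in the lightlike case.\<close>

inductive monge_taylor_map ::
  "(real^3) set \<Rightarrow> nat \<Rightarrow> (real \<times> real \<Rightarrow> real^3) \<Rightarrow> real \<times> real
     \<Rightarrow> (real^3 \<Rightarrow> jet) \<Rightarrow> jet set \<Rightarrow> jet set \<Rightarrow> bool"
  for M k x q \<theta> where
  spacelike: "monge_taylor_map M k x q \<theta> (jet_space2 k)
      (umbilic_stratum k (axis 1 1) (axis 2 1) (axis 3 1) (jet_space2 k))"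
    if "riemannian_at x q" "moving_monge_taylor M k 1 (x q) \<theta>"
| timelike: "monge_taylor_map M k x q \<theta> (jet_space2 k)
      (umbilic_stratum k (axis 1 1) (axis 3 1) (axis 2 1) (jet_space2 k))"
    if "lorentzian_at x q" "moving_monge_taylor M k (-1) (x q) \<theta>"
| lightlike: "monge_taylor_map M k x q \<theta> (jet_space k) (umbilic_stratum k u v w (jet_space k))"
    if "degenerate_at x q" "fixed_monge_taylor M k u v w (x q) \<theta>"

text \<open>Velocities at \<open>a\<close> of curves in \<open>S\<close>; this is the tangent space, since the umbilic stratum is
  a submanifold.  Curves of jets are differentiated coefficientwise.\<close>

definition jet_tangent :: "jet set \<Rightarrow> jet \<Rightarrow> jet set" where
  "jet_tangent S a = {b. \<exists>\<gamma> :: real \<Rightarrow> jet. \<gamma> 0 = a \<and> (\<forall>\<^sub>F t in nhds 0. \<gamma> t \<in> S) \<and>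
     (\<forall>s i. ((\<lambda>t. \<gamma> t s i) has_real_derivative b s i) (at 0))}"

definition jet_differential :: "(real \<times> real \<Rightarrow> jet) \<Rightarrow> real \<times> real \<Rightarrow> real \<times> real \<Rightarrow> jet" where
  "jet_differential g q d = (\<lambda>s i. frechet_derivative (\<lambda>z. g z s i) (at q) d)"

text \<open>Transversality at \<open>x q\<close> of a map \<open>\<theta>\<close> on the surface to a submanifold \<open>S\<close> of the jet space \<open>J\<close>:
  the image of the differential (computed in the parametrisation \<open>x\<close>) and the tangent space of \<open>S\<close>
  span \<open>J\<close>.\<close>

definition transverse_to ::
  "(real^3 \<Rightarrow> jet) \<Rightarrow> (real \<times> real \<Rightarrow> real^3) \<Rightarrow> real \<times> real \<Rightarrow> jet set \<Rightarrow> jet set \<Rightarrow> bool" where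
  "transverse_to \<theta> x q J S \<longleftrightarrow> (\<theta> (x q) \<in> S \<longrightarrow>
     (\<forall>a\<in>J. \<exists>d. \<exists>b\<in>jet_tangent S (\<theta> (x q)).
        a = (\<lambda>s i. jet_differential (\<theta> \<circ> x) q d s i + b s i)))"

end

theory Submission
  imports Defs "HOL-Complex_Analysis.Cauchy_Integral_Formula"
begin

text \<open>
  Both sides say that one linear map has trivial kernel, namely the differential at \<open>q\<close> of the three
  umbilic functions $(\mathfrak a,\mathfrak b,\mathfrak c)$, regarded as a map from the plane to
  three-space.

  The three functions are the $2\times 2$ minors of the pair of fundamental forms $(E,F,G)$,
  $(\bar l,\bar m,\bar n)$, so they satisfy the syzygy
  $E\mathfrak a-F\mathfrak b+G\mathfrak c=0$, and $(E,F,G)\neq 0$ because no plane is totally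
  isotropic (\<open>no_isotropic_plane\<close>).  Dividing by the nonzero coefficient shows that the pairs
  prescribed for the multiplicity generate the same ideal
  (\<open>umbilic_multiplicity_values\<close>).  The quotient by an ideal $\langle h,k\rangle$ with
  $h(q)=k(q)=0$ is one-dimensional exactly when the ideal is the maximal ideal, and by the lemma of
  Hadamard and Cramer's rule with an invertible determinant germ this happens exactly when $dh,dk$
  are linearly independent (\<open>germ_ideal_eq_maximal_iff\<close>).  By the syzygy, independence of the
  differentials of the chosen pair is injectivity of the differential of the triple
  (\<open>umbilic_multiplicity_eq_1_iff\<close>).

  For the other side, the umbilic stratum consists of the jets whose second fundamental form is
  proportional to the first one.  Three minors \<open>jetA, jetB, jetC\<close> cut it out, and its tangent space is
  the common kernel of their differentials (\<open>jet_tangent_umbilic_stratum\<close>): if $II=\kappa I$, a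
  tangent vector is realised by the curve $II(t)=(\kappa+t\mu)I(t)$.  The three differentials map the jet
  space onto the plane $ey_1-fy_2+gy_3=0$ given by the syzygy, where $(e,f,g)=I$.  Hence
  transversality means that $d(\mathrm{jetA},\mathrm{jetB},\mathrm{jetC})\circ d\theta$ maps the
  tangent plane of the surface onto that plane, which by counting dimensions means that it is injective.

  The two sides are linked by a change of parametrisation.  Let $P$ be the Jacobian matrix of the first
  two frame coordinates of the surface.  If $I$ and $II$ are the forms of the graph at the point, those of
  the given parametrisation are $P^TIP$ and a multiple of $P^TIIP$, so that the triple of minors is
  multiplied by an invertible matrix depending differentiably on the point (\<open>umb_in_Monge_frame\<close>).  At an umbilic point
  the triple vanishes, so only this matrix enters its differential.  The same formulas express the jet
  coefficients of order at most two as rational functions of differentiable data, whence \<open>\<theta>\<close> is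
  differentiable as far as needed.  The argument is the same for the moving orthonormal frames and for the
  fixed frames (\<open>umb_differential_injective_iff_transverse\<close>).
\<close>

section \<open>Double power series\<close>

text \<open>Absolute convergence on the closed polydisc of radius \<open>r\<close>, expressed by the coefficients alone so
  that it passes to Cauchy products and real or complex scalars alike.\<close>

definition conv2 :: "(nat \<Rightarrow> nat \<Rightarrow> 'a::real_normed_field) \<Rightarrow> real \<Rightarrow> bool" where
  "conv2 c r \<longleftrightarrow> 0 < r \<and> (\<lambda>(i, j). norm (c i j) * r ^ (i + j)) summable_on UNIV"

definition ps2 :: "(nat \<Rightarrow> nat \<Rightarrow> 'a::real_normed_field) \<Rightarrow> 'a \<Rightarrow> 'a \<Rightarrow> 'a" where
  "ps2 c s t = (\<Sum>\<^sub>\<infinity>(i, j). c i j * s ^ i * t ^ j)"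

lemma conv2_pos: "conv2 c r \<Longrightarrow> 0 < r"
  by (simp add: conv2_def)

lemma norm_term_le:
  fixes s t a :: "'a::real_normed_field"
  assumes "norm s \<le> r" "norm t \<le> r"
  shows "norm (a * s ^ i * t ^ j) \<le> norm a * r ^ (i + j)"
proof -
  have "0 \<le> r" using assms(1) norm_ge_zero order_trans by blast
  then have "norm s ^ i * norm t ^ j \<le> r ^ i * r ^ j"
    using assms by (intro mult_mono power_mono) auto
  then have "norm a * (norm s ^ i * norm t ^ j) \<le> norm a * (r ^ i * r ^ j)"
    by (intro mult_left_mono) auto
  then show ?thesis
    by (simp add: norm_mult norm_power power_add mult.assoc)
qed

lemma conv2_abs_summable:
  fixes c :: "nat \<Rightarrow> nat \<Rightarrow> 'a::{real_normed_field,banach}"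
  assumes "conv2 c r" "norm s \<le> r" "norm t \<le> r"
  shows "(\<lambda>ij. norm (case ij of (i, j) \<Rightarrow> c i j * s ^ i * t ^ j)) summable_on UNIV"
proof (rule Infinite_Sum.abs_summable_on_comparison_test')
  show "(\<lambda>(i, j). norm (c i j) * r ^ (i + j)) summable_on UNIV"
    using assms by (simp add: conv2_def)
qed (use norm_term_le[OF assms(2,3)] in auto)

lemma ps2_has_sum:
  fixes c :: "nat \<Rightarrow> nat \<Rightarrow> 'a::{real_normed_field,banach}"
  assumes "conv2 c r" "norm s \<le> r" "norm t \<le> r"
  shows "((\<lambda>(i, j). c i j * s ^ i * t ^ j) has_sum ps2 c s t) UNIV"
  unfolding ps2_def using Infinite_Sum.abs_summable_summable[OF conv2_abs_summable[OF assms]]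
  by (simp add: has_sum_infsum)

lemma conv2_mono:
  assumes "conv2 c r" "0 < r'" "r' \<le> r"
  shows "conv2 c r'"
proof -
  have "(\<lambda>(i, j). norm (c i j) * r' ^ (i + j)) summable_on UNIV"
  proof (rule summable_on_comparison_test)
    show "(\<lambda>(i, j). norm (c i j) * r ^ (i + j)) summable_on UNIV"
      using assms by (simp add: conv2_def)
  qed (use assms in \<open>auto intro!: mult_left_mono power_mono\<close>)
  then show ?thesis using assms by (simp add: conv2_def)
qed

text \<open>Adding one index to a large finite index set changes the partial sum by that term, and both sums
  are close to the limit.  The terms of a convergent series at a single point are therefore bounded, which
  is the input of Abel's estimate below.\<close>

lemma has_sum_terms_bounded:
  fixes f :: "'i \<Rightarrow> 'a::real_normed_vector"
  assumes "(f has_sum S) UNIV"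
  shows "\<exists>B>0. \<forall>i. norm (f i) \<le> B"
proof -
  obtain F where F: "finite F" "\<And>G. finite G \<Longrightarrow> F \<subseteq> G \<Longrightarrow> dist (sum f G) S \<le> 1"
    using assms unfolding has_sum_def tendsto_iff eventually_finite_subsets_at_top
    by (metis subset_UNIV zero_less_one less_imp_le)
  have out: "norm (f i) \<le> 2" if "i \<notin> F" for i
  proof -
    have "f i = (sum f (insert i F) - S) - (sum f F - S)"
      using that F(1) by simp
    also have "norm \<dots> \<le> norm (sum f (insert i F) - S) + norm (sum f F - S)"
      by (rule norm_triangle_ineq4)
    also have "\<dots> \<le> 1 + 1"
      using F(2)[of "insert i F"] F(2)[of F] F(1) by (intro add_mono) (auto simp: dist_norm)
    finally show ?thesis by simp
  qed
  have "norm (f i) \<le> 2 + (\<Sum>i\<in>F. norm (f i))" for i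
  proof (cases "i \<in> F")
    case True
    then show ?thesis using member_le_sum[of i F "\<lambda>i. norm (f i)"] F(1) by auto
  next
    case False
    then show ?thesis using out[of i] sum_nonneg[of F "\<lambda>i. norm (f i)"] by auto
  qed
  then show ?thesis
    by (intro exI[of _ "2 + (\<Sum>i\<in>F. norm (f i))"]) (auto intro!: add_pos_nonneg sum_nonneg)
qed

lemma norm_times_summable:
  fixes f :: "'i \<Rightarrow> 'a::real_normed_field" and g :: "'j \<Rightarrow> 'a"
  assumes "(\<lambda>x. norm (f x)) summable_on UNIV" "(\<lambda>y. norm (g y)) summable_on UNIV"
  shows "(\<lambda>xy. norm (case xy of (x, y) \<Rightarrow> f x * g y)) summable_on (UNIV \<times> UNIV)"
proof (subst Infinite_Sum.abs_summable_on_Sigma_iff, intro conjI ballI)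
  show "(\<lambda>y. norm (case (x, y) of (x, y) \<Rightarrow> f x * g y)) summable_on UNIV" for x
    using summable_on_cmult_right[OF assms(2), of "norm (f x)"] by (simp add: norm_mult)
  have "(\<lambda>x. norm (f x) * (\<Sum>\<^sub>\<infinity>y. norm (g y))) summable_on UNIV"
    by (rule summable_on_cmult_left[OF assms(1)])
  then show "(\<lambda>x. norm (\<Sum>\<^sub>\<infinity>y. norm (case (x, y) of (x, y) \<Rightarrow> f x * g y))) summable_on UNIV"
    using assms(2) by (simp add: norm_mult infsum_cmult_right abs_mult infsum_nonneg)
qed

lemma geometric2_summable:
  fixes a :: real
  assumes "0 \<le> a" "a < 1"
  shows "(\<lambda>(i::nat, j::nat). a ^ (i + j)) summable_on UNIV"
proof -
  have 1: "(\<lambda>i. a ^ i) summable_on (UNIV::nat set)"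
    using assms by (simp add: summable_on_UNIV_nonneg_real_iff)
  have "(\<lambda>(i::nat, j::nat). a ^ i * a ^ j) summable_on (UNIV \<times> UNIV)"
    using norm_times_summable[of "\<lambda>i::nat. a ^ i" "\<lambda>i::nat. a ^ i"] 1 assms(1)
    by (simp add: case_prod_unfold abs_mult)
  then show ?thesis by (simp add: power_add)
qed

text \<open>Abel's lemma: at a smaller radius a double geometric series dominates.\<close>

lemma conv2_if_bounded:
  assumes "0 < r'" "r' < r" "\<And>i j. norm (c i j) * r ^ (i + j) \<le> B"
  shows "conv2 c r'"
proof -
  have "(\<lambda>(i, j). norm (c i j) * r' ^ (i + j)) summable_on UNIV"
  proof (rule summable_on_comparison_test)
    show "(\<lambda>(i::nat, j::nat). B * (r' / r) ^ (i + j)) summable_on UNIV"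
      using summable_on_cmult_right[OF geometric2_summable[of "r' / r"], of B] assms
      by (simp add: case_prod_unfold)
    fix ij :: "nat \<times> nat"
    obtain i j where ij: "ij = (i, j)" by force
    have "norm (c i j) * r' ^ (i + j) = norm (c i j) * r ^ (i + j) * (r' / r) ^ (i + j)"
      using assms by (simp add: power_divide)
    also have "\<dots> \<le> B * (r' / r) ^ (i + j)"
      using assms by (intro mult_right_mono) auto
    finally show "(case ij of (i, j) \<Rightarrow> norm (c i j) * r' ^ (i + j)) \<le> (case ij of (i, j) \<Rightarrow> B * (r' / r) ^ (i + j))"
      by (simp add: ij)
  qed (use assms in auto)
  then show ?thesis using assms by (simp add: conv2_def)
qed

lemma eventually_nhds_polydisc:
  fixes q :: "'a::real_normed_vector \<times> 'b::real_normed_vector"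
  assumes "0 < r"
  shows "\<forall>\<^sub>F z in nhds q. norm (fst z - fst q) < r \<and> norm (snd z - snd q) < r"
  unfolding eventually_nhds_metric
proof (intro exI[of _ r] conjI allI impI assms)
  fix z assume "dist z q < r"
  then show "norm (fst z - fst q) < r" "norm (snd z - snd q) < r"
    using dist_fst_le[of z q] dist_snd_le[of z q] by (auto simp: dist_norm)
qed

text \<open>The family \<open>c\<close> consists of the Taylor coefficients of \<open>f\<close> at \<open>q\<close>.  The germ operations below act on
  coefficient families, which makes the first-order part of a germ directly readable.\<close>

definition expansion2 :: "('a::real_normed_field \<times> 'a \<Rightarrow> 'a) \<Rightarrow> 'a \<times> 'a \<Rightarrow> (nat \<Rightarrow> nat \<Rightarrow> 'a) \<Rightarrow> bool" where
  "expansion2 f q c \<longleftrightarrow> (\<exists>r. conv2 c r) \<and> (\<forall>\<^sub>F z in nhds q. f z = ps2 c (fst z - fst q) (snd z - snd q))"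

lemma expansion2I:
  "conv2 c r \<Longrightarrow> \<forall>\<^sub>F z in nhds q. f z = ps2 c (fst z - fst q) (snd z - snd q) \<Longrightarrow> expansion2 f q c"
  by (auto simp: expansion2_def)

lemma expansion2_cong:
  assumes "\<forall>\<^sub>F z in nhds q. f z = g z" "expansion2 f q c"
  shows "expansion2 g q c"
proof -
  have "\<forall>\<^sub>F z in nhds q. f z = ps2 c (fst z - fst q) (snd z - snd q)"
    using assms(2) by (simp add: expansion2_def)
  with assms(1) have "\<forall>\<^sub>F z in nhds q. g z = ps2 c (fst z - fst q) (snd z - snd q)"
    by eventually_elim simp
  then show ?thesis using assms(2) by (simp add: expansion2_def)
qed

lemma expansion2E:
  assumes "expansion2 f q c"
  obtains r where "conv2 c r"
    "\<And>z. norm (fst z - fst q) \<le> r \<Longrightarrow> norm (snd z - snd q) \<le> r \<Longrightarrow> f z = ps2 c (fst z - fst q) (snd z - snd q)"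
proof -
  obtain r where r: "conv2 c r" using assms by (auto simp: expansion2_def)
  obtain e where e: "0 < e" "\<And>z. dist z q < e \<Longrightarrow> f z = ps2 c (fst z - fst q) (snd z - snd q)"
    using assms unfolding expansion2_def eventually_nhds_metric by blast
  let ?r = "min r (e / 4)"
  have r': "0 < ?r" using conv2_pos[OF r] e(1) by simp
  have "dist z q < e" if "norm (fst z - fst q) \<le> ?r" "norm (snd z - snd q) \<le> ?r" for z
  proof -
    have "dist z q \<le> dist (fst z) (fst q) + dist (snd z) (snd q)"
      unfolding dist_prod_def using sqrt_sum_squares_le_sum by auto
    also have "\<dots> \<le> ?r + ?r" using that by (intro add_mono) (auto simp: dist_norm)
    also have "\<dots> < e" using e(1) by simp
    finally show ?thesis .
  qed
  then show thesis
    by (intro that[OF conv2_mono[OF r r']]) (use e(2) in auto)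
qed

text \<open>Pointwise summability near \<open>q\<close> already gives a polydisc of absolute convergence: it is
  used at a single point whose offsets from \<open>q\<close> have the same modulus in both variables.\<close>

lemma analytic2_at_iff:
  fixes f :: "'a::{real_normed_field,banach} \<times> 'a \<Rightarrow> 'a"
  shows "analytic2_at f q \<longleftrightarrow> (\<exists>c. expansion2 f q c)"
proof
  assume "analytic2_at f q"
  then obtain c where c: "\<forall>\<^sub>F z in nhds q. ((\<lambda>(i, j). c i j * (fst z - fst q) ^ i * (snd z - snd q) ^ j) has_sum f z) UNIV"
    by (auto simp: analytic2_at_def)
  then obtain e where e: "0 < e" "\<And>z. dist z q < e \<Longrightarrow> ((\<lambda>(i, j). c i j * (fst z - fst q) ^ i * (snd z - snd q) ^ j) has_sum f z) UNIV"
    unfolding eventually_nhds_metric by blast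
  define r where "r = e / 4"
  have r: "0 < r" using e by (simp add: r_def)
  let ?z = "(fst q + of_real r, snd q + of_real r)"
  have "dist ?z q \<le> dist (fst ?z) (fst q) + dist (snd ?z) (snd q)"
    unfolding dist_prod_def using sqrt_sum_squares_le_sum by auto
  also have "\<dots> < e" using e(1) r by (simp add: dist_norm r_def)
  finally have "((\<lambda>(i, j). c i j * of_real r ^ i * of_real r ^ j) has_sum f ?z) UNIV"
    using e(2)[of ?z] by simp
  from has_sum_terms_bounded[OF this]
  obtain B where B: "\<And>ij. norm (case ij of (i, j) \<Rightarrow> c i j * of_real r ^ i * of_real r ^ j) \<le> B"
    by blast
  have "norm (c i j) * r ^ (i + j) \<le> B" for i j
    using B[of "(i, j)"] r by (simp add: norm_mult norm_power power_add mult.assoc)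
  then have cv: "conv2 c (r / 2)"
    using r by (intro conv2_if_bounded[of _ r]) auto
  have "\<forall>\<^sub>F z in nhds q. f z = ps2 c (fst z - fst q) (snd z - snd q)"
    using c unfolding ps2_def by eventually_elim (simp add: infsumI)
  then show "\<exists>c. expansion2 f q c" using expansion2I[OF cv] by blast
next
  assume "\<exists>c. expansion2 f q c"
  then obtain c r where c: "conv2 c r" "\<forall>\<^sub>F z in nhds q. f z = ps2 c (fst z - fst q) (snd z - snd q)"
    by (auto simp: expansion2_def)
  have "\<forall>\<^sub>F z in nhds q. ((\<lambda>(i, j). c i j * (fst z - fst q) ^ i * (snd z - snd q) ^ j) has_sum f z) UNIV"
    using c(2) eventually_nhds_polydisc[OF conv2_pos[OF c(1)], of q]
    by eventually_elim (use ps2_has_sum[OF c(1)] in auto)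
  then show "analytic2_at f q" by (auto simp: analytic2_at_def)
qed

text \<open>Summation over \<open>j\<close> first turns a double series into a power series in \<open>s\<close> whose coefficients are
  power series in \<open>t\<close>.  Uniqueness and differentiation thus reduce to one variable.\<close>

lemma ps2_rows:
  fixes c :: "nat \<Rightarrow> nat \<Rightarrow> 'a::{real_normed_field,banach}"
  assumes "conv2 c r" "norm s \<le> r" "norm t \<le> r"
  shows "(\<lambda>i. (\<Sum>\<^sub>\<infinity>j. c i j * t ^ j) * s ^ i) sums ps2 c s t"
    and "(\<lambda>j. c i j * t ^ j) sums (\<Sum>\<^sub>\<infinity>j. c i j * t ^ j)"
proof -
  have row: "(\<lambda>j. c i j * t ^ j) summable_on UNIV" for i
  proof -
    have r: "0 < r" using assms by (simp add: conv2_def)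
    have "(\<lambda>(i, j). c i j * of_real r ^ i * t ^ j) summable_on (UNIV \<times> UNIV)"
      using Infinite_Sum.abs_summable_summable[OF conv2_abs_summable[OF assms(1) _ assms(3), of "of_real r"]] r by simp
    then have "(\<lambda>(i, j). c i j * of_real r ^ i * t ^ j) summable_on range (Pair i)"
      by (rule summable_on_subset_banach) auto
    then have "(\<lambda>j. c i j * of_real r ^ i * t ^ j) summable_on UNIV"
      by (subst (asm) summable_on_reindex) (auto simp: inj_on_def o_def)
    then have "(\<lambda>j. inverse (of_real r ^ i) * (c i j * of_real r ^ i * t ^ j)) summable_on UNIV"
      by (rule summable_on_cmult_right)
    then show ?thesis using r by (simp add: field_simps)
  qed
  show "(\<lambda>j. c i j * t ^ j) sums (\<Sum>\<^sub>\<infinity>j. c i j * t ^ j)"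
    using has_sum_imp_sums[OF has_sum_infsum[OF row]] .
  have "((\<lambda>i. (\<Sum>\<^sub>\<infinity>j. c i j * t ^ j) * s ^ i) has_sum ps2 c s t) UNIV"
  proof (rule has_sum_SigmaD)
    show "((\<lambda>(i, j). c i j * s ^ i * t ^ j) has_sum ps2 c s t) (SIGMA i:UNIV. UNIV)"
      using ps2_has_sum[OF assms] by simp
    fix i :: nat
    have "((\<lambda>j. c i j * t ^ j * s ^ i) has_sum (\<Sum>\<^sub>\<infinity>j. c i j * t ^ j) * s ^ i) UNIV"
      by (intro has_sum_cmult_left) (use row in \<open>simp add: has_sum_infsum\<close>)
    then show "((\<lambda>j. case (i, j) of (i, j) \<Rightarrow> c i j * s ^ i * t ^ j) has_sum (\<Sum>\<^sub>\<infinity>j. c i j * t ^ j) * s ^ i) UNIV"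
      by (simp add: mult_ac)
  qed
  then show "(\<lambda>i. (\<Sum>\<^sub>\<infinity>j. c i j * t ^ j) * s ^ i) sums ps2 c s t"
    by (rule has_sum_imp_sums)
qed

lemma conv2_swap: "conv2 c r \<Longrightarrow> conv2 (\<lambda>i j. c j i) r"
  unfolding conv2_def
  using summable_on_reindex_bij_witness[of UNIV prod.swap prod.swap UNIV "\<lambda>(i, j). norm (c i j) * r ^ (i + j)" "\<lambda>(i, j). norm (c j i) * r ^ (i + j)"]
  by (auto simp: add.commute)

lemma ps2_swap: "ps2 (\<lambda>i j. c j i) s t = ps2 c t s"
  unfolding ps2_def
  by (rule infsum_reindex_bij_witness[of UNIV prod.swap prod.swap UNIV]) (auto simp: mult_ac)

text \<open>The zeros of a nonzero power series are isolated, whereas the real points accumulate at the centre.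
  Only real points are tested, as the series will be compared with a real analytic function.\<close>

lemma powser_zero_coeffs:
  fixes a :: "nat \<Rightarrow> 'a::{real_normed_field,banach}"
  assumes "0 < r" "\<And>x. norm x < r \<Longrightarrow> summable (\<lambda>n. a n * x ^ n)"
    and "0 < e" "\<And>s. \<bar>s\<bar> < e \<Longrightarrow> (\<Sum>n. a n * of_real s ^ n) = 0"
  shows "a m = 0"
proof (rule ccontr)
  assume m: "a m \<noteq> 0"
  define f where "f x = (\<Sum>n. a n * x ^ n)" for x
  have f0: "f 0 = 0" using assms(4)[of 0] assms(3) by (simp add: f_def)
  have "f 0 = a 0" unfolding f_def by (rule powser_zero)
  then have "m > 0" using m f0 by (intro Nat.gr0I) auto
  obtain s where s: "0 < s" "\<And>z. z \<in> cball 0 s - {0} \<Longrightarrow> f z \<noteq> 0"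
  proof (rule powser_0_nonzero[of r 0 a f m])
    fix x :: 'a assume "norm (x - 0) < r"
    then show "(\<lambda>n. a n * (x - 0) ^ n) sums f x"
      using assms(2)[of x] by (simp add: f_def summable_sums)
  qed (use m \<open>m > 0\<close> assms f0 in auto)
  define t where "t = min s (e / 2)"
  have "t > 0" "t \<le> s" "t < e" using s assms(3) by (auto simp: t_def min_def)
  then have "f (of_real t) \<noteq> 0" by (intro s) (auto simp: norm_of_real)
  moreover have "f (of_real t) = 0" using assms(4)[of t] \<open>t > 0\<close> \<open>t < e\<close> by (simp add: f_def)
  ultimately show False by simp
qed

lemma ps2_zero_coeffs:
  fixes c :: "nat \<Rightarrow> nat \<Rightarrow> 'a::{real_normed_field,banach}"
  assumes "conv2 c r" "0 < e"
    and "\<And>s t. \<bar>s\<bar> < e \<Longrightarrow> \<bar>t\<bar> < e \<Longrightarrow> ps2 c (of_real s) (of_real t) = 0"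
  shows "c i j = 0"
proof -
  define d where "d = min e r"
  have d: "0 < d" "d \<le> e" "d \<le> r" using assms(2) conv2_pos[OF assms(1)] by (auto simp: d_def)
  have row: "(\<Sum>\<^sub>\<infinity>j. c i j * of_real t ^ j) = 0" if t: "\<bar>t\<bar> < d" for i t
  proof (rule powser_zero_coeffs[of d "\<lambda>i. \<Sum>\<^sub>\<infinity>j. c i j * of_real t ^ j" d])
    show "summable (\<lambda>n. (\<Sum>\<^sub>\<infinity>j. c n j * of_real t ^ j) * x ^ n)" if "norm x < d" for x
      using ps2_rows(1)[OF assms(1), of x "of_real t"] that t d by (auto simp: sums_iff)
    show "(\<Sum>n. (\<Sum>\<^sub>\<infinity>j. c n j * of_real t ^ j) * of_real s ^ n) = 0" if "\<bar>s\<bar> < d" for s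
      using ps2_rows(1)[OF assms(1), of "of_real s" "of_real t"] that t d assms(3)[of s t] by (auto simp: sums_iff)
  qed (use d in auto)
  show ?thesis
  proof (rule powser_zero_coeffs[of d "\<lambda>j. c i j" d])
    show "summable (\<lambda>n. c i n * x ^ n)" if "norm x < d" for x
      using ps2_rows(2)[OF assms(1), of 0 x i] that d by (auto simp: sums_iff)
    show "(\<Sum>n. c i n * of_real s ^ n) = 0" if "\<bar>s\<bar> < d" for s
      using ps2_rows(2)[OF assms(1), of 0 "of_real s" i] that d row[of s i] by (auto simp: sums_iff)
  qed (use d in auto)
qed

lemma conv2_add:
  assumes "conv2 c r" "conv2 d r"
  shows "conv2 (\<lambda>i j. c i j + d i j) r"
proof -
  have "(\<lambda>(i, j). norm (c i j + d i j) * r ^ (i + j)) summable_on UNIV"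
  proof (rule summable_on_comparison_test)
    show "(\<lambda>ij. (case ij of (i, j) \<Rightarrow> norm (c i j) * r ^ (i + j)) + (case ij of (i, j) \<Rightarrow> norm (d i j) * r ^ (i + j))) summable_on UNIV"
      using assms by (intro summable_on_add) (auto simp: conv2_def)
    show "(case ij of (i, j) \<Rightarrow> norm (c i j + d i j) * r ^ (i + j))
       \<le> (case ij of (i, j) \<Rightarrow> norm (c i j) * r ^ (i + j)) + (case ij of (i, j) \<Rightarrow> norm (d i j) * r ^ (i + j))" for ij
      using conv2_pos[OF assms(1)]
      by (auto simp: case_prod_unfold distrib_right[symmetric] intro!: mult_right_mono norm_triangle_ineq)
  qed (use conv2_pos[OF assms(1)] in auto)
  then show ?thesis using assms by (simp add: conv2_def)
qed

lemma ps2_add: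
  fixes c d :: "nat \<Rightarrow> nat \<Rightarrow> 'a::{real_normed_field,banach}"
  assumes "conv2 c r" "conv2 d r" "norm s \<le> r" "norm t \<le> r"
  shows "ps2 (\<lambda>i j. c i j + d i j) s t = ps2 c s t + ps2 d s t"
proof (rule has_sum_unique)
  show "((\<lambda>(i, j). (c i j + d i j) * s ^ i * t ^ j) has_sum ps2 (\<lambda>i j. c i j + d i j) s t) UNIV"
    by (rule ps2_has_sum[OF conv2_add[OF assms(1,2)] assms(3,4)])
  show "((\<lambda>(i, j). (c i j + d i j) * s ^ i * t ^ j) has_sum (ps2 c s t + ps2 d s t)) UNIV"
    using has_sum_add[OF ps2_has_sum[OF assms(1,3,4)] ps2_has_sum[OF assms(2,3,4)]]
    by (simp add: case_prod_unfold algebra_simps)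
qed

definition cauchy2 :: "(nat \<Rightarrow> nat \<Rightarrow> 'a::comm_ring_1) \<Rightarrow> (nat \<Rightarrow> nat \<Rightarrow> 'a) \<Rightarrow> nat \<Rightarrow> nat \<Rightarrow> 'a" where
  "cauchy2 c d m n = (\<Sum>(i, j)\<in>{..m} \<times> {..n}. c i j * d (m - i) (n - j))"

text \<open>The pairs of indices of the two factors are grouped by their sum.\<close>

lemma has_sum_cauchy2:
  fixes f g :: "nat \<Rightarrow> nat \<Rightarrow> 'b::{real_normed_field,banach}"
  assumes "(\<lambda>ij. norm (case ij of (i, j) \<Rightarrow> f i j)) summable_on UNIV"
    "(\<lambda>ij. norm (case ij of (i, j) \<Rightarrow> g i j)) summable_on UNIV"
  shows "((\<lambda>(m, n). cauchy2 f g m n) has_sum ((\<Sum>\<^sub>\<infinity>(i, j). f i j) * (\<Sum>\<^sub>\<infinity>(i, j). g i j))) UNIV"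
proof -
  let ?F = "\<lambda>(i, j). f i j" and ?G = "\<lambda>(i, j). g i j"
  let ?h = "\<lambda>((i, j), (k, l)). f i j * g k l"
  have sm: "(\<lambda>(x, y). ?F x * ?G y) summable_on (UNIV \<times> UNIV)"
    using Infinite_Sum.abs_summable_summable[OF norm_times_summable[OF assms]] .
  have "(\<Sum>\<^sub>\<infinity>(x, y)\<in>UNIV \<times> UNIV. ?F x * ?G y) = (\<Sum>\<^sub>\<infinity>x. \<Sum>\<^sub>\<infinity>y. ?F x * ?G y)"
    using infsum_Sigma'_banach[of "\<lambda>x y. ?F x * ?G y" UNIV "\<lambda>_. UNIV"] sm by simp
  also have "\<dots> = infsum ?F UNIV * infsum ?G UNIV"
    using Infinite_Sum.abs_summable_summable[OF assms(1)] Infinite_Sum.abs_summable_summable[OF assms(2)]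
    by (simp add: infsum_cmult_right infsum_cmult_left)
  finally have hs: "((\<lambda>(x, y). ?F x * ?G y) has_sum (infsum ?F UNIV * infsum ?G UNIV)) (UNIV \<times> UNIV)"
    using sm by (metis has_sum_infsum)
  have "((\<lambda>(p, x). f (fst x) (snd x) * g (fst p - fst x) (snd p - snd x)) has_sum (infsum ?F UNIV * infsum ?G UNIV))
      (SIGMA p:UNIV. {..fst p} \<times> {..snd p})"
  proof (subst has_sum_reindex_bij_witness[where i = "\<lambda>(x, y). ((fst x + fst y, snd x + snd y), x)"
        and j = "\<lambda>(p, x). (x, (fst p - fst x, snd p - snd x))" and T = "UNIV \<times> UNIV" and h = "\<lambda>(x, y). ?F x * ?G y"])
    show "((\<lambda>(x, y). ?F x * ?G y) has_sum (infsum ?F UNIV * infsum ?G UNIV)) (UNIV \<times> UNIV)" by (rule hs)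
  qed (auto simp: case_prod_unfold)
  from has_sum_SigmaD[OF this, of "\<lambda>p. cauchy2 f g (fst p) (snd p)"]
  show ?thesis
    by (auto simp: cauchy2_def case_prod_unfold intro!: has_sum_finiteI)
qed

lemma cauchy2_scale:
  fixes c d :: "nat \<Rightarrow> nat \<Rightarrow> 'a::comm_ring_1"
  shows "cauchy2 (\<lambda>i j. c i j * s ^ i * t ^ j) (\<lambda>i j. d i j * s ^ i * t ^ j) m n = cauchy2 c d m n * s ^ m * t ^ n"
  unfolding cauchy2_def sum_distrib_right
proof (rule sum.cong[OF refl], clarsimp)
  fix i j assume "i \<le> m" "j \<le> n"
  then have "s ^ m = s ^ i * s ^ (m - i)" "t ^ n = t ^ j * t ^ (n - j)"
    by (simp_all add: power_add[symmetric])
  then show "c i j * s ^ i * t ^ j * (d (m - i) (n - j) * s ^ (m - i) * t ^ (n - j)) = c i j * d (m - i) (n - j) * s ^ m * t ^ n"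
    by (simp add: algebra_simps)
qed

lemma
  fixes c d :: "nat \<Rightarrow> nat \<Rightarrow> 'a::{real_normed_field,banach}"
  assumes "conv2 c r" "conv2 d r"
  shows conv2_cauchy2: "conv2 (cauchy2 c d) r"
    and ps2_cauchy2: "norm s \<le> r \<Longrightarrow> norm t \<le> r \<Longrightarrow> ps2 (cauchy2 c d) s t = ps2 c s t * ps2 d s t"
proof -
  have r: "0 < r" using assms conv2_pos by blast
  have "(\<lambda>ij. norm (case ij of (i, j) \<Rightarrow> norm (c i j) * r ^ i * r ^ j)) summable_on UNIV"
    "(\<lambda>ij. norm (case ij of (i, j) \<Rightarrow> norm (d i j) * r ^ i * r ^ j)) summable_on UNIV"
    using assms r by (simp_all add: conv2_def case_prod_unfold power_add mult.assoc)
  from has_sum_imp_summable[OF has_sum_cauchy2[OF this]]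
  have sm: "(\<lambda>(m, n). cauchy2 (\<lambda>i j. norm (c i j)) (\<lambda>i j. norm (d i j)) m n * r ^ (m + n)) summable_on UNIV"
    unfolding cauchy2_scale by (simp add: power_add mult.assoc)
  have "(\<lambda>(m, n). norm (cauchy2 c d m n) * r ^ (m + n)) summable_on UNIV"
  proof (rule summable_on_comparison_test[OF sm])
    fix mn :: "nat \<times> nat"
    obtain m n where mn: "mn = (m, n)" by force
    have "norm (cauchy2 c d m n) \<le> cauchy2 (\<lambda>i j. norm (c i j)) (\<lambda>i j. norm (d i j)) m n"
      unfolding cauchy2_def by (rule order_trans[OF norm_sum]) (simp add: case_prod_unfold norm_mult)
    then show "(case mn of (m, n) \<Rightarrow> norm (cauchy2 c d m n) * r ^ (m + n))
      \<le> (case mn of (m, n) \<Rightarrow> cauchy2 (\<lambda>i j. norm (c i j)) (\<lambda>i j. norm (d i j)) m n * r ^ (m + n))"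
      using r by (simp add: mn mult_right_mono)
  qed (use r in auto)
  then show cv: "conv2 (cauchy2 c d) r" using r by (simp add: conv2_def)
  assume st: "norm s \<le> r" "norm t \<le> r"
  show "ps2 (cauchy2 c d) s t = ps2 c s t * ps2 d s t"
  proof (rule has_sum_unique[OF ps2_has_sum[OF cv st]])
    show "((\<lambda>(i, j). cauchy2 c d i j * s ^ i * t ^ j) has_sum (ps2 c s t * ps2 d s t)) UNIV"
      using has_sum_cauchy2[OF conv2_abs_summable[OF assms(1) st] conv2_abs_summable[OF assms(2) st]]
      by (simp add: cauchy2_scale ps2_def)
  qed
qed

lemma expansion2_common_radius:
  fixes f g :: "'a::{real_normed_field,banach} \<times> 'a \<Rightarrow> 'a"
  assumes "expansion2 f q c" "expansion2 g q d"
  obtains r where "conv2 c r" "conv2 d r"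
    "\<And>z. norm (fst z - fst q) \<le> r \<Longrightarrow> norm (snd z - snd q) \<le> r \<Longrightarrow> f z = ps2 c (fst z - fst q) (snd z - snd q)"
    "\<And>z. norm (fst z - fst q) \<le> r \<Longrightarrow> norm (snd z - snd q) \<le> r \<Longrightarrow> g z = ps2 d (fst z - fst q) (snd z - snd q)"
proof -
  obtain r where c: "conv2 c r"
    "\<And>z. norm (fst z - fst q) \<le> r \<Longrightarrow> norm (snd z - snd q) \<le> r \<Longrightarrow> f z = ps2 c (fst z - fst q) (snd z - snd q)"
    by (rule expansion2E[OF assms(1)]) blast
  obtain r' where d: "conv2 d r'"
    "\<And>z. norm (fst z - fst q) \<le> r' \<Longrightarrow> norm (snd z - snd q) \<le> r' \<Longrightarrow> g z = ps2 d (fst z - fst q) (snd z - snd q)"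
    by (rule expansion2E[OF assms(2)]) blast
  have "conv2 c (min r r')" "conv2 d (min r r')"
    using conv2_pos[OF c(1)] conv2_pos[OF d(1)]
    by (simp_all add: conv2_mono[OF c(1)] conv2_mono[OF d(1)])
  then show thesis
  proof (rule that)
    fix z :: "'a \<times> 'a"
    assume z: "norm (fst z - fst q) \<le> min r r'" "norm (snd z - snd q) \<le> min r r'"
    show "f z = ps2 c (fst z - fst q) (snd z - snd q)" by (rule c(2)) (use z in auto)
    show "g z = ps2 d (fst z - fst q) (snd z - snd q)" by (rule d(2)) (use z in auto)
  qed
qed

lemma expansion2_add:
  fixes f g :: "'a::{real_normed_field,banach} \<times> 'a \<Rightarrow> 'a"
  assumes "expansion2 f q c" "expansion2 g q d"
  shows "expansion2 (\<lambda>z. f z + g z) q (\<lambda>i j. c i j + d i j)"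
proof -
  obtain r where r: "conv2 c r" "conv2 d r"
    "\<And>z. norm (fst z - fst q) \<le> r \<Longrightarrow> norm (snd z - snd q) \<le> r \<Longrightarrow> f z = ps2 c (fst z - fst q) (snd z - snd q)"
    "\<And>z. norm (fst z - fst q) \<le> r \<Longrightarrow> norm (snd z - snd q) \<le> r \<Longrightarrow> g z = ps2 d (fst z - fst q) (snd z - snd q)"
    by (rule expansion2_common_radius[OF assms]) blast
  show ?thesis
  proof (rule expansion2I[OF conv2_add[OF r(1,2)]])
    show "\<forall>\<^sub>F z in nhds q. f z + g z = ps2 (\<lambda>i j. c i j + d i j) (fst z - fst q) (snd z - snd q)"
      using eventually_nhds_polydisc[OF conv2_pos[OF r(1)], of q]
      by eventually_elim (simp add: r(3,4) ps2_add[OF r(1,2)])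
  qed
qed

lemma expansion2_mult:
  fixes f g :: "'a::{real_normed_field,banach} \<times> 'a \<Rightarrow> 'a"
  assumes "expansion2 f q c" "expansion2 g q d"
  shows "expansion2 (\<lambda>z. f z * g z) q (cauchy2 c d)"
proof -
  obtain r where r: "conv2 c r" "conv2 d r"
    "\<And>z. norm (fst z - fst q) \<le> r \<Longrightarrow> norm (snd z - snd q) \<le> r \<Longrightarrow> f z = ps2 c (fst z - fst q) (snd z - snd q)"
    "\<And>z. norm (fst z - fst q) \<le> r \<Longrightarrow> norm (snd z - snd q) \<le> r \<Longrightarrow> g z = ps2 d (fst z - fst q) (snd z - snd q)"
    by (rule expansion2_common_radius[OF assms]) blast
  show ?thesis
  proof (rule expansion2I[OF conv2_cauchy2[OF r(1,2)]])
    show "\<forall>\<^sub>F z in nhds q. f z * g z = ps2 (cauchy2 c d) (fst z - fst q) (snd z - snd q)"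
      using eventually_nhds_polydisc[OF conv2_pos[OF r(1)], of q]
      by eventually_elim (simp add: r(3,4) ps2_cauchy2[OF r(1,2)])
  qed
qed

lemma analytic2_at_add:
  fixes f g :: "'a::{real_normed_field,banach} \<times> 'a \<Rightarrow> 'a"
  assumes "analytic2_at f q" "analytic2_at g q"
  shows "analytic2_at (\<lambda>z. f z + g z) q"
  using assms expansion2_add unfolding analytic2_at_iff by blast

lemma analytic2_at_mult:
  fixes f g :: "'a::{real_normed_field,banach} \<times> 'a \<Rightarrow> 'a"
  assumes "analytic2_at f q" "analytic2_at g q"
  shows "analytic2_at (\<lambda>z. f z * g z) q"
  using assms expansion2_mult unfolding analytic2_at_iff by blast

lemma has_sum_finite_support:
  assumes "finite A" "\<And>x. x \<notin> A \<Longrightarrow> f x = 0" 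
  shows "(f has_sum sum f A) UNIV"
  using assms has_sum_cong_neutral[of UNIV A f f] by (auto intro: has_sum_finite)

lemma
  assumes "finite A" "\<And>i j. (i, j) \<notin> A \<Longrightarrow> c i j = 0"
  shows conv2_finite_support: "0 < r \<Longrightarrow> conv2 c r"
    and ps2_finite_support: "ps2 c s t = (\<Sum>(i, j)\<in>A. c i j * s ^ i * t ^ j)"
proof -
  show "conv2 c r" if "0 < r"
    unfolding conv2_def
    using has_sum_finite_support[OF assms(1), of "\<lambda>(i, j). norm (c i j) * r ^ (i + j)"] assms(2) that
    by (auto intro: has_sum_imp_summable)
  show "ps2 c s t = (\<Sum>(i, j)\<in>A. c i j * s ^ i * t ^ j)"
    unfolding ps2_def
    using has_sum_finite_support[OF assms(1), of "\<lambda>(i, j). c i j * s ^ i * t ^ j"] assms(2)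
    by (auto intro!: infsumI)
qed

lemma expansion2_const:
  "expansion2 (\<lambda>_. a :: 'a::{real_normed_field,banach}) q (\<lambda>i j. if i = 0 \<and> j = 0 then a else 0)"
proof (rule expansion2I)
  show "conv2 (\<lambda>i j. if i = 0 \<and> j = 0 then a else 0) 1"
    by (rule conv2_finite_support[of "{(0, 0)}"]) auto
  show "\<forall>\<^sub>F z in nhds q. a = ps2 (\<lambda>i j. if i = 0 \<and> j = 0 then a else 0) (fst z - fst q) (snd z - snd q)"
    by (subst ps2_finite_support[of "{(0, 0)}"]) auto
qed

lemma analytic2_at_const [simp]:
  "analytic2_at (\<lambda>_. a :: 'a::{real_normed_field,banach}) q"
  using expansion2_const analytic2_at_iff by blast

lemma expansion2_fst:
  fixes q :: "'a::{real_normed_field,banach} \<times> 'a"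
  shows "expansion2 (\<lambda>z. fst z - fst q) q (\<lambda>i j. if i = 1 \<and> j = 0 then 1 else 0)"
proof (rule expansion2I)
  show "conv2 (\<lambda>i j. if i = 1 \<and> j = 0 then 1 else (0::'a)) 1"
    by (rule conv2_finite_support[of "{(1, 0)}"]) auto
  show "\<forall>\<^sub>F z in nhds q. fst z - fst q = ps2 (\<lambda>i j. if i = 1 \<and> j = 0 then 1 else 0) (fst z - fst q) (snd z - snd q)"
    by (subst ps2_finite_support[of "{(1, 0)}"]) auto
qed

lemma expansion2_snd:
  fixes q :: "'a::{real_normed_field,banach} \<times> 'a"
  shows "expansion2 (\<lambda>z. snd z - snd q) q (\<lambda>i j. if i = 0 \<and> j = 1 then 1 else 0)"
proof (rule expansion2I)
  show "conv2 (\<lambda>i j. if i = 0 \<and> j = 1 then 1 else (0::'a)) 1"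
    by (rule conv2_finite_support[of "{(0, 1)}"]) auto
  show "\<forall>\<^sub>F z in nhds q. snd z - snd q = ps2 (\<lambda>i j. if i = 0 \<and> j = 1 then 1 else 0) (fst z - fst q) (snd z - snd q)"
    by (subst ps2_finite_support[of "{(0, 1)}"]) auto
qed

lemma analytic2_at_cong:
  assumes "\<forall>\<^sub>F z in nhds q. f z = g z" "analytic2_at f q"
  shows "analytic2_at g q"
proof -
  obtain c where "\<forall>\<^sub>F z in nhds q. ((\<lambda>(i, j). c i j * (fst z - fst q) ^ i * (snd z - snd q) ^ j) has_sum f z) UNIV"
    using assms(2) by (auto simp: analytic2_at_def)
  with assms(1) have "\<forall>\<^sub>F z in nhds q. ((\<lambda>(i, j). c i j * (fst z - fst q) ^ i * (snd z - snd q) ^ j) has_sum g z) UNIV"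
    by eventually_elim simp
  then show ?thesis by (auto simp: analytic2_at_def)
qed

lemma analytic2_at_diff:
  fixes f g :: "'a::{real_normed_field,banach} \<times> 'a \<Rightarrow> 'a"
  assumes "analytic2_at f q" "analytic2_at g q"
  shows "analytic2_at (\<lambda>z. f z - g z) q"
  using analytic2_at_add[OF assms(1) analytic2_at_mult[OF analytic2_at_const[of "-1"] assms(2)]] by simp

section \<open>Differentiation of double power series\<close>

definition du :: "(nat \<Rightarrow> nat \<Rightarrow> 'a::real_normed_field) \<Rightarrow> nat \<Rightarrow> nat \<Rightarrow> 'a" where
  "du c i j = of_nat (Suc i) * c (Suc i) j"

definition dv :: "(nat \<Rightarrow> nat \<Rightarrow> 'a::real_normed_field) \<Rightarrow> nat \<Rightarrow> nat \<Rightarrow> 'a" where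
  "dv c i j = of_nat (Suc j) * c i (Suc j)"

lemma dv_eq_du_swap: "dv c = (\<lambda>i j. du (\<lambda>i j. c j i) j i)"
  by (simp add: dv_def du_def fun_eq_iff)

lemma conv2_bounded:
  assumes "conv2 c r"
  obtains B where "\<And>i j. norm (c i j) * r ^ (i + j) \<le> B"
proof -
  have "((\<lambda>(i, j). norm (c i j) * r ^ (i + j)) has_sum (\<Sum>\<^sub>\<infinity>(i, j). norm (c i j) * r ^ (i + j))) UNIV"
    using assms by (simp add: conv2_def has_sum_infsum)
  from has_sum_terms_bounded[OF this]
  obtain B where B: "\<And>ij. norm (case ij of (i, j) \<Rightarrow> norm (c i j) * r ^ (i + j)) \<le> B"
    by blast
  have "norm (c i j) * r ^ (i + j) \<le> B" for i j
    using B[of "(i, j)"] by (simp add: abs_le_iff)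
  then show thesis by (rule that)
qed

text \<open>The factor $i+1$ is absorbed by passing to an intermediate radius $R<r$, since $n(R/r)^n$ is
  bounded.\<close>

lemma conv2_du:
  assumes "conv2 c r" "0 < r'" "r' < r"
  shows "conv2 (du c) r'"
proof -
  obtain B where B: "\<And>i j. norm (c i j) * r ^ (i + j) \<le> B"
    by (rule conv2_bounded[OF assms(1)]) blast
  have B0: "0 \<le> B" using B[of 0 0] norm_ge_zero[of "c 0 0"] by (simp del: norm_ge_zero)
  define R where "R = (r + r') / 2"
  have R: "r' < R" "R < r" "0 < R" using assms by (auto simp: R_def)
  have "(\<lambda>n. of_nat n * (R / r) ^ n) \<longlonglongrightarrow> 0"
    by (rule powser_times_n_limit_0) (use R in auto)
  then have "Bseq (\<lambda>n. of_nat n * (R / r) ^ n)"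
    by (intro convergent_imp_Bseq convergentI)
  then obtain K where K: "0 < K" "\<And>n. norm (of_nat n * (R / r) ^ n) \<le> K"
    by (auto simp: Bseq_def)
  show ?thesis
  proof (rule conv2_if_bounded[of _ R])
    fix i j
    have "norm (du c i j) * R ^ (i + j) = (norm (c (Suc i) j) * r ^ (Suc i + j)) * (of_nat (Suc i) * (R / r) ^ Suc i) * (R / r) ^ j / R"
      using R by (simp add: du_def norm_mult power_divide power_add del: of_nat_Suc)
    also have "\<dots> \<le> B * K * 1 / R"
    proof (intro divide_right_mono mult_mono)
      show "of_nat (Suc i) * (R / r) ^ Suc i \<le> K"
        using K(2)[of "Suc i"] R by (simp add: abs_mult)
      show "norm (c (Suc i) j) * r ^ (Suc i + j) \<le> B" by (rule B)
    qed (use B0 R K(1) in \<open>auto intro!: power_le_one mult_nonneg_nonneg\<close>)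
    finally show "norm (du c i j) * R ^ (i + j) \<le> B * K * 1 / R" .
  qed (use assms R in auto)
qed

lemma ps2_DERIV_fst:
  fixes c :: "nat \<Rightarrow> nat \<Rightarrow> 'a::{real_normed_field,banach}"
  assumes "conv2 c r" "norm s < r" "norm t < r"
  shows "((\<lambda>s. ps2 c s t) has_field_derivative ps2 (du c) s t) (at s)"
proof -
  define C where "C i = (\<Sum>\<^sub>\<infinity>j. c i j * t ^ j)" for i
  have row: "(\<lambda>i. C i * z ^ i) sums ps2 c z t" if "norm z < r" for z
    unfolding C_def using ps2_rows(1)[OF assms(1)] that assms(3) by simp
  have 1: "((\<lambda>z. \<Sum>n. C n * z ^ n) has_field_derivative (\<Sum>n. diffs C n * s ^ n)) (at s)"
    by (rule termdiffs_strong'[of r]) (use row assms(2) in \<open>auto simp: sums_iff\<close>)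
  obtain r' where "max (norm s) (norm t) < r'" "r' < r"
    using dense[of "max (norm s) (norm t)" r] assms by auto
  then have r': "norm s < r'" "norm t < r'" "r' < r" "0 < r'"
    using norm_ge_zero[of s] by (auto simp del: norm_ge_zero)
  have "(\<lambda>i. (\<Sum>\<^sub>\<infinity>j. du c i j * t ^ j) * s ^ i) sums ps2 (du c) s t"
    using ps2_rows(1)[OF conv2_du[OF assms(1) r'(4,3)]] r' by simp
  moreover have "(\<Sum>\<^sub>\<infinity>j. du c i j * t ^ j) = diffs C i" for i
    unfolding du_def diffs_def C_def mult.assoc by (rule infsum_cmult_right')
  ultimately have 2: "(\<Sum>n. diffs C n * s ^ n) = ps2 (du c) s t"
    by (simp add: sums_iff)
  show ?thesis
  proof (rule has_field_derivative_transform_within_open[OF 1[unfolded 2]])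
    show "open (ball (0::'a) r)" "s \<in> ball 0 r" using assms by auto
    show "(\<Sum>n. C n * z ^ n) = ps2 c z t" if "z \<in> ball 0 r" for z
      using row[of z] that by (simp add: sums_iff)
  qed
qed

lemma ps2_DERIV_snd:
  fixes c :: "nat \<Rightarrow> nat \<Rightarrow> 'a::{real_normed_field,banach}"
  assumes "conv2 c r" "norm s < r" "norm t < r"
  shows "((\<lambda>t. ps2 c s t) has_field_derivative ps2 (dv c) s t) (at t)"
proof -
  have "ps2 (dv c) s t = ps2 (du (\<lambda>i j. c j i)) t s"
    unfolding dv_eq_du_swap by (rule ps2_swap)
  moreover have "(\<lambda>t. ps2 c s t) = (\<lambda>t. ps2 (\<lambda>i j. c j i) t s)"
    by (rule ext, rule ps2_swap[symmetric])
  ultimately show ?thesis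
    using ps2_DERIV_fst[OF conv2_swap[OF assms(1)] assms(3,2)] by simp
qed

lemma conv2_dv:
  assumes "conv2 c r" "0 < r'" "r' < r"
  shows "conv2 (dv c) r'"
  unfolding dv_eq_du_swap by (rule conv2_swap[OF conv2_du[OF conv2_swap[OF assms(1)] assms(2,3)]])

text \<open>Uniform limit of polynomials, by the Weierstrass M-test with the norms at radius \<open>r\<close>.\<close>

lemma continuous_on_ps2:
  fixes c :: "nat \<Rightarrow> nat \<Rightarrow> 'a::{real_normed_field,banach}"
  assumes "conv2 c r"
  shows "continuous_on (cball 0 r \<times> cball 0 r) (\<lambda>z. ps2 c (fst z) (snd z))"
proof (rule uniform_limit_theorem)
  show "uniform_limit (cball 0 r \<times> cball 0 r) (\<lambda>X z. \<Sum>ij\<in>X. c (fst ij) (snd ij) * fst z ^ fst ij * snd z ^ snd ij)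
    (\<lambda>z. ps2 c (fst z) (snd z)) (finite_subsets_at_top UNIV)"
  proof (rule Weierstrass_m_test_general')
    show "(\<lambda>ij. norm (c (fst ij) (snd ij)) * r ^ (fst ij + snd ij)) summable_on UNIV"
      using assms by (simp add: conv2_def case_prod_unfold)
    fix z :: "'a \<times> 'a" assume z: "z \<in> cball 0 r \<times> cball 0 r"
    then have z': "norm (fst z) \<le> r" "norm (snd z) \<le> r" by auto
    show "((\<lambda>ij. c (fst ij) (snd ij) * fst z ^ fst ij * snd z ^ snd ij) has_sum ps2 c (fst z) (snd z)) UNIV"
      using ps2_has_sum[OF assms z'] by (simp add: case_prod_unfold)
    show "norm (c (fst ij) (snd ij) * fst z ^ fst ij * snd z ^ snd ij) \<le> norm (c (fst ij) (snd ij)) * r ^ (fst ij + snd ij)" for ij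
      by (rule norm_term_le[OF z'])
  qed
qed (auto intro!: always_eventually continuous_intros)

lemma continuous_at_ps2:
  fixes c :: "nat \<Rightarrow> nat \<Rightarrow> 'a::{real_normed_field,banach}"
  assumes "conv2 c r" "norm s < r" "norm t < r"
  shows "isCont (\<lambda>z. ps2 c (fst z) (snd z)) (s, t)"
proof (rule continuous_on_interior[OF continuous_on_ps2[OF assms(1)]])
  have "ball 0 r \<times> ball 0 r \<subseteq> interior (cball (0::'a) r \<times> cball (0::'a) r)"
    by (intro interior_maximal open_Times) auto
  then show "(s, t) \<in> interior (cball 0 r \<times> cball 0 r)" using assms by auto
qed

text \<open>Both partial derivatives exist at all points of the polydisc and one of them is continuous, which
  suffices for total differentiability.\<close>

lemma ps2_has_derivative:
  fixes c :: "nat \<Rightarrow> nat \<Rightarrow> real"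
  assumes "conv2 c r" "norm s < r" "norm t < r"
  shows "((\<lambda>z. ps2 c (fst z) (snd z)) has_derivative (\<lambda>d. fst d * ps2 (du c) s t + snd d * ps2 (dv c) s t)) (at (s, t))"
proof -
  obtain r' where "max (norm s) (norm t) < r'" "r' < r"
    using dense[of "max (norm s) (norm t)" r] assms by auto
  then have r': "norm s < r'" "norm t < r'" "r' < r" "0 < r'"
    using norm_ge_zero[of s] by (auto simp del: norm_ge_zero)
  let ?fy = "\<lambda>s t. blinfun_scaleR_left (ps2 (dv c) s t)"
  have "((\<lambda>(x, y). ps2 c x y) has_derivative (\<lambda>(tx, ty). tx * ps2 (du c) s t + ?fy s t ty)) (at (s, t) within ball 0 r' \<times> ball 0 r')"
  proof (rule has_derivative_partialsI)
    have "((\<lambda>x. ps2 c x t) has_derivative (\<lambda>h. h * ps2 (du c) s t)) (at s)"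
      using ps2_DERIV_fst[OF assms] by (simp add: has_field_derivative_def mult_commute_abs)
    then show "((\<lambda>x. ps2 c x t) has_derivative (\<lambda>h. h * ps2 (du c) s t)) (at s within ball 0 r')"
      by (rule has_derivative_at_withinI)
    show "((\<lambda>y. ps2 c x y) has_derivative ?fy x y) (at y within ball 0 r')" if "x \<in> ball 0 r'" "y \<in> ball 0 r'" for x y
    proof -
      have "((\<lambda>y. ps2 c x y) has_derivative (\<lambda>h. h * ps2 (dv c) x y)) (at y)"
        using ps2_DERIV_snd[OF assms(1), of x y] that r' by (simp add: has_field_derivative_def mult_commute_abs)
      then show ?thesis by (simp add: has_derivative_at_withinI)
    qed
    have "isCont (\<lambda>z. ps2 (dv c) (fst z) (snd z)) (s, t)"
      by (rule continuous_at_ps2[OF conv2_dv[OF assms(1) r'(4,3)]]) (use r' in auto)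
    then have "isCont (\<lambda>z. blinfun_scaleR_left (ps2 (dv c) (fst z) (snd z))) (s, t)"
      by (intro bounded_linear.isCont[OF bounded_linear_blinfun_scaleR_left])
    then show "continuous (at (s, t) within ball 0 r' \<times> ball 0 r') (\<lambda>(x, y). ?fy x y)"
      by (simp add: case_prod_unfold continuous_at_imp_continuous_at_within)
  qed (use r' in auto)
  then have "((\<lambda>(x, y). ps2 c x y) has_derivative (\<lambda>(tx, ty). tx * ps2 (du c) s t + ?fy s t ty)) (at (s, t))"
    by (subst (asm) at_within_open) (use r' in \<open>auto intro: open_Times\<close>)
  then show ?thesis by (simp add: case_prod_unfold)
qed

lemma has_derivative_eventually_cong:
  assumes "(f has_derivative f') (at q)" "\<forall>\<^sub>F z in nhds q. f z = g z"
  shows "(g has_derivative f') (at q)"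
  by (rule has_derivative_transform_eventually[OF assms(1)])
    (use assms(2) eventually_nhds_x_imp_x[OF assms(2)] in \<open>auto simp: eventually_at_filter elim: eventually_mono\<close>)

lemma
  assumes "(f has_derivative f') (at z)"
  shows has_derivative_imp_pdu: "pdu f z = f' (1, 0)"
    and has_derivative_imp_pdv: "pdv f z = f' (0, 1)"
proof -
  interpret bounded_linear f' using assms by (rule has_derivative_bounded_linear)
  have "((\<lambda>t. (t, snd z)) has_derivative (\<lambda>h. (h, 0))) (at (fst z))"
    by (auto intro!: derivative_eq_intros)
  then have "(f \<circ> (\<lambda>t. (t, snd z)) has_derivative f' \<circ> (\<lambda>h. (h, 0))) (at (fst z))"
    by (rule diff_chain_at) (use assms in simp)
  then show "pdu f z = f' (1, 0)"
    unfolding pdu_def by (intro vector_derivative_at)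
      (simp add: has_vector_derivative_def o_def flip: scaleR)
  have "((\<lambda>t. (fst z, t)) has_derivative (\<lambda>h. (0, h))) (at (snd z))"
    by (auto intro!: derivative_eq_intros)
  then have "(f \<circ> (\<lambda>t. (fst z, t)) has_derivative f' \<circ> (\<lambda>h. (0, h))) (at (snd z))"
    by (rule diff_chain_at) (use assms in simp)
  then show "pdv f z = f' (0, 1)"
    unfolding pdv_def by (intro vector_derivative_at)
      (simp add: has_vector_derivative_def o_def flip: scaleR)
qed

lemma ps2_at_0 [simp]: "ps2 c 0 0 = c 0 0"
proof -
  have "((\<lambda>(i, j). c i j * 0 ^ i * 0 ^ j) has_sum (\<Sum>(i, j)\<in>{(0,0)}. c i j * 0 ^ i * 0 ^ j)) UNIV"
    by (rule has_sum_finite_support) (auto split: prod.splits)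
  then show ?thesis by (simp add: ps2_def infsumI)
qed

lemma expansion2_at_centre:
  fixes f :: "'a::{real_normed_field,banach} \<times> 'a \<Rightarrow> 'a"
  shows "expansion2 f q c \<Longrightarrow> f q = c 0 0"
  using eventually_nhds_x_imp_x[of "\<lambda>z. f z = ps2 c (fst z - fst q) (snd z - snd q)" q]
  by (simp add: expansion2_def)

lemma
  fixes f :: "real \<times> real \<Rightarrow> real"
  assumes "expansion2 f q c"
  shows expansion2_pdu: "expansion2 (pdu f) q (du c)"
    and expansion2_pdv: "expansion2 (pdv f) q (dv c)"
    and expansion2_eventually_derivative: "\<forall>\<^sub>F z in nhds q. (f has_derivative (\<lambda>d. fst d * pdu f z + snd d * pdv f z)) (at z)"
proof -
  obtain r where r: "conv2 c r"
    "\<And>z. norm (fst z - fst q) \<le> r \<Longrightarrow> norm (snd z - snd q) \<le> r \<Longrightarrow> f z = ps2 c (fst z - fst q) (snd z - snd q)"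
    by (rule expansion2E[OF assms]) blast
  have *: "(f has_derivative (\<lambda>d. fst d * pdu f z + snd d * pdv f z)) (at z) \<and>
      pdu f z = ps2 (du c) (fst z - fst q) (snd z - snd q) \<and> pdv f z = ps2 (dv c) (fst z - fst q) (snd z - snd q)"
    if z: "norm (fst z - fst q) < r" "norm (snd z - snd q) < r" for z
  proof -
    let ?f' = "\<lambda>d. fst d * ps2 (du c) (fst z - fst q) (snd z - snd q) + snd d * ps2 (dv c) (fst z - fst q) (snd z - snd q)"
    have "((\<lambda>w. ps2 c (fst w) (snd w)) has_derivative ?f') (at (z - q))"
      using ps2_has_derivative[OF r(1) z] by (cases z; cases q) simp
    moreover have "((\<lambda>w. w - q) has_derivative (\<lambda>d. d)) (at z)"
      by (auto intro!: derivative_eq_intros)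
    ultimately have "((\<lambda>w. ps2 c (fst w) (snd w)) \<circ> (\<lambda>w. w - q) has_derivative ?f' \<circ> (\<lambda>d. d)) (at z)"
      by (intro diff_chain_at)
    then have 0: "((\<lambda>w. ps2 c (fst (w - q)) (snd (w - q))) has_derivative ?f') (at z)"
      by (simp only: o_def)
    have D: "(f has_derivative ?f') (at z)"
    proof (rule has_derivative_transform_within_open[OF 0])
      show "open (ball (fst q) r \<times> ball (snd q) r)" by (intro open_Times open_ball)
      show "z \<in> ball (fst q) r \<times> ball (snd q) r" using z by (cases z) (auto simp: dist_norm norm_minus_commute)
      show "ps2 c (fst (w - q)) (snd (w - q)) = f w" if "w \<in> ball (fst q) r \<times> ball (snd q) r" for w
        using r(2)[of w] that by (cases w) (auto simp: dist_norm abs_minus_commute)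
    qed
    have "pdu f z = ?f' (1, 0)" "pdv f z = ?f' (0, 1)"
      by (rule has_derivative_imp_pdu[OF D] has_derivative_imp_pdv[OF D])+
    with D show ?thesis by simp
  qed
  have r0: "0 < r / 2" "r / 2 < r" using conv2_pos[OF r(1)] by auto
  have "\<forall>\<^sub>F z in nhds q. norm (fst z - fst q) < r \<and> norm (snd z - snd q) < r"
    by (rule eventually_nhds_polydisc[OF conv2_pos[OF r(1)]])
  then have ev: "\<forall>\<^sub>F z in nhds q. (f has_derivative (\<lambda>d. fst d * pdu f z + snd d * pdv f z)) (at z) \<and>
      pdu f z = ps2 (du c) (fst z - fst q) (snd z - snd q) \<and> pdv f z = ps2 (dv c) (fst z - fst q) (snd z - snd q)"
    by eventually_elim (rule *; blast)
  show "expansion2 (pdu f) q (du c)"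
    by (rule expansion2I[OF conv2_du[OF r(1) r0]]) (rule eventually_mono[OF ev], blast)
  show "expansion2 (pdv f) q (dv c)"
    by (rule expansion2I[OF conv2_dv[OF r(1) r0]]) (rule eventually_mono[OF ev], blast)
  show "\<forall>\<^sub>F z in nhds q. (f has_derivative (\<lambda>d. fst d * pdu f z + snd d * pdv f z)) (at z)"
    by (rule eventually_mono[OF ev]) blast
qed

lemma expansion2_real_coeffs:
  fixes f :: "real \<times> real \<Rightarrow> real"
  assumes "expansion2 f q c"
  shows "f q = c 0 0" "pdu f q = c 1 0" "pdv f q = c 0 1"
    "pdu (pdu f) q = 2 * c 2 0" "pdv (pdu f) q = c 1 1" "pdu (pdv f) q = c 1 1" "pdv (pdv f) q = 2 * c 0 2"
proof -
  note u = expansion2_pdu[OF assms] and v = expansion2_pdv[OF assms]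
  note e = assms u v expansion2_pdu[OF u] expansion2_pdv[OF u] expansion2_pdu[OF v] expansion2_pdv[OF v]
  show "f q = c 0 0" "pdu f q = c 1 0" "pdv f q = c 0 1"
    "pdu (pdu f) q = 2 * c 2 0" "pdv (pdu f) q = c 1 1" "pdu (pdv f) q = c 1 1" "pdv (pdv f) q = 2 * c 0 2"
    using e[THEN expansion2_at_centre] by (simp_all add: du_def dv_def numeral_2_eq_2)
qed

lemma
  fixes f :: "real \<times> real \<Rightarrow> real"
  assumes "analytic2_at f q"
  shows analytic2_at_pdu: "analytic2_at (pdu f) q"
    and analytic2_at_pdv: "analytic2_at (pdv f) q"
    and analytic2_eventually_derivative: "\<forall>\<^sub>F z in nhds q. (f has_derivative (\<lambda>d. fst d * pdu f z + snd d * pdv f z)) (at z)"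
    and analytic2_has_derivative: "(f has_derivative (\<lambda>d. fst d * pdu f q + snd d * pdv f q)) (at q)"
    and analytic2_pdu_pdv: "pdu (pdv f) q = pdv (pdu f) q"
proof -
  obtain c where c: "expansion2 f q c" using assms by (auto simp: analytic2_at_iff)
  show "analytic2_at (pdu f) q" "analytic2_at (pdv f) q"
    using expansion2_pdu[OF c] expansion2_pdv[OF c] analytic2_at_iff by blast+
  show "\<forall>\<^sub>F z in nhds q. (f has_derivative (\<lambda>d. fst d * pdu f z + snd d * pdv f z)) (at z)"
    by (rule expansion2_eventually_derivative[OF c])
  then show "(f has_derivative (\<lambda>d. fst d * pdu f q + snd d * pdv f q)) (at q)"
    by (rule eventually_nhds_x_imp_x)
  show "pdu (pdv f) q = pdv (pdu f) q"
    using expansion2_real_coeffs(5,6)[OF c] by simp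
qed

lemma pdu_cong:
  assumes "\<forall>\<^sub>F z in nhds q. f z = g z"
  shows "pdu f q = pdu g q" "pdv f q = pdv g q"
proof -
  have "filterlim (\<lambda>t. (t, snd q)) (nhds q) (nhds (fst q))" "filterlim (\<lambda>t. (fst q, t)) (nhds q) (nhds (snd q))"
    using tendsto_Pair[OF filterlim_ident tendsto_const[of "snd q"], of "fst q"]
      tendsto_Pair[OF tendsto_const filterlim_ident, of "fst q" "snd q"] by (simp_all only: prod.collapse)
  from eventually_compose_filterlim[OF assms this(1)] eventually_compose_filterlim[OF assms this(2)]
  have "\<forall>\<^sub>F t in nhds (fst q). t \<in> UNIV \<longrightarrow> f (t, snd q) = g (t, snd q)"
    "\<forall>\<^sub>F t in nhds (snd q). t \<in> UNIV \<longrightarrow> f (fst q, t) = g (fst q, t)"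
    by simp_all
  from this[THEN vector_derivative_cong_eq, OF refl refl UNIV_I]
  show "pdu f q = pdu g q" "pdv f q = pdv g q"
    unfolding pdu_def pdv_def by simp_all
qed

section \<open>Reciprocals of germs\<close>

text \<open>The coefficients of the reciprocal, solved from the requirement that the Cauchy product with \<open>c\<close> be
  the constant 1.\<close>

function recip2 :: "(nat \<Rightarrow> nat \<Rightarrow> 'a::field) \<Rightarrow> nat \<Rightarrow> nat \<Rightarrow> 'a" where
  "recip2 c m n = (if m = 0 \<and> n = 0 then 1 / c 0 0
     else - (\<Sum>(i, j)\<in>{..m} \<times> {..n} - {(0, 0)}. c i j * recip2 c (m - i) (n - j)) / c 0 0)"
  by auto
termination
  by (relation "Wellfounded.measure (\<lambda>(c, m, n). m + n)") auto

declare recip2.simps [simp del]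

lemma cauchy2_recip2:
  fixes c :: "nat \<Rightarrow> nat \<Rightarrow> 'a::field"
  assumes "c 0 0 \<noteq> 0"
  shows "cauchy2 c (recip2 c) m n = (if m = 0 \<and> n = 0 then 1 else 0)"
proof -
  have "cauchy2 c (recip2 c) m n = c 0 0 * recip2 c m n
      + (\<Sum>(i, j)\<in>{..m} \<times> {..n} - {(0, 0)}. c i j * recip2 c (m - i) (n - j))"
    unfolding cauchy2_def by (subst sum.remove[of _ "(0, 0)"]) auto
  then show ?thesis using assms by (subst (asm) recip2.simps) auto
qed

text \<open>On a small polydisc the norms of the nonconstant terms of the series add up to at most
  $|c_{00}|$; there the recursion preserves the bound $1/|c_{00}|$.\<close>

lemma conv2_recip2:
  assumes "conv2 c r" "c 0 0 \<noteq> 0"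
  shows "\<exists>r'. conv2 (recip2 c) r'"
proof -
  define S where "S = (\<Sum>\<^sub>\<infinity>(i, j). norm (c i j) * r ^ (i + j))"
  define a where "a = norm (c 0 0)"
  have r: "0 < r" by (rule conv2_pos[OF assms(1)])
  have sm: "(\<lambda>(i, j). norm (c i j) * r ^ (i + j)) summable_on UNIV" using assms(1) by (simp add: conv2_def)
  have fin: "(\<Sum>(i, j)\<in>A. norm (c i j) * r ^ (i + j)) \<le> S" if "finite A" for A
    unfolding S_def by (rule finite_sum_le_infsum[OF sm that]) (use r in auto)
  have S: "0 \<le> S" using fin[of "{}"] by simp
  have a: "0 < a" using assms(2) by (simp add: a_def)
  \<comment> \<open>shrinking the radius by the factor \<open>t\<close> shrinks every nonconstant term by at least that factor\<close>
  define t where "t = min 1 (a / (S + 1))"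
  have t: "0 < t" "t \<le> 1" using a S by (auto simp: t_def)
  have "t * S \<le> t * (S + 1)" using t by simp
  also have "\<dots> \<le> a / (S + 1) * (S + 1)" using S by (intro mult_right_mono) (auto simp: t_def)
  also have "\<dots> = a" using S by simp
  finally have tS: "t * S \<le> a" .
  define R where "R = t * r"
  have R: "0 < R" using t r by (simp add: R_def)
  have small: "(\<Sum>(i, j)\<in>A - {(0, 0)}. norm (c i j) * R ^ (i + j)) \<le> a" if "finite A" for A
  proof -
    have "(\<Sum>(i, j)\<in>A - {(0, 0)}. norm (c i j) * R ^ (i + j)) \<le> (\<Sum>(i, j)\<in>A - {(0, 0)}. t * (norm (c i j) * r ^ (i + j)))"
    proof (rule sum_mono)
      fix p assume p: "p \<in> A - {(0, 0)}"
      obtain i j where ij: "p = (i, j)" by force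
      then have "1 \<le> i + j" using p by auto
      then have "t ^ (i + j) \<le> t ^ 1" using t by (intro power_decreasing) auto
      then have "norm (c i j) * r ^ (i + j) * t ^ (i + j) \<le> norm (c i j) * r ^ (i + j) * t"
        using r by (intro mult_left_mono) auto
      then show "(case p of (i, j) \<Rightarrow> norm (c i j) * R ^ (i + j)) \<le> (case p of (i, j) \<Rightarrow> t * (norm (c i j) * r ^ (i + j)))"
        by (simp add: ij R_def power_mult_distrib mult_ac)
    qed
    also have "\<dots> = t * (\<Sum>(i, j)\<in>A - {(0, 0)}. norm (c i j) * r ^ (i + j))"
      by (simp add: sum_distrib_left case_prod_unfold)
    also have "\<dots> \<le> t * S" using fin[of "A - {(0, 0)}"] that t by (intro mult_left_mono) auto
    also note tS
    finally show ?thesis .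
  qed
  have bound: "norm (recip2 c m n) * R ^ (m + n) \<le> 1 / a" for m n
  proof (induction "m + n" arbitrary: m n rule: less_induct)
    case less
    show ?case
    proof (cases "m = 0 \<and> n = 0")
      case True
      then show ?thesis by (simp add: recip2.simps[of c 0 0] a_def norm_divide)
    next
      case False
      let ?A = "{..m} \<times> {..n} - {(0, 0)}"
      have "norm (\<Sum>(i, j)\<in>?A. c i j * recip2 c (m - i) (n - j)) * R ^ (m + n)
          \<le> (\<Sum>(i, j)\<in>?A. norm (c i j) * norm (recip2 c (m - i) (n - j))) * R ^ (m + n)"
        using R by (intro mult_right_mono order_trans[OF norm_sum]) (auto simp: case_prod_unfold norm_mult)
      also have "\<dots> \<le> (\<Sum>(i, j)\<in>?A. norm (c i j) * R ^ (i + j) * (1 / a))"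
        unfolding sum_distrib_right
      proof (rule sum_mono)
        fix p assume p: "p \<in> ?A"
        obtain i j where pij: "p = (i, j)" by force
        then have ij: "i \<le> m" "j \<le> n" "(m - i) + (n - j) < m + n" using p by auto
        from less[OF ij(3)]
        have "norm (c i j) * R ^ (i + j) * (norm (recip2 c (m - i) (n - j)) * R ^ ((m - i) + (n - j))) \<le> norm (c i j) * R ^ (i + j) * (1 / a)"
          using R by (intro mult_left_mono) auto
        moreover have "R ^ (m + n) = R ^ (i + j) * R ^ ((m - i) + (n - j))"
          using ij by (simp flip: power_add)
        ultimately show "(case p of (i, j) \<Rightarrow> norm (c i j) * norm (recip2 c (m - i) (n - j))) * R ^ (m + n)
            \<le> (case p of (i, j) \<Rightarrow> norm (c i j) * R ^ (i + j) * (1 / a))"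
          by (simp add: pij mult_ac)
      qed
      also have "\<dots> = (\<Sum>(i, j)\<in>?A. norm (c i j) * R ^ (i + j)) / a"
        by (simp add: sum_divide_distrib case_prod_unfold)
      also have "\<dots> \<le> a / a"
        using small[of "{..m} \<times> {..n}"] a by (intro divide_right_mono) auto
      also have "\<dots> = 1" using a by simp
      finally have "norm (\<Sum>(i, j)\<in>?A. c i j * recip2 c (m - i) (n - j)) * R ^ (m + n) / a \<le> 1 / a"
        using a by (intro divide_right_mono) auto
      then show ?thesis
        using False by (subst recip2.simps) (simp add: norm_divide a_def)
    qed
  qed
  show ?thesis
    by (rule exI[of _ "R / 2"], rule conv2_if_bounded[of _ R]) (use R bound in auto)
qed

lemma analytic2_at_inverse:
  fixes f :: "'a::{real_normed_field,banach} \<times> 'a \<Rightarrow> 'a"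
  assumes "analytic2_at f q" "f q \<noteq> 0"
  obtains g where "analytic2_at g q" "\<forall>\<^sub>F z in nhds q. f z * g z = 1"
proof -
  obtain c where c: "expansion2 f q c" using assms(1) by (auto simp: analytic2_at_iff)
  have "f q = c 0 0"
    using eventually_nhds_x_imp_x[OF c[unfolded expansion2_def, THEN conjunct2]] by simp
  then have c0: "c 0 0 \<noteq> 0" using assms(2) by simp
  obtain r where r: "conv2 c r" using c by (auto simp: expansion2_def)
  obtain r' where r': "conv2 (recip2 c) r'" using conv2_recip2[OF r c0] by blast
  let ?g = "\<lambda>z. ps2 (recip2 c) (fst z - fst q) (snd z - snd q)"
  have g: "expansion2 ?g q (recip2 c)" by (rule expansion2I[OF r']) simp
  have "cauchy2 c (recip2 c) = (\<lambda>i j. if i = 0 \<and> j = 0 then 1 else 0)"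
    by (intro ext cauchy2_recip2 c0)
  then have "expansion2 (\<lambda>z. f z * ?g z) q (\<lambda>i j. if i = 0 \<and> j = 0 then 1 else 0)"
    using expansion2_mult[OF c g] by simp
  then have "\<forall>\<^sub>F z in nhds q. f z * ?g z = ps2 (\<lambda>i j. if i = 0 \<and> j = 0 then 1 else 0) (fst z - fst q) (snd z - snd q)"
    by (simp add: expansion2_def)
  moreover have "ps2 (\<lambda>i j. if i = 0 \<and> j = 0 then 1 else 0) s t = (1::'a)" for s t
    by (subst ps2_finite_support[of "{(0, 0)}"]) auto
  ultimately show thesis
    using g by (intro that[of ?g]) (auto simp: analytic2_at_iff[of ?g])
qed

section \<open>Uniqueness of coefficients and complexification\<close>

lemma expansion2_diff:
  fixes f g :: "'a::{real_normed_field,banach} \<times> 'a \<Rightarrow> 'a"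
  assumes "expansion2 f q c" "expansion2 g q d"
  shows "expansion2 (\<lambda>z. f z - g z) q (\<lambda>i j. c i j - d i j)"
proof -
  have "cauchy2 (\<lambda>i j. if i = 0 \<and> j = 0 then - 1 else 0) d m n = - d m n" for m n
    unfolding cauchy2_def by (subst sum.remove[of _ "(0, 0)"]) (auto intro!: sum.neutral split: if_splits)
  then show ?thesis
    using expansion2_add[OF assms(1) expansion2_mult[OF expansion2_const[of "-1"] assms(2)]] by simp
qed

text \<open>Agreement at the real points near \<open>q\<close> is enough, so that a real analytic germ has only one
  complexification and identities between real germs carry over to the complex ones.\<close>

lemma expansion2_unique_on_reals:
  fixes F G :: "complex \<times> complex \<Rightarrow> complex"
  assumes "expansion2 F (complex_point q) c" "expansion2 G (complex_point q) d"
    and "\<forall>\<^sub>F z in nhds q. F (complex_point z) = G (complex_point z)"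
  shows "c = d"
proof (intro ext)
  fix i j
  obtain r where r: "conv2 (\<lambda>i j. c i j - d i j) r"
    "\<And>z. norm (fst z - fst (complex_point q)) \<le> r \<Longrightarrow> norm (snd z - snd (complex_point q)) \<le> r \<Longrightarrow>
      F z - G z = ps2 (\<lambda>i j. c i j - d i j) (fst z - fst (complex_point q)) (snd z - snd (complex_point q))"
    by (rule expansion2E[OF expansion2_diff[OF assms(1,2)]]) blast
  obtain e where e: "0 < e" "\<And>z. dist z q < e \<Longrightarrow> F (complex_point z) = G (complex_point z)"
    using assms(3) unfolding eventually_nhds_metric by blast
  define e' where "e' = min r (e / 2)"
  have "c i j - d i j = 0"
  proof (rule ps2_zero_coeffs[OF r(1), of e'])
    show "0 < e'" using conv2_pos[OF r(1)] e(1) by (simp add: e'_def)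
    fix s t :: real assume st: "\<bar>s\<bar> < e'" "\<bar>t\<bar> < e'"
    define z where "z = (fst q + s, snd q + t)"
    have "dist z q \<le> dist (fst z) (fst q) + dist (snd z) (snd q)"
      unfolding dist_prod_def using sqrt_sum_squares_le_sum by auto
    also have "\<dots> < e" using st by (simp add: z_def dist_real_def e'_def)
    finally have "F (complex_point z) - G (complex_point z) = 0" using e(2) by simp
    moreover have "F (complex_point z) - G (complex_point z) = ps2 (\<lambda>i j. c i j - d i j) (of_real s) (of_real t)"
      using r(2)[of "complex_point z"] st by (simp add: z_def complex_point_def e'_def)
    ultimately show "ps2 (\<lambda>i j. c i j - d i j) (of_real s) (of_real t) = 0" by simp
  qed
  then show "c i j = d i j" by simp
qed

lemma analytic2_identity:
  fixes F G :: "complex \<times> complex \<Rightarrow> complex"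
  assumes "analytic2_at F (complex_point q)" "analytic2_at G (complex_point q)"
    and "\<forall>\<^sub>F z in nhds q. F (complex_point z) = G (complex_point z)"
  shows "\<forall>\<^sub>F z in nhds (complex_point q). F z = G z"
proof -
  obtain c d where c: "expansion2 F (complex_point q) c" and d: "expansion2 G (complex_point q) d"
    using assms by (auto simp: analytic2_at_iff)
  have "c = d" by (rule expansion2_unique_on_reals[OF c d assms(3)])
  with c d show ?thesis
    unfolding expansion2_def by (auto elim: eventually_elim2)
qed

lemma ps2_of_real:
  fixes c :: "nat \<Rightarrow> nat \<Rightarrow> real"
  assumes "conv2 c r" "norm s \<le> r" "norm t \<le> r"
  shows "ps2 (\<lambda>i j. complex_of_real (c i j)) (of_real s) (of_real t) = of_real (ps2 c s t)"
proof -
  have "((\<lambda>(i, j). complex_of_real (c i j) * of_real s ^ i * of_real t ^ j) has_sum of_real (ps2 c s t)) UNIV"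
    using has_sum_of_real[OF ps2_has_sum[OF assms], where 'a = complex] by (simp add: case_prod_unfold)
  then show ?thesis unfolding ps2_def[of "\<lambda>i j. complex_of_real (c i j)"] by (rule infsumI)
qed

text \<open>The series with the same coefficients is one possible choice, and by uniqueness every choice has
  these coefficients.\<close>

lemma complexification_expansion2:
  assumes "expansion2 f q c"
  shows "expansion2 (complexification f q) (complex_point q) (\<lambda>i j. of_real (c i j))"
    and "\<forall>\<^sub>F z in nhds q. complexification f q (complex_point z) = of_real (f z)"
proof -
  obtain r where r: "conv2 c r"
    "\<And>z. norm (fst z - fst q) \<le> r \<Longrightarrow> norm (snd z - snd q) \<le> r \<Longrightarrow> f z = ps2 c (fst z - fst q) (snd z - snd q)"
    by (rule expansion2E[OF assms]) blast
  let ?F = "\<lambda>z. ps2 (\<lambda>i j. complex_of_real (c i j)) (fst z - fst (complex_point q)) (snd z - snd (complex_point q))"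
  have "conv2 (\<lambda>i j. complex_of_real (c i j)) r" using r(1) by (simp add: conv2_def)
  then have F: "expansion2 ?F (complex_point q) (\<lambda>i j. of_real (c i j))" by (rule expansion2I) simp
  have Fr: "\<forall>\<^sub>F z in nhds q. ?F (complex_point z) = of_real (f z)"
    using eventually_nhds_polydisc[OF conv2_pos[OF r(1)], of q]
  proof eventually_elim
    case (elim z)
    then show ?case
      using r(2)[of z] ps2_of_real[OF r(1), of "fst z - fst q" "snd z - snd q"] by (simp add: complex_point_def)
  qed
  have "analytic2_at (complexification f q) (complex_point q) \<and>
     (\<forall>\<^sub>F z in nhds q. complexification f q (complex_point z) = of_real (f z))"
    unfolding complexification_def
    by (rule someI[of "\<lambda>F. analytic2_at F (complex_point q) \<and> (\<forall>\<^sub>F z in nhds q. F (complex_point z) = of_real (f z))" ?F])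
      (use F Fr analytic2_at_iff in blast)
  then show C: "\<forall>\<^sub>F z in nhds q. complexification f q (complex_point z) = of_real (f z)"
    and "expansion2 (complexification f q) (complex_point q) (\<lambda>i j. of_real (c i j))"
  proof -
    assume A: "analytic2_at (complexification f q) (complex_point q) \<and>
     (\<forall>\<^sub>F z in nhds q. complexification f q (complex_point z) = of_real (f z))"
    then show "\<forall>\<^sub>F z in nhds q. complexification f q (complex_point z) = of_real (f z)" by blast
    from A obtain d where d: "expansion2 (complexification f q) (complex_point q) d"
      by (auto simp: analytic2_at_iff)
    have "d = (\<lambda>i j. of_real (c i j))"
      by (rule expansion2_unique_on_reals[OF d F]) (use A Fr in \<open>auto elim: eventually_elim2\<close>)
    with d show "expansion2 (complexification f q) (complex_point q) (\<lambda>i j. of_real (c i j))" by simp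
  qed
qed

lemma analytic2_at_complexification:
  assumes "analytic2_at f q"
  shows "analytic2_at (complexification f q) (complex_point q)"
    and "\<forall>\<^sub>F z in nhds q. complexification f q (complex_point z) = of_real (f z)"
  using assms complexification_expansion2 unfolding analytic2_at_iff by blast+

lemma analytic2_at_minus:
  fixes f :: "'a::{real_normed_field,banach} \<times> 'a \<Rightarrow> 'a"
  assumes "analytic2_at f q"
  shows "analytic2_at (\<lambda>z. - f z) q"
  using analytic2_at_mult[OF analytic2_at_const[of "-1"] assms] by simp

lemma cauchy2_low:
  "cauchy2 c d 0 0 = c 0 0 * d 0 0"
  "cauchy2 c d (Suc 0) 0 = c 0 0 * d (Suc 0) 0 + c (Suc 0) 0 * d 0 0"
  "cauchy2 c d 0 (Suc 0) = c 0 0 * d 0 (Suc 0) + c 0 (Suc 0) * d 0 0"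
  by (simp_all add: cauchy2_def sum.cartesian_product[symmetric])

lemma cauchy2_shift:
  "cauchy2 d (\<lambda>i j. if i = 1 \<and> j = 0 then 1 else 0) m n = (if m = 0 then 0 else d (m - 1) n)"
  "cauchy2 d (\<lambda>i j. if i = 0 \<and> j = 1 then 1 else 0) m n = (if n = 0 then 0 else d m (n - 1))"
proof -
  show "cauchy2 d (\<lambda>i j. if i = 1 \<and> j = 0 then 1 else 0) m n = (if m = 0 then 0 else d (m - 1) n)"
  proof (cases "m = 0")
    case False
    then show ?thesis unfolding cauchy2_def
      by (subst sum.remove[of _ "(m - 1, n)"]) (auto intro!: sum.neutral split: if_splits)
  qed (auto simp: cauchy2_def intro!: sum.neutral)
  show "cauchy2 d (\<lambda>i j. if i = 0 \<and> j = 1 then 1 else 0) m n = (if n = 0 then 0 else d m (n - 1))"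
  proof (cases "n = 0")
    case False
    then show ?thesis unfolding cauchy2_def
      by (subst sum.remove[of _ "(m, n - 1)"]) (auto intro!: sum.neutral split: if_splits)
  qed (auto simp: cauchy2_def intro!: sum.neutral)
qed

text \<open>The terms containing the first variable are divided by it; the remaining ones form a series in the
  second variable without constant term, which is divided by that variable.\<close>

lemma expansion2_Hadamard:
  fixes f :: "'a::{real_normed_field,banach} \<times> 'a \<Rightarrow> 'a"
  assumes "expansion2 f q c" "c 0 0 = 0"
  obtains f1 f2 where "analytic2_at f1 q" "analytic2_at f2 q" "f1 q = c 1 0" "f2 q = c 0 1"
    "\<forall>\<^sub>F z in nhds q. f z = f1 z * (fst z - fst q) + f2 z * (snd z - snd q)"
proof -
  define c1 where "c1 = (\<lambda>i j. c (Suc i) j)"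
  define c2 where "c2 = (\<lambda>i j. if i = (0::nat) then c 0 (Suc j) else 0)"
  obtain r where r: "conv2 c r" using assms(1) by (auto simp: expansion2_def)
  have r0: "0 < r" by (rule conv2_pos[OF r])
  obtain B where B: "\<And>i j. norm (c i j) * r ^ (i + j) \<le> B"
    by (rule conv2_bounded[OF r]) blast
  have "norm (c1 i j) * r ^ (i + j) \<le> B / r" for i j
    using B[of "Suc i" j] r0 by (simp add: c1_def field_simps)
  then have 1: "conv2 c1 (r / 2)" using r0 by (intro conv2_if_bounded[of _ r]) auto
  have "norm (c2 i j) * r ^ (i + j) \<le> B / r" for i j
  proof (cases "i = 0")
    case True
    then show ?thesis using B[of 0 "Suc j"] r0 by (simp add: c2_def field_simps)
  next
    case False
    have "0 \<le> B" using B[of 0 0] norm_ge_zero[of "c 0 0"] by (simp del: norm_ge_zero)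
    then show ?thesis using False r0 by (simp add: c2_def)
  qed
  then have 2: "conv2 c2 (r / 2)" using r0 by (intro conv2_if_bounded[of _ r]) auto
  let ?f1 = "\<lambda>z. ps2 c1 (fst z - fst q) (snd z - snd q)"
  let ?f2 = "\<lambda>z. ps2 c2 (fst z - fst q) (snd z - snd q)"
  have e1: "expansion2 ?f1 q c1" by (rule expansion2I[OF 1]) simp
  have e2: "expansion2 ?f2 q c2" by (rule expansion2I[OF 2]) simp
  let ?g = "\<lambda>z. ?f1 z * (fst z - fst q) + ?f2 z * (snd z - snd q)"
  have "expansion2 ?g q (\<lambda>i j. cauchy2 c1 (\<lambda>i j. if i = 1 \<and> j = 0 then 1 else 0) i j
      + cauchy2 c2 (\<lambda>i j. if i = 0 \<and> j = 1 then 1 else 0) i j)"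
    by (intro expansion2_add expansion2_mult e1 e2 expansion2_fst expansion2_snd)
  moreover have "(\<lambda>i j. cauchy2 c1 (\<lambda>i j. if i = 1 \<and> j = 0 then 1 else 0) i j
      + cauchy2 c2 (\<lambda>i j. if i = 0 \<and> j = 1 then 1 else 0) i j) = c"
    unfolding cauchy2_shift by (intro ext) (use assms(2) in \<open>auto simp: c1_def c2_def split: if_splits\<close>)
  ultimately have "expansion2 ?g q c" by simp
  then have "\<forall>\<^sub>F z in nhds q. f z = ?g z"
    using assms(1) unfolding expansion2_def by (auto elim: eventually_elim2)
  then show thesis
    using e1 e2 by (intro that[of ?f1 ?f2]) (auto simp: analytic2_at_iff c1_def c2_def)
qed

section \<open>Ideals of germs and multiplicity one\<close>

lemma germ_idealI:
  assumes "f \<in> holo_germs Q" "\<alpha> \<in> holo_germs Q" "\<beta> \<in> holo_germs Q"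
    and "\<forall>\<^sub>F z in nhds Q. f z = \<alpha> z * h z + \<beta> z * k z"
  shows "f \<in> germ_ideal h k Q"
  using assms unfolding germ_ideal_def by (simp, intro bexI[of _ \<alpha>] bexI[of _ \<beta>])

lemma germ_ideal_mono:
  assumes "h1 \<in> germ_ideal h2 k2 Q" "k1 \<in> germ_ideal h2 k2 Q"
  shows "germ_ideal h1 k1 Q \<subseteq> germ_ideal h2 k2 Q"
proof
  fix f assume "f \<in> germ_ideal h1 k1 Q"
  then obtain \<alpha> \<beta> where f: "f \<in> holo_germs Q" "\<alpha> \<in> holo_germs Q" "\<beta> \<in> holo_germs Q"
    "\<forall>\<^sub>F z in nhds Q. f z = \<alpha> z * h1 z + \<beta> z * k1 z"
    by (auto simp: germ_ideal_def)
  obtain \<alpha>1 \<beta>1 where h: "\<alpha>1 \<in> holo_germs Q" "\<beta>1 \<in> holo_germs Q" "\<forall>\<^sub>F z in nhds Q. h1 z = \<alpha>1 z * h2 z + \<beta>1 z * k2 z"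
    using assms(1) by (auto simp: germ_ideal_def)
  obtain \<alpha>2 \<beta>2 where k: "\<alpha>2 \<in> holo_germs Q" "\<beta>2 \<in> holo_germs Q" "\<forall>\<^sub>F z in nhds Q. k1 z = \<alpha>2 z * h2 z + \<beta>2 z * k2 z"
    using assms(2) by (auto simp: germ_ideal_def)
  have "\<forall>\<^sub>F z in nhds Q. f z = (\<alpha> z * \<alpha>1 z + \<beta> z * \<alpha>2 z) * h2 z + (\<alpha> z * \<beta>1 z + \<beta> z * \<beta>2 z) * k2 z"
    using f(4) h(3) k(3) by eventually_elim (simp add: algebra_simps)
  then show "f \<in> germ_ideal h2 k2 Q"
    using f h k by (intro germ_idealI) (auto simp: holo_germs_def intro!: analytic2_at_add analytic2_at_mult)
qed

lemma germ_ideal_generators: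
  assumes "h \<in> holo_germs Q" "k \<in> holo_germs Q"
  shows "h \<in> germ_ideal h k Q" "k \<in> germ_ideal h k Q"
  using assms by (auto intro: germ_idealI[of _ _ "\<lambda>_. 1" "\<lambda>_. 0"] germ_idealI[of _ _ "\<lambda>_. 0" "\<lambda>_. 1"] simp: holo_germs_def)

text \<open>A germ \<open>e\<close> with \<open>e Q \<noteq> 0\<close> has a reciprocal germ, so a relation may be divided by it.\<close>

lemma germ_idealI_unit:
  assumes "h \<in> holo_germs Q" "e \<in> holo_germs Q" "e Q \<noteq> 0" "\<alpha> \<in> holo_germs Q" "\<beta> \<in> holo_germs Q"
    and "\<forall>\<^sub>F z in nhds Q. e z * h z = \<alpha> z * h2 z + \<beta> z * k2 z"
  shows "h \<in> germ_ideal h2 k2 Q"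
proof -
  obtain w where w: "analytic2_at w Q" "\<forall>\<^sub>F z in nhds Q. e z * w z = 1"
    using assms(2,3) by (auto simp: holo_germs_def elim: analytic2_at_inverse)
  have "\<forall>\<^sub>F z in nhds Q. h z = (w z * \<alpha> z) * h2 z + (w z * \<beta> z) * k2 z"
    using assms(6) w(2)
  proof eventually_elim
    case (elim z)
    have "h z = (e z * w z) * h z" using elim by simp
    also have "\<dots> = w z * (e z * h z)" by simp
    also have "\<dots> = (w z * \<alpha> z) * h2 z + (w z * \<beta> z) * k2 z" unfolding elim(1) by (simp add: algebra_simps)
    finally show ?case .
  qed
  then show ?thesis
    using w(1) assms(1,4,5) by (intro germ_idealI) (auto simp: holo_germs_def intro!: analytic2_at_mult)
qed

lemma germ_ideal_vanishes:
  assumes "f \<in> germ_ideal h k Q" "h Q = 0" "k Q = 0"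
  shows "f Q = 0"
proof -
  obtain \<alpha> \<beta> where "\<forall>\<^sub>F z in nhds Q. f z = \<alpha> z * h z + \<beta> z * k z"
    using assms(1) by (auto simp: germ_ideal_def)
  from eventually_nhds_x_imp_x[OF this] assms(2,3) show ?thesis by simp
qed

text \<open>All elements of the ideal vanish at \<open>Q\<close>.  If \<open>b\<close> spans the quotient, then \<open>b Q \<noteq> 0\<close> because 1 is
  a multiple of \<open>b\<close> up to the ideal; hence a germ vanishing at \<open>Q\<close> has coefficient 0 and lies in the ideal.
  Conversely \<open>f - f Q\<close> vanishes at \<open>Q\<close>, so that 1 spans the quotient by the maximal ideal.\<close>

lemma quotient_dim_eq_1_iff:
  assumes "h Q = 0" "k Q = 0"
  shows "quotient_dim (holo_germs Q) (germ_ideal h k Q) = 1 \<longleftrightarrow> germ_ideal h k Q = {f \<in> holo_germs Q. f Q = 0}"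
    (is "?d = 1 \<longleftrightarrow> ?I = ?m")
proof
  have van: "f Q = 0" if "f \<in> ?I" for f
    by (rule germ_ideal_vanishes[OF that assms])
  have one: "(\<lambda>_. 1) \<in> holo_germs Q" by (auto simp: holo_germs_def)
  let ?X = "{enat (card B) | B. quotient_basis (holo_germs Q) ?I B}"
  {
    assume d: "?d = 1"
    then have "?X \<noteq> {}" unfolding quotient_dim_def Inf_enat_def by (auto split: if_splits)
    then have "Inf ?X \<in> ?X" unfolding Inf_enat_def using LeastI[of "\<lambda>x. x \<in> ?X"] by auto
    then have "1 \<in> ?X" using d by (simp add: quotient_dim_def)
    then obtain B where B: "quotient_basis (holo_germs Q) ?I B" "card B = 1"
      by (auto simp: one_enat_def)
    then obtain b where b: "B = {b}" by (auto simp: card_1_singleton_iff)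
    have span: "\<exists>c. (\<lambda>z. f z - c * b z) \<in> ?I" if "f \<in> holo_germs Q" for f
      using B(1) that unfolding quotient_basis_def b by auto
    obtain c where "(\<lambda>z. 1 - c * b z) \<in> ?I" using span[OF one] by auto
    from van[OF this] have bQ: "b Q \<noteq> 0" by auto
    show "?I = ?m"
    proof (intro equalityI subsetI)
      show "f \<in> ?m" if "f \<in> ?I" for f using that van[OF that] by (auto simp: germ_ideal_def)
      fix f assume f: "f \<in> ?m"
      then obtain c where c: "(\<lambda>z. f z - c * b z) \<in> ?I" using span by auto
      from van[OF this] f bQ have "c = 0" by auto
      with c show "f \<in> ?I" by simp
    qed
  }
  assume I: "?I = ?m"
  have basis: "quotient_basis (holo_germs Q) ?I {\<lambda>_. 1}"
    unfolding quotient_basis_def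
  proof (intro conjI allI impI ballI)
    show "c b = 0" if "(\<lambda>z. \<Sum>b\<in>{\<lambda>_. 1}. c b * b z) \<in> ?I" "b \<in> {\<lambda>_. 1}" for c b
      using van[OF that(1)] that(2) by simp
    show "\<exists>c. (\<lambda>z. f z - (\<Sum>b\<in>{\<lambda>_. 1}. c b * b z)) \<in> ?I" if "f \<in> holo_germs Q" for f
      using that unfolding I
      by (intro exI[of _ "\<lambda>_. f Q"]) (auto simp: holo_germs_def intro!: analytic2_at_diff)
  qed (use one in auto)
  show "?d = 1"
    unfolding quotient_dim_def
  proof (rule antisym)
    show "Inf ?X \<le> 1"
      by (rule Inf_lower) (use basis in \<open>force simp: one_enat_def\<close>)
    show "1 \<le> Inf ?X"
    proof (rule Inf_greatest, clarify)
      fix B assume B: "quotient_basis (holo_germs Q) ?I B"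
      have "B \<noteq> {}"
      proof
        assume "B = {}"
        then have "(\<lambda>_. 1) \<in> ?I" using B one by (auto simp: quotient_basis_def)
        from van[OF this] show False by simp
      qed
      then have "1 \<le> card B" using B by (simp add: quotient_basis_def Suc_leI card_gt_0_iff)
      then show "1 \<le> enat (card B)" by (simp add: one_enat_def)
    qed
  qed
qed

text \<open>If both coordinate functions are combinations of \<open>h\<close> and \<open>k\<close>, comparing first-order coefficients
  exhibits an inverse of the Jacobian matrix.  Conversely the lemma of Hadamard writes \<open>h\<close> and \<open>k\<close> as
  combinations of the coordinate functions with a coefficient matrix whose value at \<open>Q\<close> is the Jacobian
  matrix, and Cramer's rule inverts it over the germs.\<close>

lemma germ_ideal_eq_maximal_iff:
  fixes h k :: "complex \<times> complex \<Rightarrow> complex"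
  assumes h: "expansion2 h (complex_point q) a" "a 0 0 = 0" and k: "expansion2 k (complex_point q) b" "b 0 0 = 0"
  shows "germ_ideal h k (complex_point q) = {f \<in> holo_germs (complex_point q). f (complex_point q) = 0} \<longleftrightarrow> a 1 0 * b 0 1 - a 0 1 * b 1 0 \<noteq> 0"
    (is "?I = ?m \<longleftrightarrow> _")
proof
  let ?Q = "complex_point q"
  let ?Z1 = "\<lambda>z. fst z - fst ?Q" and ?Z2 = "\<lambda>z. snd z - snd ?Q"
  have Z: "expansion2 ?Z1 ?Q (\<lambda>i j. if i = 1 \<and> j = 0 then 1 else 0)"
     "expansion2 ?Z2 ?Q (\<lambda>i j. if i = 0 \<and> j = 1 then 1 else 0)"
    by (rule expansion2_fst expansion2_snd)+
  then have Zg: "?Z1 \<in> holo_germs ?Q" "?Z2 \<in> holo_germs ?Q"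
    unfolding holo_germs_def analytic2_at_iff by blast+
  {
    assume I: "?I = ?m"
    have lin: "\<exists>s t. s * a 1 0 + t * b 1 0 = c 1 0 \<and> s * a 0 1 + t * b 0 1 = c 0 1"
      if f: "expansion2 f ?Q c" "c 0 0 = 0" for f c
    proof -
      have "f \<in> ?m" using f expansion2_at_centre[OF f(1)] by (auto simp: holo_germs_def analytic2_at_iff[of f])
      then obtain \<alpha> \<beta> where ab: "analytic2_at \<alpha> ?Q" "analytic2_at \<beta> ?Q" "\<forall>\<^sub>F z in nhds ?Q. f z = \<alpha> z * h z + \<beta> z * k z"
        unfolding I[symmetric] by (auto simp: germ_ideal_def holo_germs_def)
      obtain c1 c2 where c: "expansion2 \<alpha> ?Q c1" "expansion2 \<beta> ?Q c2"
        using ab(1,2) by (auto simp: analytic2_at_iff)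
      have "expansion2 f ?Q (\<lambda>i j. cauchy2 c1 a i j + cauchy2 c2 b i j)"
        by (rule expansion2_cong[OF _ expansion2_add[OF expansion2_mult[OF c(1) h(1)] expansion2_mult[OF c(2) k(1)]]])
          (use ab(3) in \<open>auto elim: eventually_mono\<close>)
      then have "c = (\<lambda>i j. cauchy2 c1 a i j + cauchy2 c2 b i j)"
        by (rule expansion2_unique_on_reals[OF f(1)]) simp
      then show ?thesis
        using h(2) k(2) by (intro exI[of _ "c1 0 0"] exI[of _ "c2 0 0"]) (simp add: cauchy2_low)
    qed
    obtain s t where 1: "s * a 1 0 + t * b 1 0 = 1" "s * a 0 1 + t * b 0 1 = 0"
      using lin[OF Z(1)] by auto
    obtain s' t' where 2: "s' * a 1 0 + t' * b 1 0 = 0" "s' * a 0 1 + t' * b 0 1 = 1"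
      using lin[OF Z(2)] by auto
    have "(s * t' - t * s') * (a 1 0 * b 0 1 - a 0 1 * b 1 0) = 1"
      using 1 2 by algebra
    then show "a 1 0 * b 0 1 - a 0 1 * b 1 0 \<noteq> 0" by auto
  }
  assume det: "a 1 0 * b 0 1 - a 0 1 * b 1 0 \<noteq> 0"
  obtain h1 h2 where H: "analytic2_at h1 ?Q" "analytic2_at h2 ?Q" "h1 ?Q = a 1 0" "h2 ?Q = a 0 1"
    "\<forall>\<^sub>F z in nhds ?Q. h z = h1 z * ?Z1 z + h2 z * ?Z2 z"
    by (rule expansion2_Hadamard[OF h])
  obtain k1 k2 where K: "analytic2_at k1 ?Q" "analytic2_at k2 ?Q" "k1 ?Q = b 1 0" "k2 ?Q = b 0 1"
    "\<forall>\<^sub>F z in nhds ?Q. k z = k1 z * ?Z1 z + k2 z * ?Z2 z"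
    by (rule expansion2_Hadamard[OF k])
  let ?\<Delta> = "\<lambda>z. h1 z * k2 z - h2 z * k1 z"
  have \<Delta>: "?\<Delta> \<in> holo_germs ?Q" "?\<Delta> ?Q \<noteq> 0"
    using H K det by (auto simp: holo_germs_def intro!: analytic2_at_diff analytic2_at_mult)
  have "\<forall>\<^sub>F z in nhds ?Q. ?\<Delta> z * ?Z1 z = k2 z * h z + (- 1 * h2 z) * k z"
    using H(5) K(5)
  proof eventually_elim
    case (elim z)
    show ?case unfolding elim by (simp add: algebra_simps)
  qed
  from germ_idealI_unit[OF Zg(1) \<Delta> _ _ this] have Z1: "?Z1 \<in> ?I"
    using analytic2_at_minus[OF H(2)] analytic2_at_minus[OF K(1)] H(1,2) K(1,2) by (simp add: holo_germs_def)
  have "\<forall>\<^sub>F z in nhds ?Q. ?\<Delta> z * ?Z2 z = (- 1 * k1 z) * h z + h1 z * k z"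
    using H(5) K(5)
  proof eventually_elim
    case (elim z)
    show ?case unfolding elim by (simp add: algebra_simps)
  qed
  from germ_idealI_unit[OF Zg(2) \<Delta> _ _ this] have Z2: "?Z2 \<in> ?I"
    using analytic2_at_minus[OF H(2)] analytic2_at_minus[OF K(1)] H(1,2) K(1,2) by (simp add: holo_germs_def)
  show "?I = ?m"
  proof (intro equalityI subsetI)
    have "h ?Q = 0" "k ?Q = 0" using h k expansion2_at_centre by metis+
    then show "f \<in> ?m" if "f \<in> ?I" for f using that germ_ideal_vanishes[OF that] by (auto simp: germ_ideal_def)
    fix f assume f: "f \<in> ?m"
    then obtain c where c: "expansion2 f ?Q c" by (auto simp: holo_germs_def analytic2_at_iff)
    then have "c 0 0 = 0" using f expansion2_at_centre[OF c] by simp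
    from expansion2_Hadamard[OF c this] obtain f1 f2 where
      "analytic2_at f1 ?Q" "analytic2_at f2 ?Q" "\<forall>\<^sub>F z in nhds ?Q. f z = f1 z * ?Z1 z + f2 z * ?Z2 z"
      by blast
    then have "f \<in> germ_ideal ?Z1 ?Z2 ?Q" using f by (intro germ_idealI[of _ _ f1 f2]) (auto simp: holo_germs_def)
    then show "f \<in> ?I" using germ_ideal_mono[OF Z1 Z2] by blast
  qed
qed

lemma multiplicity2_eq_1_iff:
  assumes "analytic2_at h q" "analytic2_at k q" "h q = 0" "k q = 0"
  shows "multiplicity2 h k q = 1 \<longleftrightarrow> pdu h q * pdv k q - pdv h q * pdu k q \<noteq> 0"
proof -
  obtain a b where a: "expansion2 h q a" and b: "expansion2 k q b"
    using assms by (auto simp: analytic2_at_iff)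
  note ca = expansion2_real_coeffs(1-3)[OF a] and cb = expansion2_real_coeffs(1-3)[OF b]
  note A = complexification_expansion2(1)[OF a] and B = complexification_expansion2(1)[OF b]
  have 0: "of_real (a 0 0) = (0 :: complex)" "of_real (b 0 0) = (0 :: complex)"
    using ca cb assms by simp_all
  have "complexification h q (complex_point q) = 0" "complexification k q (complex_point q) = 0"
    using expansion2_at_centre[OF A] expansion2_at_centre[OF B] 0 by simp_all
  then have "multiplicity2 h k q = 1 \<longleftrightarrow> complex_of_real (a 1 0) * of_real (b 0 1) - of_real (a 0 1) * of_real (b 1 0) \<noteq> 0"
    unfolding multiplicity2_def using quotient_dim_eq_1_iff germ_ideal_eq_maximal_iff[OF A 0(1) B 0(2)] by presburger
  also have "\<dots> \<longleftrightarrow> a 1 0 * b 0 1 - a 0 1 * b 1 0 \<noteq> 0"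
    by (metis of_real_mult of_real_diff of_real_eq_0_iff)
  finally show ?thesis unfolding ca cb .
qed

lemma complexification_in_germ_ideal:
  assumes "analytic2_at h q" "analytic2_at e q" "e q \<noteq> 0" "analytic2_at f q" "analytic2_at g q" "analytic2_at h2 q" "analytic2_at k2 q"
    and "\<forall>\<^sub>F z in nhds q. e z * h z = f z * h2 z + g z * k2 z"
  shows "complexification h q \<in> germ_ideal (complexification h2 q) (complexification k2 q) (complex_point q)"
proof (rule germ_idealI_unit)
  note C = assms(1,2,4-7)[THEN analytic2_at_complexification(1)]
  note R = assms(1,2,4-7)[THEN analytic2_at_complexification(2)]
  show "complexification h q \<in> holo_germs (complex_point q)" "complexification e q \<in> holo_germs (complex_point q)"
    "complexification f q \<in> holo_germs (complex_point q)" "complexification g q \<in> holo_germs (complex_point q)"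
    using C by (auto simp: holo_germs_def)
  show "complexification e q (complex_point q) \<noteq> 0"
    using eventually_nhds_x_imp_x[OF R(2)] assms(3) by simp
  show "\<forall>\<^sub>F z in nhds (complex_point q). complexification e q z * complexification h q z
     = complexification f q z * complexification h2 q z + complexification g q z * complexification k2 q z"
  proof (rule analytic2_identity)
    show "\<forall>\<^sub>F z in nhds q. complexification e q (complex_point z) * complexification h q (complex_point z)
     = complexification f q (complex_point z) * complexification h2 q (complex_point z)
       + complexification g q (complex_point z) * complexification k2 q (complex_point z)"
      using R assms(8) by eventually_elim (simp flip: of_real_mult of_real_add)
  qed (intro analytic2_at_add analytic2_at_mult C)+
qed

section \<open>Multiplicity one as injectivity of a differential\<close>

definition vec_analytic_on :: "(real \<times> real) set \<Rightarrow> (real \<times> real \<Rightarrow> real^3) \<Rightarrow> bool" where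
  "vec_analytic_on D x \<longleftrightarrow> (\<forall>z\<in>D. \<forall>i. analytic2_at (\<lambda>w. x w $ i) z)"

lemma
  fixes x :: "real \<times> real \<Rightarrow> real^3"
  assumes "\<forall>i. analytic2_at (\<lambda>w. x w $ i) z"
  shows vec_analytic_has_derivative: "(x has_derivative (\<lambda>d. fst d *\<^sub>R pdu x z + snd d *\<^sub>R pdv x z)) (at z)"
    and pdu_component: "pdu x z $ i = pdu (\<lambda>w. x w $ i) z"
    and pdv_component: "pdv x z $ i = pdv (\<lambda>w. x w $ i) z"
proof -
  let ?L = "\<lambda>d::real \<times> real. fst d *\<^sub>R (\<chi> i. pdu (\<lambda>w. x w $ i) z) + snd d *\<^sub>R (\<chi> i. pdv (\<lambda>w. x w $ i) z)"
  have D: "(x has_derivative ?L) (at z)"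
  proof (subst has_derivative_componentwise_within, intro ballI)
    fix b :: "real^3" assume "b \<in> Basis"
    then obtain i where b: "b = axis i 1" by (auto simp: Basis_vec_def)
    show "((\<lambda>z. x z \<bullet> b) has_derivative (\<lambda>d. ?L d \<bullet> b)) (at z)"
      using analytic2_has_derivative[OF assms[rule_format, of i]]
      by (simp add: b inner_axis algebra_simps)
  qed
  have u: "pdu x z = (\<chi> i. pdu (\<lambda>w. x w $ i) z)" using has_derivative_imp_pdu[OF D] by simp
  have v: "pdv x z = (\<chi> i. pdv (\<lambda>w. x w $ i) z)" using has_derivative_imp_pdv[OF D] by simp
  show "(x has_derivative (\<lambda>d. fst d *\<^sub>R pdu x z + snd d *\<^sub>R pdv x z)) (at z)" using D unfolding u v .
  show "pdu x z $ i = pdu (\<lambda>w. x w $ i) z" "pdv x z $ i = pdv (\<lambda>w. x w $ i) z" by (simp_all add: u v)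
qed

lemma vec_analytic_on_pd:
  assumes "open D" "vec_analytic_on D x"
  shows "vec_analytic_on D (pdu x)" "vec_analytic_on D (pdv x)"
proof -
  have "analytic2_at (\<lambda>w. pdu x w $ i) z \<and> analytic2_at (\<lambda>w. pdv x w $ i) z" if z: "z \<in> D" for z i
  proof -
    have an: "analytic2_at (\<lambda>w. x w $ i) z" using assms(2) z by (auto simp: vec_analytic_on_def)
    have ev: "\<forall>\<^sub>F w in nhds z. w \<in> D" using assms(1) z by (rule eventually_nhds_in_open)
    then have e: "\<forall>\<^sub>F w in nhds z. pdu (\<lambda>w. x w $ i) w = pdu x w $ i" "\<forall>\<^sub>F w in nhds z. pdv (\<lambda>w. x w $ i) w = pdv x w $ i"
      by (eventually_elim; use assms(2) in \<open>simp add: pdu_component pdv_component vec_analytic_on_def\<close>)+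
    then show ?thesis
      using analytic2_at_cong[OF e(1) analytic2_at_pdu[OF an]] analytic2_at_cong[OF e(2) analytic2_at_pdv[OF an]] by simp
  qed
  then show "vec_analytic_on D (pdu x)" "vec_analytic_on D (pdv x)" by (auto simp: vec_analytic_on_def)
qed

lemmas analytic2_at_intros = analytic2_at_add analytic2_at_mult analytic2_at_diff analytic2_at_minus analytic2_at_const

lemma analytic2_at_mink:
  assumes "\<forall>i. analytic2_at (\<lambda>w. x w $ i) z" "\<forall>i. analytic2_at (\<lambda>w. y w $ i) z"
  shows "analytic2_at (\<lambda>w. mink (x w) (y w)) z"
  unfolding mink_def using assms by (intro analytic2_at_intros) auto

lemma analytic2_at_mcross:
  assumes "\<forall>i. analytic2_at (\<lambda>w. x w $ i) z" "\<forall>i. analytic2_at (\<lambda>w. y w $ i) z"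
  shows "\<forall>i. analytic2_at (\<lambda>w. mcross (x w) (y w) $ i) z"
  unfolding mcross_def cross3_def forall_3 vector_3 using assms by (auto intro!: analytic2_at_intros)

lemma analytic2_at_fundamental_forms:
  assumes "open D" "vec_analytic_on D x" "z \<in> D"
  shows "analytic2_at (fffE x) z" "analytic2_at (fffF x) z" "analytic2_at (fffG x) z"
    "analytic2_at (lbar x) z" "analytic2_at (mbar x) z" "analytic2_at (nbar x) z"
    "analytic2_at (umb_a x) z" "analytic2_at (umb_b x) z" "analytic2_at (umb_c x) z"
proof -
  note p = vec_analytic_on_pd[OF assms(1)]
  have c: "\<forall>i. analytic2_at (\<lambda>w. pdu x w $ i) z" "\<forall>i. analytic2_at (\<lambda>w. pdv x w $ i) z"
    "\<forall>i. analytic2_at (\<lambda>w. pdu (pdu x) w $ i) z" "\<forall>i. analytic2_at (\<lambda>w. pdv (pdu x) w $ i) z"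
    "\<forall>i. analytic2_at (\<lambda>w. pdv (pdv x) w $ i) z"
    using p[OF assms(2)] p[OF p(1)[OF assms(2)]] p[OF p(2)[OF assms(2)]] assms(3)
    by (auto simp: vec_analytic_on_def)
  show 1: "analytic2_at (fffE x) z" "analytic2_at (fffF x) z" "analytic2_at (fffG x) z"
    unfolding fffE_def[abs_def] fffF_def[abs_def] fffG_def[abs_def] by (intro analytic2_at_mink c)+
  show 2: "analytic2_at (lbar x) z" "analytic2_at (mbar x) z" "analytic2_at (nbar x) z"
    unfolding lbar_def[abs_def] mbar_def[abs_def] nbar_def[abs_def] by (intro analytic2_at_mink analytic2_at_mcross c)+
  show "analytic2_at (umb_a x) z" "analytic2_at (umb_b x) z" "analytic2_at (umb_c x) z"
    unfolding umb_a_def[abs_def] umb_b_def[abs_def] umb_c_def[abs_def] by (intro analytic2_at_intros 1 2)+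
qed

text \<open>The three functions are the minors of a matrix with the two rows $(E,F,G)$ and
  $(\bar l,\bar m,\bar n)$; repeating the first row gives a vanishing determinant.\<close>

lemma umb_syzygy: "fffE x z * umb_a x z - fffF x z * umb_b x z + fffG x z * umb_c x z = 0"
  by (simp add: umb_a_def umb_b_def umb_c_def algebra_simps)

lemma det2_nonzero_iff_injective:
  fixes a1 a2 b1 b2 :: real
  shows "a1 * b2 - a2 * b1 \<noteq> 0 \<longleftrightarrow> (\<forall>s t. s * a1 + t * a2 = 0 \<and> s * b1 + t * b2 = 0 \<longrightarrow> s = 0 \<and> t = 0)"
proof
  assume d: "a1 * b2 - a2 * b1 \<noteq> 0"
  show "\<forall>s t. s * a1 + t * a2 = 0 \<and> s * b1 + t * b2 = 0 \<longrightarrow> s = 0 \<and> t = 0"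
  proof (intro allI impI)
    fix s t assume st: "s * a1 + t * a2 = 0 \<and> s * b1 + t * b2 = 0"
    then have "s * (a1 * b2 - a2 * b1) = 0" "t * (a1 * b2 - a2 * b1) = 0" by algebra+
    with d show "s = 0 \<and> t = 0" by simp
  qed
next
  assume *: "\<forall>s t. s * a1 + t * a2 = 0 \<and> s * b1 + t * b2 = 0 \<longrightarrow> s = 0 \<and> t = 0"
  show "a1 * b2 - a2 * b1 \<noteq> 0"
  proof
    assume d: "a1 * b2 - a2 * b1 = 0"
    have "a2 = 0 \<and> - a1 = 0" by (rule *[rule_format]) (use d in \<open>auto simp: algebra_simps\<close>)
    moreover have "b2 = 0 \<and> - b1 = 0" by (rule *[rule_format]) (use d in \<open>auto simp: algebra_simps\<close>)
    ultimately show False using *[rule_format, of 1 0] by auto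
  qed
qed

text \<open>The differential at \<open>q\<close> of the triple of umbilic functions, applied to \<open>d\<close>.\<close>

definition umb_differential :: "(real \<times> real \<Rightarrow> real^3) \<Rightarrow> real \<times> real \<Rightarrow> real \<times> real \<Rightarrow> real \<times> real \<times> real" where
  "umb_differential x q d = (fst d * pdu (umb_a x) q + snd d * pdv (umb_a x) q,
     fst d * pdu (umb_b x) q + snd d * pdv (umb_b x) q, fst d * pdu (umb_c x) q + snd d * pdv (umb_c x) q)"

lemma umb_differential_syzygy:
  assumes "open D" "vec_analytic_on D x" "q \<in> D" "umbilic_at x q"
    and "umb_differential x q d = (\<alpha>, \<beta>, \<gamma>)"
  shows "fffE x q * \<alpha> - fffF x q * \<beta> + fffG x q * \<gamma> = 0"
proof -
  note A = analytic2_at_fundamental_forms[OF assms(1-3), THEN analytic2_has_derivative]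
  have u: "umb_a x q = 0" "umb_b x q = 0" "umb_c x q = 0" using assms(4) by (auto simp: umbilic_at_def)
  have \<alpha>: "\<alpha> = fst d * pdu (umb_a x) q + snd d * pdv (umb_a x) q"
    "\<beta> = fst d * pdu (umb_b x) q + snd d * pdv (umb_b x) q" "\<gamma> = fst d * pdu (umb_c x) q + snd d * pdv (umb_c x) q"
    using assms(5) by (auto simp: umb_differential_def)
  have "((\<lambda>z. fffE x z * umb_a x z - fffF x z * umb_b x z + fffG x z * umb_c x z) has_derivative
     (\<lambda>d. fffE x q * (fst d * pdu (umb_a x) q + snd d * pdv (umb_a x) q) - fffF x q * (fst d * pdu (umb_b x) q + snd d * pdv (umb_b x) q)
        + fffG x q * (fst d * pdu (umb_c x) q + snd d * pdv (umb_c x) q))) (at q)"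
    by (rule A derivative_eq_intros refl)+ (simp add: u)
  moreover have "((\<lambda>z. fffE x z * umb_a x z - fffF x z * umb_b x z + fffG x z * umb_c x z) has_derivative (\<lambda>d. 0)) (at q)"
    unfolding umb_syzygy by simp
  ultimately show ?thesis unfolding \<alpha> using has_derivative_unique by (metis (no_types, lifting))
qed

text \<open>The multiplicity depends only on the ideal.  Where two of \<open>E\<close>, \<open>F\<close>, \<open>G\<close> are nonzero, dividing the
  syzygy by either of them shows that the corresponding ideals coincide, so the description determines the
  value uniquely and consistently.\<close>

lemma umbilic_multiplicity_values:
  assumes "open D" "vec_analytic_on D x" "q \<in> D"
  shows "fffE x q \<noteq> 0 \<Longrightarrow> umbilic_multiplicity x q = multiplicity2 (umb_b x) (umb_c x) q"
    and "fffF x q \<noteq> 0 \<Longrightarrow> umbilic_multiplicity x q = multiplicity2 (umb_a x) (umb_c x) q"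
    and "fffG x q \<noteq> 0 \<Longrightarrow> umbilic_multiplicity x q = multiplicity2 (umb_a x) (umb_b x) q"
proof -
  note A = analytic2_at_fundamental_forms[OF assms]
  let ?a = "complexification (umb_a x) q" and ?b = "complexification (umb_b x) q" and ?c = "complexification (umb_c x) q"
  let ?Q = "complex_point q"
  have holo: "?a \<in> holo_germs ?Q" "?b \<in> holo_germs ?Q" "?c \<in> holo_germs ?Q"
    using A(7-9)[THEN analytic2_at_complexification(1)] by (auto simp: holo_germs_def)
  have s: "fffE x z * umb_a x z = fffF x z * umb_b x z + - fffG x z * umb_c x z"
     "fffF x z * umb_b x z = fffE x z * umb_a x z + fffG x z * umb_c x z"
     "fffG x z * umb_c x z = - fffE x z * umb_a x z + fffF x z * umb_b x z" for z
    using umb_syzygy[of x z] by simp_all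
  have a: "?a \<in> germ_ideal ?b ?c ?Q" if "fffE x q \<noteq> 0"
    by (rule complexification_in_germ_ideal[where e = "fffE x" and f = "fffF x" and g = "\<lambda>z. - fffG x z"])
      (use that s(1) in \<open>auto intro!: A analytic2_at_minus\<close>)
  have b: "?b \<in> germ_ideal ?a ?c ?Q" if "fffF x q \<noteq> 0"
    by (rule complexification_in_germ_ideal[where e = "fffF x" and f = "fffE x" and g = "fffG x"])
      (use that s(2) in \<open>auto intro!: A\<close>)
  have c: "?c \<in> germ_ideal ?a ?b ?Q" if "fffG x q \<noteq> 0"
    by (rule complexification_in_germ_ideal[where e = "fffG x" and f = "\<lambda>z. - fffE x z" and g = "fffF x"])
      (use that s(3) in \<open>auto intro!: A analytic2_at_minus\<close>)
  note g = germ_ideal_generators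
  have EF: "germ_ideal ?b ?c ?Q = germ_ideal ?a ?c ?Q" if "fffE x q \<noteq> 0" "fffF x q \<noteq> 0"
    using germ_ideal_mono[OF a[OF that(1)] g(2)[OF holo(2,3)]] germ_ideal_mono[OF b[OF that(2)] g(2)[OF holo(1,3)]] by auto
  have EG: "germ_ideal ?b ?c ?Q = germ_ideal ?a ?b ?Q" if "fffE x q \<noteq> 0" "fffG x q \<noteq> 0"
    using germ_ideal_mono[OF a[OF that(1)] g(1)[OF holo(2,3)]] germ_ideal_mono[OF g(2)[OF holo(1,2)] c[OF that(2)]] by auto
  have FG: "germ_ideal ?a ?c ?Q = germ_ideal ?a ?b ?Q" if "fffF x q \<noteq> 0" "fffG x q \<noteq> 0"
    using germ_ideal_mono[OF g(1)[OF holo(1,3)] b[OF that(1)]] germ_ideal_mono[OF g(1)[OF holo(1,2)] c[OF that(2)]] by auto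
  have EF': "multiplicity2 (umb_b x) (umb_c x) q = multiplicity2 (umb_a x) (umb_c x) q" if "fffE x q \<noteq> 0" "fffF x q \<noteq> 0"
    using EF[OF that] by (simp add: multiplicity2_def)
  have EG': "multiplicity2 (umb_b x) (umb_c x) q = multiplicity2 (umb_a x) (umb_b x) q" if "fffE x q \<noteq> 0" "fffG x q \<noteq> 0"
    using EG[OF that] by (simp add: multiplicity2_def)
  have FG': "multiplicity2 (umb_a x) (umb_c x) q = multiplicity2 (umb_a x) (umb_b x) q" if "fffF x q \<noteq> 0" "fffG x q \<noteq> 0"
    using FG[OF that] by (simp add: multiplicity2_def)
  show "umbilic_multiplicity x q = multiplicity2 (umb_b x) (umb_c x) q" if "fffE x q \<noteq> 0"
    unfolding umbilic_multiplicity_def by (rule the_equality) (use that EF' EG' FG' in auto)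
  show "umbilic_multiplicity x q = multiplicity2 (umb_a x) (umb_c x) q" if "fffF x q \<noteq> 0"
    unfolding umbilic_multiplicity_def by (rule the_equality) (use that EF' EG' FG' in auto)
  show "umbilic_multiplicity x q = multiplicity2 (umb_a x) (umb_b x) q" if "fffG x q \<noteq> 0"
    unfolding umbilic_multiplicity_def by (rule the_equality) (use that EF' EG' FG' in auto)
qed

text \<open>By the differentiated syzygy, the differential of the function left out of the chosen pair vanishes
  wherever those of the pair do.\<close>

lemma umbilic_multiplicity_eq_1_iff:
  assumes "open D" "vec_analytic_on D x" "q \<in> D" "umbilic_at x q"
    and "fffE x q \<noteq> 0 \<or> fffF x q \<noteq> 0 \<or> fffG x q \<noteq> 0"
  shows "umbilic_multiplicity x q = 1 \<longleftrightarrow> (\<forall>d. umb_differential x q d = 0 \<longrightarrow> d = 0)"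
proof -
  note A = analytic2_at_fundamental_forms(7-9)[OF assms(1-3)]
  note V = umbilic_multiplicity_values[OF assms(1-3)]
  have u: "umb_a x q = 0" "umb_b x q = 0" "umb_c x q = 0" using assms(4) by (auto simp: umbilic_at_def)
  define \<alpha> \<beta> \<gamma> where abc: "\<alpha> s t = s * pdu (umb_a x) q + t * pdv (umb_a x) q"
    "\<beta> s t = s * pdu (umb_b x) q + t * pdv (umb_b x) q" "\<gamma> s t = s * pdu (umb_c x) q + t * pdv (umb_c x) q" for s t
  have d: "umb_differential x q (s, t) = (\<alpha> s t, \<beta> s t, \<gamma> s t)" for s t
    by (simp add: umb_differential_def abc)
  have z: "fffE x q * \<alpha> s t - fffF x q * \<beta> s t + fffG x q * \<gamma> s t = 0" for s t
    by (rule umb_differential_syzygy[OF assms(1-4) d])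
  have R: "(\<forall>d. umb_differential x q d = 0 \<longrightarrow> d = 0) \<longleftrightarrow>
      (\<forall>s t. \<alpha> s t = 0 \<and> \<beta> s t = 0 \<and> \<gamma> s t = 0 \<longrightarrow> s = 0 \<and> t = 0)"
    by (simp add: split_paired_all zero_prod_def d)
  consider "fffE x q \<noteq> 0" | "fffF x q \<noteq> 0" | "fffG x q \<noteq> 0" using assms(5) by blast
  then show ?thesis
  proof cases
    case 1
    then have "\<beta> s t = 0 \<and> \<gamma> s t = 0 \<longleftrightarrow> \<alpha> s t = 0 \<and> \<beta> s t = 0 \<and> \<gamma> s t = 0" for s t using z[of s t] by auto
    then show ?thesis
      unfolding V(1)[OF 1] multiplicity2_eq_1_iff[OF A(2,3) u(2,3)] det2_nonzero_iff_injective R by (simp add: abc)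
  next
    case 2
    then have "\<alpha> s t = 0 \<and> \<gamma> s t = 0 \<longleftrightarrow> \<alpha> s t = 0 \<and> \<beta> s t = 0 \<and> \<gamma> s t = 0" for s t using z[of s t] by auto
    then show ?thesis
      unfolding V(2)[OF 2] multiplicity2_eq_1_iff[OF A(1,3) u(1,3)] det2_nonzero_iff_injective R by (simp add: abc)
  next
    case 3
    then have "\<alpha> s t = 0 \<and> \<beta> s t = 0 \<longleftrightarrow> \<alpha> s t = 0 \<and> \<beta> s t = 0 \<and> \<gamma> s t = 0" for s t using z[of s t] by auto
    then show ?thesis
      unfolding V(3)[OF 3] multiplicity2_eq_1_iff[OF A(1,2) u(1,2)] det2_nonzero_iff_injective R by (simp add: abc)
  qed
qed

text \<open>Suppose that all products vanish.  The combination of \<open>u\<close> and \<open>v\<close> that cancels the timelike coordinates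
  is isotropic, and the product is positive definite on vectors without timelike coordinate, so it is zero.  By
  independence both timelike coordinates are zero, and for the same reason so is \<open>u\<close>.\<close>

lemma no_isotropic_plane:
  assumes ind: "\<forall>\<alpha> \<beta>. \<alpha> *\<^sub>R u + \<beta> *\<^sub>R v = (0 :: real^3) \<longrightarrow> \<alpha> = 0 \<and> \<beta> = 0"
  shows "mink u u \<noteq> 0 \<or> mink u v \<noteq> 0 \<or> mink v v \<noteq> 0"
proof (rule ccontr)
  assume n: "\<not> ?thesis"
  let ?w = "v $ 3 *\<^sub>R u + (- u $ 3) *\<^sub>R v"
  have "mink ?w ?w = (v $ 3)\<^sup>2 * mink u u - 2 * u $ 3 * v $ 3 * mink u v + (u $ 3)\<^sup>2 * mink v v"
    by (simp add: mink_def power2_eq_square algebra_simps)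
  then have "(?w $ 1)\<^sup>2 + (?w $ 2)\<^sup>2 = 0"
    using n by (simp add: mink_def power2_eq_square)
  then have "?w = 0" by (simp add: vec_eq_iff forall_3 sum_power2_eq_zero_iff)
  then have "v $ 3 = 0 \<and> - u $ 3 = 0" by (rule ind[rule_format])
  then have "(u $ 1)\<^sup>2 + (u $ 2)\<^sup>2 = 0" using n by (simp add: mink_def power2_eq_square)
  then have "u = 0" using \<open>v $ 3 = 0 \<and> - u $ 3 = 0\<close> by (simp add: vec_eq_iff forall_3 sum_power2_eq_zero_iff)
  then show False using ind[rule_format, of 1 0] by simp
qed

section \<open>Surfaces as graphs in a frame\<close>

definition fdet :: "real^3 \<Rightarrow> real^3 \<Rightarrow> real^3 \<Rightarrow> real" where
  "fdet u v w = det (vector [u, v, w])"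

lemma fdet_expand:
  "fdet u v w = u $ 1 * v $ 2 * w $ 3 + u $ 2 * v $ 3 * w $ 1 + u $ 3 * v $ 1 * w $ 2
    - u $ 1 * v $ 3 * w $ 2 - u $ 2 * v $ 1 * w $ 3 - u $ 3 * v $ 2 * w $ 1"
  by (simp add: fdet_def det_3 vector_3)

text \<open>Coordinates with respect to a frame by Cramer's rule; as explicit formulas they are differentiable
  in the frame as well.\<close>

definition frame_coord1 :: "real^3 \<Rightarrow> real^3 \<Rightarrow> real^3 \<Rightarrow> real^3 \<Rightarrow> real" where
  "frame_coord1 u v w y = fdet y v w / fdet u v w"
definition frame_coord2 :: "real^3 \<Rightarrow> real^3 \<Rightarrow> real^3 \<Rightarrow> real^3 \<Rightarrow> real" where
  "frame_coord2 u v w y = fdet u y w / fdet u v w"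
definition frame_coord3 :: "real^3 \<Rightarrow> real^3 \<Rightarrow> real^3 \<Rightarrow> real^3 \<Rightarrow> real" where
  "frame_coord3 u v w y = fdet u v y / fdet u v w"

text \<open>In the coordinates of the frame \<open>u, v, w\<close> centred at \<open>x z\<close>, the point \<open>x z'\<close> lies on the graph of \<open>f\<close>.\<close>

abbreviation graph_near ::
  "real^3 \<Rightarrow> real^3 \<Rightarrow> real^3 \<Rightarrow> (real \<times> real \<Rightarrow> real) \<Rightarrow> (real \<times> real \<Rightarrow> real^3) \<Rightarrow> real \<times> real \<Rightarrow> bool" where
  "graph_near u v w f x z \<equiv> \<forall>\<^sub>F z' in nhds z.
     f (frame_coord1 u v w (x z' - x z), frame_coord2 u v w (x z' - x z)) = frame_coord3 u v w (x z' - x z)"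

lemma frame_coords_combine:
  assumes "fdet u v w \<noteq> 0"
  shows "frame_coord1 u v w y *\<^sub>R u + frame_coord2 u v w y *\<^sub>R v + frame_coord3 u v w y *\<^sub>R w = y"
proof -
  have "fdet y v w *\<^sub>R u + fdet u y w *\<^sub>R v + fdet u v y *\<^sub>R w = fdet u v w *\<^sub>R y"
    by (simp add: vec_eq_iff forall_3 fdet_expand) algebra
  then have "(1 / fdet u v w) *\<^sub>R (fdet y v w *\<^sub>R u + fdet u y w *\<^sub>R v + fdet u v y *\<^sub>R w) = y"
    using assms by simp
  then show ?thesis
    by (simp add: frame_coord1_def frame_coord2_def frame_coord3_def scaleR_add_right)
qed

lemma frame_coords_of_combination:
  assumes "fdet u v w \<noteq> 0"
  shows "frame_coord1 u v w (r *\<^sub>R u + s *\<^sub>R v + t *\<^sub>R w) = r"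
    "frame_coord2 u v w (r *\<^sub>R u + s *\<^sub>R v + t *\<^sub>R w) = s"
    "frame_coord3 u v w (r *\<^sub>R u + s *\<^sub>R v + t *\<^sub>R w) = t"
proof -
  have "fdet (r *\<^sub>R u + s *\<^sub>R v + t *\<^sub>R w) v w = r * fdet u v w"
    "fdet u (r *\<^sub>R u + s *\<^sub>R v + t *\<^sub>R w) w = s * fdet u v w"
    "fdet u v (r *\<^sub>R u + s *\<^sub>R v + t *\<^sub>R w) = t * fdet u v w"
    by (simp_all add: fdet_expand; algebra)+
  then show "frame_coord1 u v w (r *\<^sub>R u + s *\<^sub>R v + t *\<^sub>R w) = r"
    "frame_coord2 u v w (r *\<^sub>R u + s *\<^sub>R v + t *\<^sub>R w) = s"
    "frame_coord3 u v w (r *\<^sub>R u + s *\<^sub>R v + t *\<^sub>R w) = t"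
    using assms by (simp_all add: frame_coord1_def frame_coord2_def frame_coord3_def)
qed

lemma bounded_linear_frame_coords:
  "bounded_linear (frame_coord1 u v w)" "bounded_linear (frame_coord2 u v w)" "bounded_linear (frame_coord3 u v w)"
  unfolding linear_conv_bounded_linear[symmetric]
  by (rule linearI; simp add: frame_coord1_def frame_coord2_def frame_coord3_def fdet_expand field_simps add_divide_distrib diff_divide_distrib)+

text \<open>The equation of the graph is differentiated at all points near \<open>z\<close>, and the resulting identities
  once more at \<open>z\<close>, where the first two coordinates vanish.  The equation is phrased in the given
  parametrisation, so the chain rule applies to it directly.  The form \<open>Q\<close> is the Hessian of \<open>f\<close> pulled back to the
  tangent plane.\<close>

lemma Monge_chain_rule:
  fixes f :: "real \<times> real \<Rightarrow> real"
  assumes D: "open D" "vec_analytic_on D x" "z \<in> D"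
    and L: "bounded_linear (L1 :: real^3 \<Rightarrow> real)" "bounded_linear L2" "bounded_linear L3"
    and f: "analytic2_at f (0, 0)"
    and eq: "\<forall>\<^sub>F z' in nhds z. f (L1 (x z' - x z), L2 (x z' - x z)) = L3 (x z' - x z)"
  defines "Q \<equiv> \<lambda>s t. pdu (pdu f) (0, 0) * L1 s * L1 t + pdv (pdu f) (0, 0) * (L1 s * L2 t + L2 s * L1 t) + pdv (pdv f) (0, 0) * L2 s * L2 t"
  shows "L3 (pdu x z) = pdu f (0, 0) * L1 (pdu x z) + pdv f (0, 0) * L2 (pdu x z)"
    and "L3 (pdv x z) = pdu f (0, 0) * L1 (pdv x z) + pdv f (0, 0) * L2 (pdv x z)"
    and "L3 (pdu (pdu x) z) = pdu f (0, 0) * L1 (pdu (pdu x) z) + pdv f (0, 0) * L2 (pdu (pdu x) z) + Q (pdu x z) (pdu x z)"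
    and "L3 (pdv (pdu x) z) = pdu f (0, 0) * L1 (pdv (pdu x) z) + pdv f (0, 0) * L2 (pdv (pdu x) z) + Q (pdu x z) (pdv x z)"
    and "L3 (pdv (pdv x) z) = pdu f (0, 0) * L1 (pdv (pdv x) z) + pdv f (0, 0) * L2 (pdv (pdv x) z) + Q (pdv x z) (pdv x z)"
proof -
  let ?y = "\<lambda>z'. (L1 (x z' - x z), L2 (x z' - x z))"
  have X: "(x has_derivative (\<lambda>d. fst d *\<^sub>R pdu x w + snd d *\<^sub>R pdv x w)) (at w)" if "w \<in> D" for w
    by (rule vec_analytic_has_derivative) (use D that in \<open>auto simp: vec_analytic_on_def\<close>)
  have XL: "((\<lambda>w. L (x w - x z)) has_derivative (\<lambda>d. L (fst d *\<^sub>R pdu x w + snd d *\<^sub>R pdv x w))) (at w)"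
    if "w \<in> D" "bounded_linear L" for w and L :: "real^3 \<Rightarrow> real"
    by (rule bounded_linear.has_derivative[OF that(2)]) (use X[OF that(1)] in \<open>auto intro!: derivative_eq_intros\<close>)
  have y: "(?y has_derivative (\<lambda>d. (L1 (fst d *\<^sub>R pdu x w + snd d *\<^sub>R pdv x w), L2 (fst d *\<^sub>R pdu x w + snd d *\<^sub>R pdv x w)))) (at w)"
    if "w \<in> D" for w
    by (intro has_derivative_Pair XL that L)
  have y0: "?y z = (0, 0)" using L by (simp add: linear_simps)
  have ty: "filterlim ?y (nhds (0, 0)) (nhds z)"
    using has_derivative_continuous[OF y[OF D(3)]] y0
    unfolding isCont_def tendsto_at_iff_tendsto_nhds[of ?y z] by metis
  have inD: "\<forall>\<^sub>F z' in nhds z. z' \<in> D" using D by (intro eventually_nhds_in_open)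
  have fd: "\<forall>\<^sub>F z' in nhds z. (f has_derivative (\<lambda>d. fst d * pdu f (?y z') + snd d * pdv f (?y z'))) (at (?y z'))"
    by (rule eventually_compose_filterlim[OF analytic2_eventually_derivative[OF f] ty])
  have ev2: "\<forall>\<^sub>F z' in nhds z. \<forall>\<^sub>F w in nhds z'. f (?y w) = L3 (x w - x z)"
    using eq by (simp add: eventually_eventually)
  have first: "\<forall>\<^sub>F z' in nhds z.
     L3 (pdu x z') = pdu f (?y z') * L1 (pdu x z') + pdv f (?y z') * L2 (pdu x z') \<and>
     L3 (pdv x z') = pdu f (?y z') * L1 (pdv x z') + pdv f (?y z') * L2 (pdv x z')"
    using inD fd ev2
  proof eventually_elim
    case (elim w)
    let ?d = "\<lambda>d. fst d *\<^sub>R pdu x w + snd d *\<^sub>R pdv x w"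
    have "(f \<circ> ?y has_derivative (\<lambda>d. fst d * pdu f (?y w) + snd d * pdv f (?y w)) \<circ> (\<lambda>d. (L1 (?d d), L2 (?d d)))) (at w)"
      by (rule diff_chain_at[OF y[OF elim(1)] elim(2)])
    then have 1: "((\<lambda>w. f (?y w)) has_derivative (\<lambda>d. L1 (?d d) * pdu f (?y w) + L2 (?d d) * pdv f (?y w))) (at w)"
      by (simp add: o_def)
    have "(\<lambda>d. L1 (?d d) * pdu f (?y w) + L2 (?d d) * pdv f (?y w)) = (\<lambda>d. L3 (?d d))"
    proof (rule has_derivative_unique)
      show "((\<lambda>w. L3 (x w - x z)) has_derivative (\<lambda>d. L1 (?d d) * pdu f (?y w) + L2 (?d d) * pdv f (?y w))) (at w)"
        by (rule has_derivative_eventually_cong[OF 1 elim(3)])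
      show "((\<lambda>w. L3 (x w - x z)) has_derivative (\<lambda>d. L3 (?d d))) (at w)"
        by (rule XL[OF elim(1) L(3)])
    qed
    from fun_cong[OF this, of "(1, 0)"] fun_cong[OF this, of "(0, 1)"] show ?case
      by (simp add: mult.commute)
  qed
  from eventually_nhds_x_imp_x[OF this]
  show f1: "L3 (pdu x z) = pdu f (0, 0) * L1 (pdu x z) + pdv f (0, 0) * L2 (pdu x z)"
    and f2: "L3 (pdv x z) = pdu f (0, 0) * L1 (pdv x z) + pdv f (0, 0) * L2 (pdv x z)"
    unfolding y0 by simp_all
  have second: "L3 (fst d *\<^sub>R pdu \<xi> z + snd d *\<^sub>R pdv \<xi> z) = pdu f (0, 0) * L1 (fst d *\<^sub>R pdu \<xi> z + snd d *\<^sub>R pdv \<xi> z)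
      + pdv f (0, 0) * L2 (fst d *\<^sub>R pdu \<xi> z + snd d *\<^sub>R pdv \<xi> z) + Q (\<xi> z) (fst d *\<^sub>R pdu x z + snd d *\<^sub>R pdv x z)"
    if \<xi>: "vec_analytic_on D \<xi>"
      and ev: "\<forall>\<^sub>F z' in nhds z. L3 (\<xi> z') = pdu f (?y z') * L1 (\<xi> z') + pdv f (?y z') * L2 (\<xi> z')" for \<xi> d
  proof -
    let ?d = "\<lambda>d. fst d *\<^sub>R pdu x z + snd d *\<^sub>R pdv x z"
    let ?e = "\<lambda>d. fst d *\<^sub>R pdu \<xi> z + snd d *\<^sub>R pdv \<xi> z"
    have \<Xi>: "(\<xi> has_derivative ?e) (at z)"
      by (rule vec_analytic_has_derivative) (use D \<xi> in \<open>auto simp: vec_analytic_on_def\<close>)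
    have LX: "((\<lambda>z'. L (\<xi> z')) has_derivative (\<lambda>d. L (?e d))) (at z)" if "bounded_linear L" for L :: "real^3 \<Rightarrow> real"
      by (rule bounded_linear.has_derivative[OF that \<Xi>])
    have G: "((\<lambda>z'. g (?y z')) has_derivative (\<lambda>d. L1 (?d d) * pdu g (0, 0) + L2 (?d d) * pdv g (0, 0))) (at z)"
      if "analytic2_at g (0, 0)" for g :: "real \<times> real \<Rightarrow> real"
    proof -
      have "(g \<circ> ?y has_derivative (\<lambda>d. fst d * pdu g (0, 0) + snd d * pdv g (0, 0)) \<circ> (\<lambda>d. (L1 (?d d), L2 (?d d)))) (at z)"
        by (rule diff_chain_at[OF y[OF D(3)]]) (use analytic2_has_derivative[OF that] in \<open>simp only: y0\<close>)
      then show ?thesis by (simp add: o_def)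
    qed
    have R: "((\<lambda>z'. pdu f (?y z') * L1 (\<xi> z') + pdv f (?y z') * L2 (\<xi> z')) has_derivative
       (\<lambda>d. pdu f (0, 0) * L1 (?e d) + (L1 (?d d) * pdu (pdu f) (0, 0) + L2 (?d d) * pdv (pdu f) (0, 0)) * L1 (\<xi> z)
         + (pdv f (0, 0) * L2 (?e d) + (L1 (?d d) * pdu (pdv f) (0, 0) + L2 (?d d) * pdv (pdv f) (0, 0)) * L2 (\<xi> z)))) (at z)"
      using has_derivative_add[OF has_derivative_mult[OF G[OF analytic2_at_pdu[OF f]] LX[OF L(1)]] has_derivative_mult[OF G[OF analytic2_at_pdv[OF f]] LX[OF L(2)]]]
      unfolding y0 .
    have "(\<lambda>d. pdu f (0, 0) * L1 (?e d) + (L1 (?d d) * pdu (pdu f) (0, 0) + L2 (?d d) * pdv (pdu f) (0, 0)) * L1 (\<xi> z)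
         + (pdv f (0, 0) * L2 (?e d) + (L1 (?d d) * pdu (pdv f) (0, 0) + L2 (?d d) * pdv (pdv f) (0, 0)) * L2 (\<xi> z))) = (\<lambda>d. L3 (?e d))"
    proof (rule has_derivative_unique)
      show "((\<lambda>z'. L3 (\<xi> z')) has_derivative
       (\<lambda>d. pdu f (0, 0) * L1 (?e d) + (L1 (?d d) * pdu (pdu f) (0, 0) + L2 (?d d) * pdv (pdu f) (0, 0)) * L1 (\<xi> z)
         + (pdv f (0, 0) * L2 (?e d) + (L1 (?d d) * pdu (pdv f) (0, 0) + L2 (?d d) * pdv (pdv f) (0, 0)) * L2 (\<xi> z)))) (at z)"
        by (rule has_derivative_eventually_cong[OF R], rule eventually_mono[OF ev], simp)
    qed (rule LX[OF L(3)])
    from fun_cong[OF this, of d] show ?thesis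
      unfolding Q_def analytic2_pdu_pdv[OF f] by (simp add: algebra_simps)
  qed
  note an = vec_analytic_on_pd[OF D(1,2)]
  have u: "\<forall>\<^sub>F z' in nhds z. L3 (pdu x z') = pdu f (?y z') * L1 (pdu x z') + pdv f (?y z') * L2 (pdu x z')"
    and v: "\<forall>\<^sub>F z' in nhds z. L3 (pdv x z') = pdu f (?y z') * L1 (pdv x z') + pdv f (?y z') * L2 (pdv x z')"
    using first by (auto elim: eventually_mono)
  show "L3 (pdu (pdu x) z) = pdu f (0, 0) * L1 (pdu (pdu x) z) + pdv f (0, 0) * L2 (pdu (pdu x) z) + Q (pdu x z) (pdu x z)"
    "L3 (pdv (pdu x) z) = pdu f (0, 0) * L1 (pdv (pdu x) z) + pdv f (0, 0) * L2 (pdv (pdu x) z) + Q (pdu x z) (pdv x z)"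
    using second[OF an(1) u, of "(1, 0)"] second[OF an(1) u, of "(0, 1)"] by simp_all
  show "L3 (pdv (pdv x) z) = pdu f (0, 0) * L1 (pdv (pdv x) z) + pdv f (0, 0) * L2 (pdv (pdv x) z) + Q (pdv x z) (pdv x z)"
    using second[OF an(2) v, of "(0, 1)"] by simp
qed

section \<open>Umbilic points of graphs and the umbilic stratum\<close>

lemma frame_graph_derivatives:
  fixes f :: "real \<times> real \<Rightarrow> real" and u v w :: "real^3"
  assumes f: "analytic2_at f (0, 0)"
  defines "X \<equiv> frame_graph u v w f"
  shows "pdu X (0, 0) = u + pdu f (0, 0) *\<^sub>R w" "pdv X (0, 0) = v + pdv f (0, 0) *\<^sub>R w"
    "pdu (pdu X) (0, 0) = pdu (pdu f) (0, 0) *\<^sub>R w" "pdv (pdu X) (0, 0) = pdv (pdu f) (0, 0) *\<^sub>R w"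
    "pdv (pdv X) (0, 0) = pdv (pdv f) (0, 0) *\<^sub>R w"
proof -
  have "pdu X z = u + pdu f z *\<^sub>R w \<and> pdv X z = v + pdv f z *\<^sub>R w"
    if "(f has_derivative (\<lambda>d. fst d * pdu f z + snd d * pdv f z)) (at z)" for z
  proof -
    have "(X has_derivative (\<lambda>d. fst d *\<^sub>R u + snd d *\<^sub>R v + (fst d * pdu f z + snd d * pdv f z) *\<^sub>R w)) (at z)"
      unfolding X_def frame_graph_def[abs_def] using that by (auto intro!: derivative_eq_intros)
    then show ?thesis using has_derivative_imp_pdu has_derivative_imp_pdv by fastforce
  qed
  then have ev: "\<forall>\<^sub>F z in nhds (0, 0). pdu X z = u + pdu f z *\<^sub>R w" "\<forall>\<^sub>F z in nhds (0, 0). pdv X z = v + pdv f z *\<^sub>R w"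
    using analytic2_eventually_derivative[OF f] by (auto elim: eventually_mono)
  show "pdu X (0, 0) = u + pdu f (0, 0) *\<^sub>R w" "pdv X (0, 0) = v + pdv f (0, 0) *\<^sub>R w"
    using ev[THEN eventually_nhds_x_imp_x] by auto
  have g: "pdu (\<lambda>z. a + g z *\<^sub>R w) (0, 0) = pdu g (0, 0) *\<^sub>R w" "pdv (\<lambda>z. a + g z *\<^sub>R w) (0, 0) = pdv g (0, 0) *\<^sub>R w"
    if "analytic2_at g (0, 0)" for g :: "real \<times> real \<Rightarrow> real" and a
  proof -
    have "((\<lambda>z. a + g z *\<^sub>R w) has_derivative (\<lambda>d. (fst d * pdu g (0, 0) + snd d * pdv g (0, 0)) *\<^sub>R w)) (at (0, 0))"
      using analytic2_has_derivative[OF that] by (auto intro!: derivative_eq_intros)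
    from has_derivative_imp_pdu[OF this] has_derivative_imp_pdv[OF this]
    show "pdu (\<lambda>z. a + g z *\<^sub>R w) (0, 0) = pdu g (0, 0) *\<^sub>R w" "pdv (\<lambda>z. a + g z *\<^sub>R w) (0, 0) = pdv g (0, 0) *\<^sub>R w"
      by simp_all
  qed
  show "pdu (pdu X) (0, 0) = pdu (pdu f) (0, 0) *\<^sub>R w" "pdv (pdu X) (0, 0) = pdv (pdu f) (0, 0) *\<^sub>R w"
    "pdv (pdv X) (0, 0) = pdv (pdv f) (0, 0) *\<^sub>R w"
    using pdu_cong[OF ev(1)] pdu_cong[OF ev(2)] g[OF analytic2_at_pdu[OF f]] g[OF analytic2_at_pdv[OF f]] by simp_all
qed

text \<open>First fundamental form at the origin of the graph of a jet, and the minors of the two fundamental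
  forms.  The second fundamental form of the graph is $(2a_{20},a_{21},2a_{22})$ times the determinant of the
  frame; that factor is omitted in the minors.\<close>

definition jetE :: "real^3 \<Rightarrow> real^3 \<Rightarrow> real^3 \<Rightarrow> jet \<Rightarrow> real" where
  "jetE u v w a = mink (u + a 1 0 *\<^sub>R w) (u + a 1 0 *\<^sub>R w)"
definition jetF :: "real^3 \<Rightarrow> real^3 \<Rightarrow> real^3 \<Rightarrow> jet \<Rightarrow> real" where
  "jetF u v w a = mink (u + a 1 0 *\<^sub>R w) (v + a 1 1 *\<^sub>R w)"
definition jetG :: "real^3 \<Rightarrow> real^3 \<Rightarrow> real^3 \<Rightarrow> jet \<Rightarrow> real" where
  "jetG u v w a = mink (v + a 1 1 *\<^sub>R w) (v + a 1 1 *\<^sub>R w)"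

definition jetA :: "real^3 \<Rightarrow> real^3 \<Rightarrow> real^3 \<Rightarrow> jet \<Rightarrow> real" where
  "jetA u v w a = jetF u v w a * (2 * a 2 2) - jetG u v w a * a 2 1"
definition jetB :: "real^3 \<Rightarrow> real^3 \<Rightarrow> real^3 \<Rightarrow> jet \<Rightarrow> real" where
  "jetB u v w a = jetE u v w a * (2 * a 2 2) - jetG u v w a * (2 * a 2 0)"
definition jetC :: "real^3 \<Rightarrow> real^3 \<Rightarrow> real^3 \<Rightarrow> jet \<Rightarrow> real" where
  "jetC u v w a = jetE u v w a * a 2 1 - jetF u v w a * (2 * a 2 0)"

lemma mink_mcross_fdet: "mink (mcross a b) c = fdet a b c"
  by (simp add: mink_mcross fdet_def)

lemma expansion2_jet_poly:
  "expansion2 (jet_poly k a) (0, 0) (\<lambda>i j. if 1 \<le> i + j \<and> i + j \<le> k then a (i + j) j else 0)"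
proof (rule expansion2I)
  let ?A = "{..k} \<times> {..k} \<inter> {(i, j). 1 \<le> i + j \<and> i + j \<le> k}"
  let ?c = "\<lambda>i j. if 1 \<le> i + j \<and> i + j \<le> k then a (i + j) j else 0"
  have A: "finite ?A" "\<And>i j. (i, j) \<notin> ?A \<Longrightarrow> ?c i j = 0" by auto
  show "conv2 ?c 1" by (rule conv2_finite_support[OF A]) simp_all
  have "jet_poly k a z = (\<Sum>(s, i)\<in>Sigma {1..k} (\<lambda>s. {..s}). a s i * fst z ^ (s - i) * snd z ^ i)" for z
    by (simp add: jet_poly_def sum.Sigma)
  also have "\<dots> z = (\<Sum>(i, j)\<in>?A. ?c i j * fst z ^ i * snd z ^ j)" for z
    by (rule sum.reindex_bij_witness[of _ "\<lambda>(i, j). (i + j, j)" "\<lambda>(s, i). (s - i, i)"]) auto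
  finally show "\<forall>\<^sub>F z in nhds (0, 0). jet_poly k a z = ps2 ?c (fst z - fst (0, 0)) (snd z - snd (0, 0))"
    by (subst ps2_finite_support[OF A]) simp_all
qed

lemma umbilic_at_jet_graph_iff:
  assumes "2 \<le> k" "fdet u v w \<noteq> 0"
  shows "umbilic_at (frame_graph u v w (jet_poly k a)) (0, 0) \<longleftrightarrow> jetA u v w a = 0 \<and> jetB u v w a = 0 \<and> jetC u v w a = 0"
proof -
  note e = expansion2_jet_poly[of k a]
  have an: "analytic2_at (jet_poly k a) (0, 0)" using e by (auto simp: analytic2_at_iff)
  note c = expansion2_real_coeffs[OF e]
  let ?X = "frame_graph u v w (jet_poly k a)"
  have d: "pdu (jet_poly k a) (0, 0) = a 1 0" "pdv (jet_poly k a) (0, 0) = a 1 1"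
    "pdu (pdu (jet_poly k a)) (0, 0) = 2 * a 2 0" "pdv (pdu (jet_poly k a)) (0, 0) = a 2 1"
    "pdv (pdv (jet_poly k a)) (0, 0) = 2 * a 2 2"
    using c assms(1) by (simp_all add: numeral_2_eq_2)
  note X = frame_graph_derivatives[OF an, of u v w, unfolded d]
  have det: "fdet (u + r *\<^sub>R w) (v + s *\<^sub>R w) (t *\<^sub>R w) = t * fdet u v w" for r s t
    by (simp add: fdet_expand algebra_simps)
  have I: "fffE ?X (0, 0) = jetE u v w a" "fffF ?X (0, 0) = jetF u v w a" "fffG ?X (0, 0) = jetG u v w a"
    by (simp_all add: fffE_def fffF_def fffG_def X jetE_def jetF_def jetG_def)
  have II: "lbar ?X (0, 0) = 2 * a 2 0 * fdet u v w" "mbar ?X (0, 0) = a 2 1 * fdet u v w" "nbar ?X (0, 0) = 2 * a 2 2 * fdet u v w"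
    by (simp_all add: lbar_def mbar_def nbar_def X mink_mcross_fdet det)
  have "umb_a ?X (0, 0) = fdet u v w * jetA u v w a" "umb_b ?X (0, 0) = fdet u v w * jetB u v w a" "umb_c ?X (0, 0) = fdet u v w * jetC u v w a"
    by (simp_all add: umb_a_def umb_b_def umb_c_def I II jetA_def jetB_def jetC_def algebra_simps)
  then show ?thesis using assms(2) by (simp add: umbilic_at_def)
qed

lemma taylor_jet_low:
  fixes f :: "real \<times> real \<Rightarrow> real"
  assumes "analytic2_at f (0, 0)" "2 \<le> k"
  shows "taylor_jet k f 1 0 = pdu f (0, 0)" "taylor_jet k f 1 1 = pdv f (0, 0)"
    "2 * taylor_jet k f 2 0 = pdu (pdu f) (0, 0)" "taylor_jet k f 2 1 = pdv (pdu f) (0, 0)"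
    "2 * taylor_jet k f 2 2 = pdv (pdv f) (0, 0)"
  using assms(2) analytic2_pdu_pdv[OF assms(1)] by (simp_all add: taylor_jet_def numeral_2_eq_2)

text \<open>Let $P$ be the matrix of the \<open>p\<close>s.  The tangent vectors of \<open>x\<close> are the columns of $P$ in the basis of
  tangent vectors of the graph.  Thus the first fundamental form is pulled back by $P$, and the second one
  also picks up the factor $\det P$ from the unnormalised normal vector.  The minors are the coefficients of
  the quadratic form that defines the lines of curvature; they are pulled back as well, with a further factor
  $\det P$.\<close>

lemma umb_in_Monge_frame:
  fixes f :: "real \<times> real \<Rightarrow> real" and u v w :: "real^3" and x :: "real \<times> real \<Rightarrow> real^3"
  assumes D: "open D" "vec_analytic_on D x" "z \<in> D" and k: "2 \<le> k"
    and \<delta>: "fdet u v w \<noteq> 0"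
    and f: "analytic2_at f (0, 0)"
    and eq: "graph_near u v w f x z"
  defines "a \<equiv> taylor_jet k f"
    and "p11 \<equiv> frame_coord1 u v w (pdu x z)" and "p12 \<equiv> frame_coord1 u v w (pdv x z)"
    and "p21 \<equiv> frame_coord2 u v w (pdu x z)" and "p22 \<equiv> frame_coord2 u v w (pdv x z)"
  defines "\<Delta> \<equiv> p11 * p22 - p12 * p21"
  shows "pdu x z = p11 *\<^sub>R (u + a 1 0 *\<^sub>R w) + p21 *\<^sub>R (v + a 1 1 *\<^sub>R w)"
    and "pdv x z = p12 *\<^sub>R (u + a 1 0 *\<^sub>R w) + p22 *\<^sub>R (v + a 1 1 *\<^sub>R w)"
    and "frame_coord3 u v w (pdu x z) = a 1 0 * p11 + a 1 1 * p21"
    and "frame_coord3 u v w (pdv x z) = a 1 0 * p12 + a 1 1 * p22"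
    and "lbar x z = fdet u v w * \<Delta> * (2 * a 2 0 * p11\<^sup>2 + 2 * a 2 1 * p11 * p21 + 2 * a 2 2 * p21\<^sup>2)"
    and "mbar x z = fdet u v w * \<Delta> * (2 * a 2 0 * p11 * p12 + a 2 1 * (p11 * p22 + p12 * p21) + 2 * a 2 2 * p21 * p22)"
    and "nbar x z = fdet u v w * \<Delta> * (2 * a 2 0 * p12\<^sup>2 + 2 * a 2 1 * p12 * p22 + 2 * a 2 2 * p22\<^sup>2)"
    and "umb_c x z = fdet u v w * \<Delta>\<^sup>2 * (jetC u v w a * p11\<^sup>2 + jetB u v w a * (p11 * p21) + jetA u v w a * p21\<^sup>2)"
    and "umb_b x z = fdet u v w * \<Delta>\<^sup>2 * (jetC u v w a * (2 * p11 * p12) + jetB u v w a * (p11 * p22 + p12 * p21) + jetA u v w a * (2 * p21 * p22))"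
    and "umb_a x z = fdet u v w * \<Delta>\<^sup>2 * (jetC u v w a * p12\<^sup>2 + jetB u v w a * (p12 * p22) + jetA u v w a * p22\<^sup>2)"
proof -
  note t = taylor_jet_low[OF f k, folded a_def]
  note C = Monge_chain_rule[OF D bounded_linear_frame_coords[of u v w] f eq, folded p11_def p12_def p21_def p22_def t(1,2,4), folded t(3,5)]
  show g: "frame_coord3 u v w (pdu x z) = a 1 0 * p11 + a 1 1 * p21" "frame_coord3 u v w (pdv x z) = a 1 0 * p12 + a 1 1 * p22"
    by (rule C(1) C(2))+
  have comb: "y = frame_coord1 u v w y *\<^sub>R u + frame_coord2 u v w y *\<^sub>R v + frame_coord3 u v w y *\<^sub>R w" for y
    by (rule frame_coords_combine[OF \<delta>, symmetric])
  show xu: "pdu x z = p11 *\<^sub>R (u + a 1 0 *\<^sub>R w) + p21 *\<^sub>R (v + a 1 1 *\<^sub>R w)"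
    using comb[of "pdu x z"] g(1) by (simp add: p11_def p21_def algebra_simps)
  show xv: "pdv x z = p12 *\<^sub>R (u + a 1 0 *\<^sub>R w) + p22 *\<^sub>R (v + a 1 1 *\<^sub>R w)"
    using comb[of "pdv x z"] g(2) by (simp add: p12_def p22_def algebra_simps)
  have second: "y = frame_coord1 u v w y *\<^sub>R (u + a 1 0 *\<^sub>R w) + frame_coord2 u v w y *\<^sub>R (v + a 1 1 *\<^sub>R w) + Q *\<^sub>R w"
    if "frame_coord3 u v w y = a 1 0 * frame_coord1 u v w y + a 1 1 * frame_coord2 u v w y + Q" for y Q
    using comb[of y] that by (simp add: algebra_simps)
  have det: "fdet (pdu x z) (pdv x z) (r *\<^sub>R (u + a 1 0 *\<^sub>R w) + s *\<^sub>R (v + a 1 1 *\<^sub>R w) + Q *\<^sub>R w) = fdet u v w * \<Delta> * Q" for r s Q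
    unfolding xu xv \<Delta>_def fdet_expand by simp algebra
  show l: "lbar x z = fdet u v w * \<Delta> * (2 * a 2 0 * p11\<^sup>2 + 2 * a 2 1 * p11 * p21 + 2 * a 2 2 * p21\<^sup>2)"
    unfolding lbar_def mink_mcross_fdet by (subst second[OF C(3)], subst det) (simp add: power2_eq_square algebra_simps)
  show m: "mbar x z = fdet u v w * \<Delta> * (2 * a 2 0 * p11 * p12 + a 2 1 * (p11 * p22 + p12 * p21) + 2 * a 2 2 * p21 * p22)"
    unfolding mbar_def mink_mcross_fdet by (subst second[OF C(4)], subst det) (simp add: power2_eq_square algebra_simps)
  show n: "nbar x z = fdet u v w * \<Delta> * (2 * a 2 0 * p12\<^sup>2 + 2 * a 2 1 * p12 * p22 + 2 * a 2 2 * p22\<^sup>2)"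
    unfolding nbar_def mink_mcross_fdet by (subst second[OF C(5)], subst det) (simp add: power2_eq_square algebra_simps)
  have mink_lin: "mink (r *\<^sub>R y + s *\<^sub>R y') (r' *\<^sub>R y + s' *\<^sub>R y') = r * r' * mink y y + (r * s' + s * r') * mink y y' + s * s' * mink y' y'" for r s r' s' y y'
    by (simp add: mink_def algebra_simps)
  have EFG: "fffE x z = p11\<^sup>2 * jetE u v w a + 2 * p11 * p21 * jetF u v w a + p21\<^sup>2 * jetG u v w a"
    "fffF x z = p11 * p12 * jetE u v w a + (p11 * p22 + p12 * p21) * jetF u v w a + p21 * p22 * jetG u v w a"
    "fffG x z = p12\<^sup>2 * jetE u v w a + 2 * p12 * p22 * jetF u v w a + p22\<^sup>2 * jetG u v w a"
    unfolding fffE_def fffF_def fffG_def xu xv mink_lin jetE_def jetF_def jetG_def by (simp_all add: power2_eq_square algebra_simps)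
  show "umb_c x z = fdet u v w * \<Delta>\<^sup>2 * (jetC u v w a * p11\<^sup>2 + jetB u v w a * (p11 * p21) + jetA u v w a * p21\<^sup>2)"
    unfolding umb_c_def EFG l m jetA_def jetB_def jetC_def \<Delta>_def by algebra
  show "umb_b x z = fdet u v w * \<Delta>\<^sup>2 * (jetC u v w a * (2 * p11 * p12) + jetB u v w a * (p11 * p22 + p12 * p21) + jetA u v w a * (2 * p21 * p22))"
    unfolding umb_b_def EFG l n jetA_def jetB_def jetC_def \<Delta>_def by algebra
  show "umb_a x z = fdet u v w * \<Delta>\<^sup>2 * (jetC u v w a * p12\<^sup>2 + jetB u v w a * (p12 * p22) + jetA u v w a * p22\<^sup>2)"
    unfolding umb_a_def EFG m n jetA_def jetB_def jetC_def \<Delta>_def by algebra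
qed

section \<open>The tangent space of the umbilic stratum\<close>

text \<open>The coefficients on which membership in the umbilic stratum depends.\<close>

definition low_coeffs :: "(nat \<times> nat) set" where
  "low_coeffs = {(1, 0), (1, 1), (2, 0), (2, 1), (2, 2)}"

text \<open>Formal differentials at \<open>a\<close> in the direction \<open>b\<close>.\<close>

definition djetE :: "real^3 \<Rightarrow> real^3 \<Rightarrow> real^3 \<Rightarrow> jet \<Rightarrow> jet \<Rightarrow> real" where
  "djetE u v w a b = 2 * b 1 0 * mink (u + a 1 0 *\<^sub>R w) w"
definition djetF :: "real^3 \<Rightarrow> real^3 \<Rightarrow> real^3 \<Rightarrow> jet \<Rightarrow> jet \<Rightarrow> real" where
  "djetF u v w a b = b 1 0 * mink (v + a 1 1 *\<^sub>R w) w + b 1 1 * mink (u + a 1 0 *\<^sub>R w) w"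
definition djetG :: "real^3 \<Rightarrow> real^3 \<Rightarrow> real^3 \<Rightarrow> jet \<Rightarrow> jet \<Rightarrow> real" where
  "djetG u v w a b = 2 * b 1 1 * mink (v + a 1 1 *\<^sub>R w) w"

definition djetA :: "real^3 \<Rightarrow> real^3 \<Rightarrow> real^3 \<Rightarrow> jet \<Rightarrow> jet \<Rightarrow> real" where
  "djetA u v w a b = djetF u v w a b * (2 * a 2 2) + jetF u v w a * (2 * b 2 2) - djetG u v w a b * a 2 1 - jetG u v w a * b 2 1"
definition djetB :: "real^3 \<Rightarrow> real^3 \<Rightarrow> real^3 \<Rightarrow> jet \<Rightarrow> jet \<Rightarrow> real" where
  "djetB u v w a b = djetE u v w a b * (2 * a 2 2) + jetE u v w a * (2 * b 2 2) - djetG u v w a b * (2 * a 2 0) - jetG u v w a * (2 * b 2 0)"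
definition djetC :: "real^3 \<Rightarrow> real^3 \<Rightarrow> real^3 \<Rightarrow> jet \<Rightarrow> jet \<Rightarrow> real" where
  "djetC u v w a b = djetE u v w a b * a 2 1 + jetE u v w a * b 2 1 - djetF u v w a b * (2 * a 2 0) - jetF u v w a * (2 * b 2 0)"

lemmas djet_defs = djetE_def djetF_def djetG_def djetA_def djetB_def djetC_def

lemma
  fixes \<gamma> :: "'n::real_normed_vector \<Rightarrow> jet" and \<gamma>' :: "'n \<Rightarrow> jet"
  assumes "\<And>s i. (s, i) \<in> low_coeffs \<Longrightarrow> ((\<lambda>t. \<gamma> t s i) has_derivative (\<lambda>d. \<gamma>' d s i)) (at t)"
  shows jetE_has_derivative: "((\<lambda>t. jetE u v w (\<gamma> t)) has_derivative (\<lambda>d. djetE u v w (\<gamma> t) (\<gamma>' d))) (at t)"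
    and jetF_has_derivative: "((\<lambda>t. jetF u v w (\<gamma> t)) has_derivative (\<lambda>d. djetF u v w (\<gamma> t) (\<gamma>' d))) (at t)"
    and jetG_has_derivative: "((\<lambda>t. jetG u v w (\<gamma> t)) has_derivative (\<lambda>d. djetG u v w (\<gamma> t) (\<gamma>' d))) (at t)"
    and jetA_has_derivative: "((\<lambda>t. jetA u v w (\<gamma> t)) has_derivative (\<lambda>d. djetA u v w (\<gamma> t) (\<gamma>' d))) (at t)"
    and jetB_has_derivative: "((\<lambda>t. jetB u v w (\<gamma> t)) has_derivative (\<lambda>d. djetB u v w (\<gamma> t) (\<gamma>' d))) (at t)"
    and jetC_has_derivative: "((\<lambda>t. jetC u v w (\<gamma> t)) has_derivative (\<lambda>d. djetC u v w (\<gamma> t) (\<gamma>' d))) (at t)"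
proof -
  note c = assms[of 1 0] assms[of 1 1] assms[of 2 0] assms[of 2 1] assms[of 2 2]
  have c: "((\<lambda>t. \<gamma> t 1 0) has_derivative (\<lambda>d. \<gamma>' d 1 0)) (at t)" "((\<lambda>t. \<gamma> t 1 1) has_derivative (\<lambda>d. \<gamma>' d 1 1)) (at t)"
    "((\<lambda>t. \<gamma> t 2 0) has_derivative (\<lambda>d. \<gamma>' d 2 0)) (at t)" "((\<lambda>t. \<gamma> t 2 1) has_derivative (\<lambda>d. \<gamma>' d 2 1)) (at t)"
    "((\<lambda>t. \<gamma> t 2 2) has_derivative (\<lambda>d. \<gamma>' d 2 2)) (at t)"
    using c by (simp_all add: low_coeffs_def)
  show E: "((\<lambda>t. jetE u v w (\<gamma> t)) has_derivative (\<lambda>d. djetE u v w (\<gamma> t) (\<gamma>' d))) (at t)"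
    unfolding jetE_def djetE_def mink_def vector_add_component vector_scaleR_component
    by (rule c derivative_eq_intros refl)+ (simp add: algebra_simps)
  show F: "((\<lambda>t. jetF u v w (\<gamma> t)) has_derivative (\<lambda>d. djetF u v w (\<gamma> t) (\<gamma>' d))) (at t)"
    unfolding jetF_def djetF_def mink_def vector_add_component vector_scaleR_component
    by (rule c derivative_eq_intros refl)+ (simp add: algebra_simps)
  show G: "((\<lambda>t. jetG u v w (\<gamma> t)) has_derivative (\<lambda>d. djetG u v w (\<gamma> t) (\<gamma>' d))) (at t)"
    unfolding jetG_def djetG_def mink_def vector_add_component vector_scaleR_component
    by (rule c derivative_eq_intros refl)+ (simp add: algebra_simps)
  show "((\<lambda>t. jetA u v w (\<gamma> t)) has_derivative (\<lambda>d. djetA u v w (\<gamma> t) (\<gamma>' d))) (at t)"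
    unfolding jetA_def djetA_def by (rule c E F G derivative_eq_intros refl)+ (simp add: algebra_simps)
  show "((\<lambda>t. jetB u v w (\<gamma> t)) has_derivative (\<lambda>d. djetB u v w (\<gamma> t) (\<gamma>' d))) (at t)"
    unfolding jetB_def djetB_def by (rule c E F G derivative_eq_intros refl)+ (simp add: algebra_simps)
  show "((\<lambda>t. jetC u v w (\<gamma> t)) has_derivative (\<lambda>d. djetC u v w (\<gamma> t) (\<gamma>' d))) (at t)"
    unfolding jetC_def djetC_def by (rule c E F G derivative_eq_intros refl)+ (simp add: algebra_simps)
qed

lemma djet_syzygy:
  assumes "jetA u v w a = 0" "jetB u v w a = 0" "jetC u v w a = 0"
  shows "jetE u v w a * djetA u v w a b - jetF u v w a * djetB u v w a b + jetG u v w a * djetC u v w a b = 0"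
  using assms unfolding djetA_def djetB_def djetC_def jetA_def jetB_def jetC_def by algebra

lemma djet_diff:
  "djetA u v w a (\<lambda>s i. b s i - c s i) = djetA u v w a b - djetA u v w a c"
  "djetB u v w a (\<lambda>s i. b s i - c s i) = djetB u v w a b - djetB u v w a c"
  "djetC u v w a (\<lambda>s i. b s i - c s i) = djetC u v w a b - djetC u v w a c"
  by (simp_all add: djet_defs algebra_simps)

lemma proportional_if_minors_vanish:
  fixes e f g l m n :: real
  assumes "e \<noteq> 0 \<or> f \<noteq> 0 \<or> g \<noteq> 0" "f * n = g * m" "e * n = g * l" "e * m = f * l"
  shows "\<exists>\<mu>. l = \<mu> * e \<and> m = \<mu> * f \<and> n = \<mu> * g"
proof -
  consider "e \<noteq> 0" | "f \<noteq> 0" | "g \<noteq> 0" using assms(1) by blast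
  then show ?thesis
  proof cases
    case 1
    then show ?thesis using assms by (intro exI[of _ "l / e"]) (simp add: field_simps)
  next
    case 2
    then show ?thesis using assms by (intro exI[of _ "m / f"]) (simp add: field_simps)
  next
    case 3
    then show ?thesis using assms by (intro exI[of _ "n / g"]) (simp add: field_simps)
  qed
qed

text \<open>On the stratum the second fundamental form is $\kappa$ times the first one.  If the differentials
  of the minors vanish on \<open>b\<close>, the derivative of $II-\kappa I$ along \<open>b\<close> is again proportional to $I$, with a
  factor $\mu$.  The curve with $II(t)=(\kappa+t\mu)I(t)$ and all other coefficients moving linearly then
  stays in the stratum and has velocity \<open>b\<close>.\<close>

lemma jet_tangent_umbilic_stratum:
  assumes k: "2 \<le> k" and \<delta>: "fdet u v w \<noteq> 0" and J: "J = jet_space k \<or> J = jet_space2 k"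
    and a: "a \<in> umbilic_stratum k u v w J"
    and reg: "jetE u v w a \<noteq> 0 \<or> jetF u v w a \<noteq> 0 \<or> jetG u v w a \<noteq> 0"
    and b: "b \<in> J"
  shows "b \<in> jet_tangent (umbilic_stratum k u v w J) a \<longleftrightarrow>
     djetA u v w a b = 0 \<and> djetB u v w a b = 0 \<and> djetC u v w a b = 0"
proof
  have S: "c \<in> umbilic_stratum k u v w J \<longleftrightarrow> c \<in> J \<and> jetA u v w c = 0 \<and> jetB u v w c = 0 \<and> jetC u v w c = 0" for c
    by (simp add: umbilic_stratum_def umbilic_at_jet_graph_iff[OF k \<delta>])
  {
    assume "b \<in> jet_tangent (umbilic_stratum k u v w J) a"
    then obtain \<gamma> where \<gamma>: "\<gamma> 0 = a" "\<forall>\<^sub>F t in nhds 0. \<gamma> t \<in> umbilic_stratum k u v w J"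
      "\<And>s i. ((\<lambda>t. \<gamma> t s i) has_real_derivative b s i) (at 0)"
      by (auto simp: jet_tangent_def)
    have d: "((\<lambda>t. \<gamma> t s i) has_derivative (\<lambda>h. h * b s i)) (at 0)" for s i
      using \<gamma>(3) by (simp add: has_field_derivative_def mult_commute_abs)
    have zero: "djet (\<lambda>s i. 1 * b s i) = 0"
      if h: "((\<lambda>t. jt (\<gamma> t)) has_derivative (\<lambda>h. djet (\<lambda>s i. h * b s i))) (at 0)"
        and ev: "\<forall>\<^sub>F t in nhds 0. jt (\<gamma> t) = (0 :: real)" for jt djet
    proof -
      have "((\<lambda>t::real. 0::real) has_derivative (\<lambda>h. djet (\<lambda>s i. h * b s i))) (at 0)"
        by (rule has_derivative_eventually_cong[OF h ev])
      then have "(\<lambda>h. djet (\<lambda>s i. h * b s i)) = (\<lambda>h. 0)"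
        by (rule has_derivative_unique) simp
      from fun_cong[OF this, of 1] show ?thesis by simp
    qed
    have ev: "\<forall>\<^sub>F t in nhds 0. jetA u v w (\<gamma> t) = 0" "\<forall>\<^sub>F t in nhds 0. jetB u v w (\<gamma> t) = 0" "\<forall>\<^sub>F t in nhds 0. jetC u v w (\<gamma> t) = 0"
      using \<gamma>(2) by (auto simp: S elim: eventually_mono)
    show "djetA u v w a b = 0 \<and> djetB u v w a b = 0 \<and> djetC u v w a b = 0"
      using zero[OF jetA_has_derivative[where \<gamma> = \<gamma> and \<gamma>' = "\<lambda>h s i. h * b s i" and t = 0, OF d] ev(1)] zero[OF jetB_has_derivative[where \<gamma> = \<gamma> and \<gamma>' = "\<lambda>h s i. h * b s i" and t = 0, OF d] ev(2)] zero[OF jetC_has_derivative[where \<gamma> = \<gamma> and \<gamma>' = "\<lambda>h s i. h * b s i" and t = 0, OF d] ev(3)]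
      by (simp add: \<gamma>(1))
  }
  assume db: "djetA u v w a b = 0 \<and> djetB u v w a b = 0 \<and> djetC u v w a b = 0"
  have a0: "a \<in> J" "jetA u v w a = 0" "jetB u v w a = 0" "jetC u v w a = 0" using a S by auto
  let ?e = "jetE u v w a" and ?f = "jetF u v w a" and ?g = "jetG u v w a"
  let ?de = "djetE u v w a b" and ?df = "djetF u v w a b" and ?dg = "djetG u v w a b"
  obtain \<kappa> where \<kappa>: "2 * a 2 0 = \<kappa> * ?e" "a 2 1 = \<kappa> * ?f" "2 * a 2 2 = \<kappa> * ?g"
    using proportional_if_minors_vanish[OF reg, of "2 * a 2 2" "a 2 1" "2 * a 2 0"] a0
    by (auto simp: jetA_def jetB_def jetC_def)
  have "\<exists>\<mu>. 2 * b 2 0 - \<kappa> * ?de = \<mu> * ?e \<and> b 2 1 - \<kappa> * ?df = \<mu> * ?f \<and> 2 * b 2 2 - \<kappa> * ?dg = \<mu> * ?g"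
  proof (rule proportional_if_minors_vanish[OF reg])
    show "?f * (2 * b 2 2 - \<kappa> * ?dg) = ?g * (b 2 1 - \<kappa> * ?df)"
      using db unfolding djetA_def \<kappa> by (simp add: algebra_simps)
    show "?e * (2 * b 2 2 - \<kappa> * ?dg) = ?g * (2 * b 2 0 - \<kappa> * ?de)"
      using db unfolding djetB_def \<kappa> by (simp add: algebra_simps)
    show "?e * (b 2 1 - \<kappa> * ?df) = ?f * (2 * b 2 0 - \<kappa> * ?de)"
      using db unfolding djetC_def \<kappa> by (simp add: algebra_simps)
  qed
  then obtain \<mu> where \<mu>: "2 * b 2 0 = \<kappa> * ?de + \<mu> * ?e" "b 2 1 = \<kappa> * ?df + \<mu> * ?f" "2 * b 2 2 = \<kappa> * ?dg + \<mu> * ?g"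
    by (auto simp: algebra_simps)
  define lin :: "real \<Rightarrow> jet" where "lin t = (\<lambda>s i. a s i + t * b s i)" for t
  \<comment> \<open>the first fundamental form depends only on the coefficients of degree 1, where \<open>\<gamma>\<close> and \<open>lin\<close> agree\<close>
  define \<gamma> :: "real \<Rightarrow> jet" where "\<gamma> t = (\<lambda>s i. if (s, i) = (2, 0) then (\<kappa> + t * \<mu>) * jetE u v w (lin t) / 2
      else if (s, i) = (2, 1) then (\<kappa> + t * \<mu>) * jetF u v w (lin t)
      else if (s, i) = (2, 2) then (\<kappa> + t * \<mu>) * jetG u v w (lin t) / 2 else lin t s i)" for t
  have lin0: "lin 0 = a" by (simp add: lin_def)
  have lin': "((\<lambda>t. lin t s i) has_derivative (\<lambda>h. h * b s i)) (at t)" for s i t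
    unfolding lin_def by (auto intro!: derivative_eq_intros)
  have dl: "djetE u v w a (\<lambda>s i. h * b s i) = h * ?de" "djetF u v w a (\<lambda>s i. h * b s i) = h * ?df" "djetG u v w a (\<lambda>s i. h * b s i) = h * ?dg" for h
    by (simp_all add: djet_defs algebra_simps)
  have l: "((\<lambda>t. jetE u v w (lin t)) has_real_derivative ?de) (at 0)"
    "((\<lambda>t. jetF u v w (lin t)) has_real_derivative ?df) (at 0)" "((\<lambda>t. jetG u v w (lin t)) has_real_derivative ?dg) (at 0)"
    using jetE_has_derivative[where \<gamma> = lin and \<gamma>' = "\<lambda>h s i. h * b s i" and t = 0 and u = u and v = v and w = w, OF lin'] jetF_has_derivative[where \<gamma> = lin and \<gamma>' = "\<lambda>h s i. h * b s i" and t = 0 and u = u and v = v and w = w, OF lin'] jetG_has_derivative[where \<gamma> = lin and \<gamma>' = "\<lambda>h s i. h * b s i" and t = 0 and u = u and v = v and w = w, OF lin']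
    by (simp_all add: lin0 dl has_field_derivative_def mult_commute_abs)
  have "\<gamma> 0 = a"
    using \<kappa> by (auto simp: \<gamma>_def lin0 fun_eq_iff)
  moreover have "\<gamma> t \<in> umbilic_stratum k u v w J" for t
  proof -
    have "jetE u v w (\<gamma> t) = jetE u v w (lin t)" "jetF u v w (\<gamma> t) = jetF u v w (lin t)" "jetG u v w (\<gamma> t) = jetG u v w (lin t)"
      by (simp_all add: jetE_def jetF_def jetG_def \<gamma>_def)
    then have "jetA u v w (\<gamma> t) = 0 \<and> jetB u v w (\<gamma> t) = 0 \<and> jetC u v w (\<gamma> t) = 0"
      by (simp add: jetA_def jetB_def jetC_def) (simp add: \<gamma>_def)
    moreover have "\<gamma> t \<in> J"
    proof -
      have "lin t s i = 0" if "a s i = 0" "b s i = 0" for s i using that by (simp add: lin_def)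
      then have "lin t \<in> J"
        using J a0(1) b unfolding jet_space_def jet_space2_def by blast
      moreover have "\<gamma> t s i = lin t s i" if "s \<noteq> 2 \<or> \<not> i \<le> 2" for s i
        using that by (auto simp: \<gamma>_def)
      ultimately show ?thesis
        using J k unfolding jet_space_def jet_space2_def by (smt (verit) mem_Collect_eq le_refl one_le_numeral)
    qed
    ultimately show ?thesis by (simp add: S)
  qed
  moreover have "((\<lambda>t. \<gamma> t s i) has_real_derivative b s i) (at 0)" for s i
  proof -
    have "((\<lambda>t. (\<kappa> + t * \<mu>) * jetE u v w (lin t) / 2) has_real_derivative b 2 0) (at 0)"
      "((\<lambda>t. (\<kappa> + t * \<mu>) * jetF u v w (lin t)) has_real_derivative b 2 1) (at 0)"
      "((\<lambda>t. (\<kappa> + t * \<mu>) * jetG u v w (lin t) / 2) has_real_derivative b 2 2) (at 0)"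
      using \<mu> by (auto intro!: derivative_eq_intros l simp: lin0 algebra_simps)
    note second = this
    have l1: "((\<lambda>t. lin t s i) has_real_derivative b s i) (at 0)"
      using lin'[of s i 0] by (simp add: has_field_derivative_def mult_commute_abs)
    consider "s = 2" "i = 0" | "s = 2" "i = 1" | "s = 2" "i = 2"
      | "(s, i) \<noteq> (2, 0)" "(s, i) \<noteq> (2, 1)" "(s, i) \<noteq> (2, 2)" by blast
    then show ?thesis
    proof cases
      case 4
      then show ?thesis unfolding \<gamma>_def using l1 by (simp only: if_False)
    qed (use second in \<open>simp_all add: \<gamma>_def\<close>)
  qed
  ultimately show "b \<in> jet_tangent (umbilic_stratum k u v w J) a"
    unfolding jet_tangent_def by (intro CollectI exI[of _ \<gamma>]) auto
qed

section \<open>Maps of the plane into the syzygy plane\<close>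

lemma det2_nonzero_iff_surjective:
  fixes a1 a2 b1 b2 :: real
  shows "a1 * b2 - a2 * b1 \<noteq> 0 \<longleftrightarrow> (\<forall>y1 y2. \<exists>s t. s * a1 + t * a2 = y1 \<and> s * b1 + t * b2 = y2)"
proof
  let ?d = "a1 * b2 - a2 * b1"
  assume d: "?d \<noteq> 0"
  show "\<forall>y1 y2. \<exists>s t. s * a1 + t * a2 = y1 \<and> s * b1 + t * b2 = y2"
  proof (intro allI)
    fix y1 y2
    obtain e where "e * ?d = 1" using d by (metis divide_self_if times_divide_eq_left mult_1)
    then have "e * (y1 * b2 - a2 * y2) * a1 + e * (a1 * y2 - y1 * b1) * a2 = y1"
      "e * (y1 * b2 - a2 * y2) * b1 + e * (a1 * y2 - y1 * b1) * b2 = y2"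
      by algebra+
    then show "\<exists>s t. s * a1 + t * a2 = y1 \<and> s * b1 + t * b2 = y2" by blast
  qed
next
  assume *: "\<forall>y1 y2. \<exists>s t. s * a1 + t * a2 = y1 \<and> s * b1 + t * b2 = y2"
  obtain s t where 1: "s * a1 + t * a2 = 1" "s * b1 + t * b2 = 0" using * by blast
  obtain s' t' where 2: "s' * a1 + t' * a2 = 0" "s' * b1 + t' * b2 = 1" using * by blast
  have "(s * t' - t * s') * (a1 * b2 - a2 * b1) = 1" using 1 2 by algebra
  then show "a1 * b2 - a2 * b1 \<noteq> 0" by auto
qed

text \<open>The plane is the graph of one coordinate over the other two, and for a map between planes
  injectivity and surjectivity coincide.\<close>

lemma injective_iff_onto_plane:
  fixes \<alpha> \<beta> \<gamma> :: "real \<times> real \<Rightarrow> real" and e f g :: real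
  assumes lin: "\<And>d. \<alpha> d = fst d * \<alpha> (1, 0) + snd d * \<alpha> (0, 1)" "\<And>d. \<beta> d = fst d * \<beta> (1, 0) + snd d * \<beta> (0, 1)"
      "\<And>d. \<gamma> d = fst d * \<gamma> (1, 0) + snd d * \<gamma> (0, 1)"
    and plane: "\<And>d. e * \<alpha> d - f * \<beta> d + g * \<gamma> d = 0"
    and reg: "e \<noteq> 0 \<or> f \<noteq> 0 \<or> g \<noteq> 0"
  shows "(\<forall>d. \<alpha> d = 0 \<and> \<beta> d = 0 \<and> \<gamma> d = 0 \<longrightarrow> d = 0) \<longleftrightarrow>
     (\<forall>y1 y2 y3. e * y1 - f * y2 + g * y3 = 0 \<longrightarrow> (\<exists>d. \<alpha> d = y1 \<and> \<beta> d = y2 \<and> \<gamma> d = y3))"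
proof -
  have pair: "(\<forall>d. \<phi> d = 0 \<and> \<psi> d = 0 \<longrightarrow> d = 0) \<longleftrightarrow> (\<forall>y1 y2. \<exists>d. \<phi> d = y1 \<and> \<psi> d = y2)"
    if "\<And>d. \<phi> d = fst d * \<phi> (1, 0) + snd d * \<phi> (0, 1)" "\<And>d. \<psi> d = fst d * \<psi> (1, 0) + snd d * \<psi> (0, 1)"
    for \<phi> \<psi> :: "real \<times> real \<Rightarrow> real"
  proof -
    have 1: "\<phi> (s, t) = s * \<phi> (1, 0) + t * \<phi> (0, 1)" "\<psi> (s, t) = s * \<psi> (1, 0) + t * \<psi> (0, 1)" for s t
      using that(1)[of "(s, t)"] that(2)[of "(s, t)"] by simp_all
    have "(\<forall>d. \<phi> d = 0 \<and> \<psi> d = 0 \<longrightarrow> d = 0) \<longleftrightarrow>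
       (\<forall>s t. s * \<phi> (1, 0) + t * \<phi> (0, 1) = 0 \<and> s * \<psi> (1, 0) + t * \<psi> (0, 1) = 0 \<longrightarrow> s = 0 \<and> t = 0)"
      unfolding split_paired_All 1[symmetric] by (simp add: zero_prod_def)
    also have "\<dots> \<longleftrightarrow> (\<forall>y1 y2. \<exists>s t. s * \<phi> (1, 0) + t * \<phi> (0, 1) = y1 \<and> s * \<psi> (1, 0) + t * \<psi> (0, 1) = y2)"
      unfolding det2_nonzero_iff_surjective[symmetric] det2_nonzero_iff_injective ..
    also have "\<dots> \<longleftrightarrow> (\<forall>y1 y2. \<exists>d. \<phi> d = y1 \<and> \<psi> d = y2)"
      unfolding split_paired_Ex 1[symmetric] ..
    finally show ?thesis .
  qed
  consider "e \<noteq> 0" | "f \<noteq> 0" | "g \<noteq> 0" using reg by blast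
  then show ?thesis
  proof cases
    case 1
    have third: "\<alpha> d = (f * \<beta> d - g * \<gamma> d) / e" for d using plane[of d] 1 by (simp add: field_simps)
    have y: "e * y1 - f * y2 + g * y3 = 0 \<longleftrightarrow> y1 = (f * y2 - g * y3) / e" for y1 y2 y3 using 1 by (auto simp: field_simps)
    have "(\<forall>d. \<alpha> d = 0 \<and> \<beta> d = 0 \<and> \<gamma> d = 0 \<longrightarrow> d = 0) \<longleftrightarrow> (\<forall>d. \<beta> d = 0 \<and> \<gamma> d = 0 \<longrightarrow> d = 0)"
      using third by auto
    also note pair[OF lin(2,3)]
    also have "(\<forall>y2 y3. \<exists>d. \<beta> d = y2 \<and> \<gamma> d = y3) \<longleftrightarrow>
        (\<forall>y1 y2 y3. e * y1 - f * y2 + g * y3 = 0 \<longrightarrow> (\<exists>d. \<alpha> d = y1 \<and> \<beta> d = y2 \<and> \<gamma> d = y3))"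
      unfolding y third by metis
    finally show ?thesis .
  next
    case 2
    have third: "\<beta> d = (e * \<alpha> d + g * \<gamma> d) / f" for d using plane[of d] 2 by (simp add: field_simps)
    have y: "e * y1 - f * y2 + g * y3 = 0 \<longleftrightarrow> y2 = (e * y1 + g * y3) / f" for y1 y2 y3 using 2 by (auto simp: field_simps)
    have "(\<forall>d. \<alpha> d = 0 \<and> \<beta> d = 0 \<and> \<gamma> d = 0 \<longrightarrow> d = 0) \<longleftrightarrow> (\<forall>d. \<alpha> d = 0 \<and> \<gamma> d = 0 \<longrightarrow> d = 0)"
      using third by auto
    also note pair[OF lin(1,3)]
    also have "(\<forall>y1 y3. \<exists>d. \<alpha> d = y1 \<and> \<gamma> d = y3) \<longleftrightarrow>
        (\<forall>y1 y2 y3. e * y1 - f * y2 + g * y3 = 0 \<longrightarrow> (\<exists>d. \<alpha> d = y1 \<and> \<beta> d = y2 \<and> \<gamma> d = y3))"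
      unfolding y third by metis
    finally show ?thesis .
  next
    case 3
    have third: "\<gamma> d = (f * \<beta> d - e * \<alpha> d) / g" for d using plane[of d] 3 by (simp add: field_simps)
    have y: "e * y1 - f * y2 + g * y3 = 0 \<longleftrightarrow> y3 = (f * y2 - e * y1) / g" for y1 y2 y3 using 3 by (auto simp: field_simps)
    have "(\<forall>d. \<alpha> d = 0 \<and> \<beta> d = 0 \<and> \<gamma> d = 0 \<longrightarrow> d = 0) \<longleftrightarrow> (\<forall>d. \<alpha> d = 0 \<and> \<beta> d = 0 \<longrightarrow> d = 0)"
      using third by auto
    also note pair[OF lin(1,2)]
    also have "(\<forall>y1 y2. \<exists>d. \<alpha> d = y1 \<and> \<beta> d = y2) \<longleftrightarrow>
        (\<forall>y1 y2 y3. e * y1 - f * y2 + g * y3 = 0 \<longrightarrow> (\<exists>d. \<alpha> d = y1 \<and> \<beta> d = y2 \<and> \<gamma> d = y3))"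
      unfolding y third by metis
    finally show ?thesis .
  qed
qed

text \<open>Already the jets that are homogeneous of degree 2, which both jet spaces contain, are mapped onto the
  syzygy plane.\<close>

lemma second_order_jet_exists:
  assumes "2 \<le> k" and J: "J = jet_space k \<or> J = jet_space2 k"
    and reg: "jetE u v w a \<noteq> 0 \<or> jetF u v w a \<noteq> 0 \<or> jetG u v w a \<noteq> 0"
    and y: "jetE u v w a * y1 - jetF u v w a * y2 + jetG u v w a * y3 = 0"
  shows "\<exists>b\<in>J. djetA u v w a b = y1 \<and> djetB u v w a b = y2 \<and> djetC u v w a b = y3"
proof -
  let ?e = "jetE u v w a" and ?f = "jetF u v w a" and ?g = "jetG u v w a"
  define jt :: "real \<Rightarrow> real \<Rightarrow> real \<Rightarrow> jet" where
    "jt l m n = (\<lambda>s i. if (s, i) = (2, 0) then l / 2 else if (s, i) = (2, 1) then m else if (s, i) = (2, 2) then n / 2 else 0)" for l m n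
  have J: "jt l m n \<in> J" for l m n
    using J assms(1) by (auto simp: jet_space_def jet_space2_def jt_def split: if_splits)
  have d: "djetA u v w a (jt l m n) = ?f * n - ?g * m" "djetB u v w a (jt l m n) = ?e * n - ?g * l" "djetC u v w a (jt l m n) = ?e * m - ?f * l" for l m n
    by (simp_all add: djet_defs jt_def)
  consider "?e \<noteq> 0" | "?f \<noteq> 0" | "?g \<noteq> 0" using reg by blast
  then show ?thesis
  proof cases
    case 1
    show ?thesis by (rule bexI[OF _ J[of 0 "y3 / ?e" "y2 / ?e"]]) (use 1 y in \<open>simp add: d field_simps\<close>)
  next
    case 2
    show ?thesis by (rule bexI[OF _ J[of "- y3 / ?f" 0 "y1 / ?f"]]) (use 2 y in \<open>simp add: d field_simps\<close>)
  next
    case 3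
    show ?thesis by (rule bexI[OF _ J[of "- y2 / ?g" "- y1 / ?g" 0]]) (use 3 y in \<open>simp add: d field_simps\<close>)
  qed
qed

section \<open>Transversality of the Monge-Taylor map\<close>

lemma differentiable_eventually_cong:
  assumes "f differentiable (at q)" "\<forall>\<^sub>F z in nhds q. f z = g z"
  shows "g differentiable (at q)"
proof -
  obtain f' where "(f has_derivative f') (at q)" using assms(1) by (auto simp: differentiable_def)
  then have "(g has_derivative f') (at q)"
    by (rule has_derivative_eventually_cong[OF _ assms(2)])
  then show ?thesis by (auto simp: differentiable_def)
qed

lemma fdet_differentiable:
  fixes a b c :: "real \<times> real \<Rightarrow> real^3"
  assumes "a differentiable (at q)" "b differentiable (at q)" "c differentiable (at q)"
  shows "(\<lambda>z. fdet (a z) (b z) (c z)) differentiable (at q)"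
proof -
  have nth: "(\<lambda>z. h z $ i) differentiable (at q)" if "h differentiable (at q)" for h :: "real \<times> real \<Rightarrow> real^3" and i
    using that bounded_linear.has_derivative[OF bounded_linear_vec_nth] unfolding differentiable_def by blast
  show ?thesis
    unfolding fdet_expand by (intro differentiable_add differentiable_diff differentiable_mult nth assms)
qed

text \<open>A degenerate matrix would make the tangent vectors of \<open>x\<close> linearly dependent, as they are obtained
  from those of the graph by this matrix.\<close>

lemma Monge_frame_jacobian:
  fixes f :: "real \<times> real \<Rightarrow> real" and u v w :: "real^3" and x :: "real \<times> real \<Rightarrow> real^3" and k :: nat
  assumes D: "open D" "vec_analytic_on D x" "z \<in> D" and k: "2 \<le> k"
    and \<delta>: "fdet u v w \<noteq> 0" and f: "analytic2_at f (0, 0)"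
    and eq: "graph_near u v w f x z"
    and ind: "\<forall>\<alpha> \<beta>. \<alpha> *\<^sub>R pdu x z + \<beta> *\<^sub>R pdv x z = 0 \<longrightarrow> \<alpha> = 0 \<and> \<beta> = 0"
  shows "frame_coord1 u v w (pdu x z) * frame_coord2 u v w (pdv x z) - frame_coord1 u v w (pdv x z) * frame_coord2 u v w (pdu x z) \<noteq> 0"
proof
  define p11 p12 p21 p22 where p: "p11 = frame_coord1 u v w (pdu x z)" "p12 = frame_coord1 u v w (pdv x z)"
    "p21 = frame_coord2 u v w (pdu x z)" "p22 = frame_coord2 u v w (pdv x z)"
  assume "frame_coord1 u v w (pdu x z) * frame_coord2 u v w (pdv x z) - frame_coord1 u v w (pdv x z) * frame_coord2 u v w (pdu x z) = 0"
  then have 0: "p11 * p22 - p12 * p21 = 0" by (simp only: p)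
  let ?a = "taylor_jet k f"
  define X1 where "X1 = u + ?a 1 0 *\<^sub>R w"
  define X2 where "X2 = v + ?a 1 1 *\<^sub>R w"
  have X: "pdu x z = p11 *\<^sub>R X1 + p21 *\<^sub>R X2" "pdv x z = p12 *\<^sub>R X1 + p22 *\<^sub>R X2"
    unfolding X1_def X2_def p by (rule umb_in_Monge_frame(1,2)[OF D k \<delta> f eq])+
  have lin: "b *\<^sub>R (p *\<^sub>R X1 + p' *\<^sub>R X2) + c *\<^sub>R (r *\<^sub>R X1 + r' *\<^sub>R X2) = (b * p + c * r) *\<^sub>R X1 + (b * p' + c * r') *\<^sub>R X2" for b c p p' r r'
    by (simp add: algebra_simps)
  have "p22 *\<^sub>R pdu x z + (- p21) *\<^sub>R pdv x z = 0"
    unfolding X lin using 0 by (simp add: mult.commute)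
  from ind[rule_format, OF this] have 1: "p22 = 0" "p21 = 0" by simp_all
  have "p12 *\<^sub>R pdu x z + (- p11) *\<^sub>R pdv x z = 0"
    unfolding X lin using 0 by (simp add: mult.commute)
  from ind[rule_format, OF this] have 2: "p12 = 0" "p11 = 0" by simp_all
  have "1 *\<^sub>R pdu x z + 0 *\<^sub>R pdv x z = 0" using X(1) 1 2 by simp
  from ind[rule_format, OF this] show False by simp
qed

text \<open>Near \<open>x z\<close> the surface is the image of the graph, and the frame coordinates recover the parameters of a
  point of that image.\<close>

lemma coordinates_in_monge_chart:
  assumes M: "monge_function M (x z) u v w f" and \<delta>: "fdet u v w \<noteq> 0"
    and D: "open D" "z \<in> D" "x ` D \<subseteq> M" "continuous_on D x"
  shows "graph_near u v w f x z"
proof -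
  obtain N B where N: "open N" "x z \<in> N" "M \<inter> N = (\<lambda>s. x z + frame_graph u v w f s) ` B"
    using M by (auto simp: monge_function_def)
  have "open (D \<inter> x -` N)" by (rule continuous_open_preimage[OF D(4,1) N(1)])
  then have "\<forall>\<^sub>F z' in nhds z. z' \<in> D \<inter> x -` N" using D(2) N(2) by (intro eventually_nhds_in_open) auto
  then show ?thesis
  proof eventually_elim
    case (elim z')
    then have "x z' \<in> M \<inter> N" using D(3) by auto
    then obtain s where "x z' = x z + frame_graph u v w f s" using N(3) by auto
    then have "x z' - x z = fst s *\<^sub>R u + snd s *\<^sub>R v + f s *\<^sub>R w" by (simp add: frame_graph_def)
    then show ?case using frame_coords_of_combination[OF \<delta>] by simp
  qed
qed

lemma derivative_on_pairs:
  assumes "((h :: real \<times> real \<Rightarrow> real) has_derivative h') F"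
  shows "h' d = fst d * h' (1, 0) + snd d * h' (0, 1)"
proof -
  interpret bounded_linear h' using assms by (rule has_derivative_bounded_linear)
  have "d = fst d *\<^sub>R (1, 0) + snd d *\<^sub>R (0, 1)" by (cases d) simp
  then have "h' d = h' (fst d *\<^sub>R (1, 0) + snd d *\<^sub>R (0, 1))" by simp
  also have "\<dots> = fst d * h' (1, 0) + snd d * h' (0, 1)" by (simp only: add scaleR real_scaleR_def)
  finally show ?thesis .
qed

text \<open>The derivatives of the coefficients \<open>\<kappa>\<close> are multiplied by functions that vanish at \<open>q\<close>.\<close>

lemma has_derivative_combination_vanishing:
  fixes A B C :: "'n::real_normed_vector \<Rightarrow> real"
  assumes "(A has_derivative A') (at q)" "(B has_derivative B') (at q)" "(C has_derivative C') (at q)"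
    and "A q = 0" "B q = 0" "C q = 0"
    and "\<kappa> differentiable (at q)" "\<kappa>1 differentiable (at q)" "\<kappa>2 differentiable (at q)" "\<kappa>3 differentiable (at q)"
  shows "((\<lambda>z. \<kappa> z * (C z * \<kappa>1 z + B z * \<kappa>2 z + A z * \<kappa>3 z)) has_derivative
     (\<lambda>d. \<kappa> q * (C' d * \<kappa>1 q + B' d * \<kappa>2 q + A' d * \<kappa>3 q))) (at q)"
proof -
  obtain k k1 k2 k3 where "(\<kappa> has_derivative k) (at q)" "(\<kappa>1 has_derivative k1) (at q)"
    "(\<kappa>2 has_derivative k2) (at q)" "(\<kappa>3 has_derivative k3) (at q)"
    using assms by (auto simp: differentiable_def)
  note d = this assms(1-3)
  show ?thesis by (rule d derivative_eq_intros refl)+ (simp add: assms(4-6) algebra_simps)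
qed

text \<open>Substituting the inverse matrix recovers the quadratic form up to the square of the determinant.\<close>

lemma quadratic_form_substitution_injective:
  fixes A B C :: real
  assumes "p11 * p22 - p12 * p21 \<noteq> 0"
    and "C * p11\<^sup>2 + B * (p11 * p21) + A * p21\<^sup>2 = 0"
    and "C * (2 * p11 * p12) + B * (p11 * p22 + p12 * p21) + A * (2 * p21 * p22) = 0"
    and "C * p12\<^sup>2 + B * (p12 * p22) + A * p22\<^sup>2 = 0"
  shows "A = 0 \<and> B = 0 \<and> C = 0"
proof -
  have "A * (p11 * p22 - p12 * p21)\<^sup>2 = 0" "B * (p11 * p22 - p12 * p21)\<^sup>2 = 0" "C * (p11 * p22 - p12 * p21)\<^sup>2 = 0"
    using assms(2-4) by algebra+
  then show ?thesis using assms(1) by simp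
qed

lemma jet_induced_metric_nonzero:
  assumes "fdet u v w \<noteq> 0"
  shows "jetE u v w a \<noteq> 0 \<or> jetF u v w a \<noteq> 0 \<or> jetG u v w a \<noteq> 0"
  unfolding jetE_def jetF_def jetG_def
proof (rule no_isotropic_plane, intro allI impI)
  fix \<alpha> \<beta> assume "\<alpha> *\<^sub>R (u + a 1 0 *\<^sub>R w) + \<beta> *\<^sub>R (v + a 1 1 *\<^sub>R w) = 0"
  then have "\<alpha> *\<^sub>R u + \<beta> *\<^sub>R v + (\<alpha> * a 1 0 + \<beta> * a 1 1) *\<^sub>R w = 0" by (simp add: algebra_simps)
  with frame_coords_of_combination[OF assms, of \<alpha> \<beta> "\<alpha> * a 1 0 + \<beta> * a 1 1"] frame_coords_of_combination[OF assms, of 0 0 0]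
  show "\<alpha> = 0 \<and> \<beta> = 0" by simp
qed

lemma jet_space_diff:
  assumes J: "J = jet_space k \<or> J = jet_space2 k" and "a \<in> J" "b \<in> J"
  shows "(\<lambda>s i. a s i - b s i) \<in> J"
proof -
  have *: "a s i \<noteq> 0 \<or> b s i \<noteq> 0" if "a s i - b s i \<noteq> 0" for s i using that by auto
  from J show ?thesis
  proof
    assume "J = jet_space k"
    then show ?thesis using assms(2,3) * unfolding jet_space_def by blast
  next
    assume "J = jet_space2 k"
    then show ?thesis using assms(2,3) * unfolding jet_space2_def by blast
  qed
qed

text \<open>The jet \<open>a\<close> is that of the surface at \<open>x z\<close> in the frame \<open>U, V, W\<close>, and its graph has the same first
  fundamental form in this frame and in the frame \<open>u, v, w\<close> to which the stratum refers.\<close>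

abbreviation Monge_jet_in_frame ::
  "nat \<Rightarrow> jet set \<Rightarrow> real^3 \<Rightarrow> real^3 \<Rightarrow> real^3 \<Rightarrow> real^3 \<Rightarrow> real^3 \<Rightarrow> real^3
    \<Rightarrow> (real \<times> real \<Rightarrow> real^3) \<Rightarrow> real \<times> real \<Rightarrow> jet \<Rightarrow> bool" where
  "Monge_jet_in_frame k J u v w U V W x z a \<equiv> fdet U V W \<noteq> 0 \<and> a \<in> J \<and>
     jetE U V W a = jetE u v w a \<and> jetF U V W a = jetF u v w a \<and> jetG U V W a = jetG u v w a \<and>
     (\<exists>f. analytic2_at f (0, 0) \<and> a = taylor_jet k f \<and> graph_near U V W f x z)"

text \<open>The frame \<open>U, V, W\<close> may move with the point, while the stratum refers to the frame \<open>u, v, w\<close>; they only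
  need to induce the same first fundamental forms on the jets that occur.  By the transformation of the
  minors, the umbilic functions of \<open>x\<close> are combinations of those of \<open>\<theta> \<circ> x\<close> with an invertible coefficient
  matrix, so the kernels of the two differentials at \<open>q\<close> agree.  Transversality is surjectivity of the second
  differential onto the syzygy plane: for a given jet one looks for a velocity of \<open>\<theta> \<circ> x\<close> with the same image,
  and the difference is tangent to the stratum.\<close>

lemma umb_differential_injective_iff_transverse:
  fixes x U V W :: "real \<times> real \<Rightarrow> real^3" and u v w :: "real^3"
  assumes D: "open D" "vec_analytic_on D x" "q \<in> D"
    and ind: "\<forall>z\<in>D. \<forall>\<alpha> \<beta>. \<alpha> *\<^sub>R pdu x z + \<beta> *\<^sub>R pdv x z = 0 \<longrightarrow> \<alpha> = 0 \<and> \<beta> = 0"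
    and umb: "umbilic_at x q" and k: "2 \<le> k"
    and UVW: "U differentiable (at q)" "V differentiable (at q)" "W differentiable (at q)"
    and \<delta>: "fdet u v w \<noteq> 0"
    and J: "J = jet_space k \<or> J = jet_space2 k"
    and ev: "\<forall>\<^sub>F z in nhds q. z \<in> D \<and> Monge_jet_in_frame k J u v w (U z) (V z) (W z) x z (\<theta> (x z))"
  shows "(\<forall>d. umb_differential x q d = 0 \<longrightarrow> d = 0) \<longleftrightarrow> transverse_to \<theta> x q J (umbilic_stratum k u v w J)"
proof -
  define \<Theta> where "\<Theta> z = \<theta> (x z)" for z
  define \<delta>' where "\<delta>' z = fdet (U z) (V z) (W z)" for z
  define p11 where "p11 z = frame_coord1 (U z) (V z) (W z) (pdu x z)" for z
  define p12 where "p12 z = frame_coord1 (U z) (V z) (W z) (pdv x z)" for z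
  define p21 where "p21 z = frame_coord2 (U z) (V z) (W z) (pdu x z)" for z
  define p22 where "p22 z = frame_coord2 (U z) (V z) (W z) (pdv x z)" for z
  define g1 where "g1 z = frame_coord3 (U z) (V z) (W z) (pdu x z)" for z
  define g2 where "g2 z = frame_coord3 (U z) (V z) (W z) (pdv x z)" for z
  define \<Delta> where "\<Delta> z = p11 z * p22 z - p12 z * p21 z" for z
  define A where "A z = jetA u v w (\<Theta> z)" for z
  define B where "B z = jetB u v w (\<Theta> z)" for z
  define C where "C z = jetC u v w (\<Theta> z)" for z
  let ?l = "\<lambda>z. \<delta>' z * \<Delta> z * (2 * \<Theta> z 2 0 * (p11 z)\<^sup>2 + 2 * \<Theta> z 2 1 * p11 z * p21 z + 2 * \<Theta> z 2 2 * (p21 z)\<^sup>2)"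
  let ?m = "\<lambda>z. \<delta>' z * \<Delta> z * (2 * \<Theta> z 2 0 * p11 z * p12 z + \<Theta> z 2 1 * (p11 z * p22 z + p12 z * p21 z) + 2 * \<Theta> z 2 2 * p21 z * p22 z)"
  let ?n = "\<lambda>z. \<delta>' z * \<Delta> z * (2 * \<Theta> z 2 0 * (p12 z)\<^sup>2 + 2 * \<Theta> z 2 1 * p12 z * p22 z + 2 * \<Theta> z 2 2 * (p22 z)\<^sup>2)"
  let ?qc = "\<lambda>z. C z * (p11 z)\<^sup>2 + B z * (p11 z * p21 z) + A z * (p21 z)\<^sup>2"
  let ?qb = "\<lambda>z. C z * (2 * p11 z * p12 z) + B z * (p11 z * p22 z + p12 z * p21 z) + A z * (2 * p21 z * p22 z)"
  let ?qa = "\<lambda>z. C z * (p12 z)\<^sup>2 + B z * (p12 z * p22 z) + A z * (p22 z)\<^sup>2"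
  let ?c10 = "\<lambda>z. (g1 z * p22 z - g2 z * p21 z) / \<Delta> z"
  let ?c11 = "\<lambda>z. (g2 z * p11 z - g1 z * p12 z) / \<Delta> z"
  let ?c20 = "\<lambda>z. ((p22 z)\<^sup>2 * lbar x z - 2 * p22 z * p21 z * mbar x z + (p21 z)\<^sup>2 * nbar x z) / (2 * \<delta>' z * \<Delta> z ^ 3)"
  let ?c21 = "\<lambda>z. ((p11 z * p22 z + p12 z * p21 z) * mbar x z - p12 z * p22 z * lbar x z - p11 z * p21 z * nbar x z) / (\<delta>' z * \<Delta> z ^ 3)"
  let ?c22 = "\<lambda>z. ((p12 z)\<^sup>2 * lbar x z - 2 * p11 z * p12 z * mbar x z + (p11 z)\<^sup>2 * nbar x z) / (2 * \<delta>' z * \<Delta> z ^ 3)"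

  have main: "\<forall>\<^sub>F z in nhds q. \<delta>' z \<noteq> 0 \<and> \<Delta> z \<noteq> 0 \<and> \<Theta> z \<in> J \<and>
     g1 z = \<Theta> z 1 0 * p11 z + \<Theta> z 1 1 * p21 z \<and> g2 z = \<Theta> z 1 0 * p12 z + \<Theta> z 1 1 * p22 z \<and>
     lbar x z = ?l z \<and>
     mbar x z = ?m z \<and>
     nbar x z = ?n z \<and>
     umb_c x z = \<delta>' z * (\<Delta> z)\<^sup>2 * ?qc z \<and>
     umb_b x z = \<delta>' z * (\<Delta> z)\<^sup>2 * ?qb z \<and>
     umb_a x z = \<delta>' z * (\<Delta> z)\<^sup>2 * ?qa z"
    using ev
  proof eventually_elim
    case (elim z)
    then obtain f where f: "analytic2_at f (0, 0)" "\<theta> (x z) = taylor_jet k f"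
      "graph_near (U z) (V z) (W z) f x z" by blast
    have z: "z \<in> D" and \<delta>z: "fdet (U z) (V z) (W z) \<noteq> 0" using elim by auto
    note M = umb_in_Monge_frame(3-10)[OF D(1,2) z k \<delta>z f(1,3)]
    have \<Delta>z: "\<Delta> z \<noteq> 0"
      unfolding \<Delta>_def p11_def p12_def p21_def p22_def
      by (rule Monge_frame_jacobian[OF D(1,2) z k \<delta>z f(1,3)]) (use ind z in blast)
    have ABC: "jetA (U z) (V z) (W z) (\<Theta> z) = A z" "jetB (U z) (V z) (W z) (\<Theta> z) = B z" "jetC (U z) (V z) (W z) (\<Theta> z) = C z"
      using elim by (simp_all add: A_def B_def C_def jetA_def jetB_def jetC_def \<Theta>_def)
    note M' = M[folded f(2), folded \<Theta>_def, folded p11_def p12_def p21_def p22_def g1_def g2_def \<delta>'_def, folded \<Delta>_def, unfolded ABC]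
    have \<Theta>J: "\<Theta> z \<in> J" using elim by (simp add: \<Theta>_def)
    show ?case by (intro conjI M' \<Delta>z \<delta>z[folded \<delta>'_def] \<Theta>J)
  qed
  note at_q = eventually_nhds_x_imp_x[OF main]
  have dq: "\<delta>' q \<noteq> 0" "\<Delta> q \<noteq> 0" "\<Theta> q \<in> J" using at_q by blast+

  have X: "pdu x differentiable (at q)" "pdv x differentiable (at q)"
    using vec_analytic_on_pd[OF D(1,2)] D(3) vec_analytic_has_derivative[of "pdu x" q] vec_analytic_has_derivative[of "pdv x" q]
    unfolding vec_analytic_on_def differentiable_def by blast+
  have F: "lbar x differentiable (at q)" "mbar x differentiable (at q)" "nbar x differentiable (at q)"
    using analytic2_at_fundamental_forms(4-6)[OF D, THEN analytic2_has_derivative] unfolding differentiable_def by blast+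
  have d\<delta>: "\<delta>' differentiable (at q)"
    unfolding \<delta>'_def[abs_def] by (intro fdet_differentiable UVW)
  have dP: "p11 differentiable (at q)" "p12 differentiable (at q)" "p21 differentiable (at q)" "p22 differentiable (at q)"
    "g1 differentiable (at q)" "g2 differentiable (at q)"
    unfolding p11_def[abs_def] p12_def[abs_def] p21_def[abs_def] p22_def[abs_def] g1_def[abs_def] g2_def[abs_def]
      frame_coord1_def frame_coord2_def frame_coord3_def
    by (intro differentiable_divide fdet_differentiable UVW X dq(1)[unfolded \<delta>'_def])+
  have d\<Delta>: "\<Delta> differentiable (at q)"
    unfolding \<Delta>_def[abs_def] by (intro differentiable_diff differentiable_mult dP)

  \<comment> \<open>the transformation formulas are solved for the jet, which becomes a rational function of differentiable data\<close>
  have solve: "\<forall>\<^sub>F z in nhds q. ?c10 z = \<Theta> z 1 0 \<and> ?c11 z = \<Theta> z 1 1 \<and>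
      ?c20 z = \<Theta> z 2 0 \<and>
      ?c21 z = \<Theta> z 2 1 \<and>
      ?c22 z = \<Theta> z 2 2"
    using main
  proof eventually_elim
    case (elim z)
    then have nz: "\<delta>' z \<noteq> 0" "\<Delta> z \<noteq> 0" by blast+
    have div: "n / c = t" if "c \<noteq> 0" "n = t * c" for n c t :: real using that by simp
    have g: "g1 z = \<Theta> z 1 0 * p11 z + \<Theta> z 1 1 * p21 z" "g2 z = \<Theta> z 1 0 * p12 z + \<Theta> z 1 1 * p22 z"
      and lmn: "lbar x z = ?l z"
      "mbar x z = ?m z"
      "nbar x z = ?n z"
      using elim by blast+
    show ?case
    proof (intro conjI div)
      show "g1 z * p22 z - g2 z * p21 z = \<Theta> z 1 0 * \<Delta> z" unfolding g \<Delta>_def by algebra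
      show "g2 z * p11 z - g1 z * p12 z = \<Theta> z 1 1 * \<Delta> z" unfolding g \<Delta>_def by algebra
      show "(p22 z)\<^sup>2 * lbar x z - 2 * p22 z * p21 z * mbar x z + (p21 z)\<^sup>2 * nbar x z = \<Theta> z 2 0 * (2 * \<delta>' z * \<Delta> z ^ 3)"
        unfolding lmn \<Delta>_def by algebra
      show "(p11 z * p22 z + p12 z * p21 z) * mbar x z - p12 z * p22 z * lbar x z - p11 z * p21 z * nbar x z = \<Theta> z 2 1 * (\<delta>' z * \<Delta> z ^ 3)"
        unfolding lmn \<Delta>_def by algebra
      show "(p12 z)\<^sup>2 * lbar x z - 2 * p11 z * p12 z * mbar x z + (p11 z)\<^sup>2 * nbar x z = \<Theta> z 2 2 * (2 * \<delta>' z * \<Delta> z ^ 3)"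
        unfolding lmn \<Delta>_def by algebra
    qed (use nz in auto)
  qed
  have low: "(\<lambda>z. \<Theta> z s i) differentiable (at q)" if "(s, i) \<in> low_coeffs" for s i
  proof -
    note dI = differentiable_divide differentiable_add differentiable_diff differentiable_mult differentiable_power differentiable_const dP d\<Delta> d\<delta> F
    have nz: "2 * \<delta>' q * \<Delta> q ^ 3 \<noteq> 0" "\<delta>' q * \<Delta> q ^ 3 \<noteq> 0" using dq by auto
    have "(\<lambda>z. ?c10 z) differentiable (at q)"
      "(\<lambda>z. ?c11 z) differentiable (at q)"
      "(\<lambda>z. ?c20 z) differentiable (at q)"
      "(\<lambda>z. ?c21 z) differentiable (at q)"
      "(\<lambda>z. ?c22 z) differentiable (at q)"
      by (intro dI dq nz)+
    from this[THEN differentiable_eventually_cong]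
    have "(\<lambda>z. \<Theta> z 1 0) differentiable (at q)" "(\<lambda>z. \<Theta> z 1 1) differentiable (at q)" "(\<lambda>z. \<Theta> z 2 0) differentiable (at q)"
      "(\<lambda>z. \<Theta> z 2 1) differentiable (at q)" "(\<lambda>z. \<Theta> z 2 2) differentiable (at q)"
      using eventually_conj_iff solve by (simp_all only: eventually_conj_iff)
    then show ?thesis using that by (auto simp: low_coeffs_def)
  qed
  define jd where "jd d = jet_differential (\<theta> \<circ> x) q d" for d
  have jd: "((\<lambda>z. \<Theta> z s i) has_derivative (\<lambda>d. jd d s i)) (at q)" if "(s, i) \<in> low_coeffs" for s i
    using low[OF that] unfolding frechet_derivative_works by (simp add: jd_def jet_differential_def \<Theta>_def)
  \<comment> \<open>coefficients that vanish on \<open>J\<close> vanish along \<open>\<Theta>\<close> near \<open>q\<close>; the others are unconstrained\<close>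
  have jdJ: "jd d \<in> J" for d
  proof -
    have "jd d s i = 0" if z: "\<forall>a\<in>J. a s i = 0" for s i
    proof -
      have "\<forall>\<^sub>F z in nhds q. \<Theta> z s i = 0" by (rule eventually_mono[OF main]) (use z in blast)
      then have "((\<lambda>z. \<Theta> z s i) has_derivative (\<lambda>_. 0)) (at q)"
        by (intro has_derivative_transform_eventually[OF has_derivative_const[of 0]])
          (use eventually_nhds_x_imp_x[of "\<lambda>z. \<Theta> z s i = 0" q] in \<open>auto simp: eventually_at_filter elim: eventually_mono\<close>)
      from fun_cong[OF frechet_derivative_at[OF this], of d] show ?thesis
        by (simp add: jd_def jet_differential_def \<Theta>_def)
    qed
    then show ?thesis using J by (fastforce simp: jet_space_def jet_space2_def)
  qed
  have dA: "(A has_derivative (\<lambda>d. djetA u v w (\<Theta> q) (jd d))) (at q)"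
    and dB: "(B has_derivative (\<lambda>d. djetB u v w (\<Theta> q) (jd d))) (at q)"
    and dC: "(C has_derivative (\<lambda>d. djetC u v w (\<Theta> q) (jd d))) (at q)"
    unfolding A_def[abs_def] B_def[abs_def] C_def[abs_def]
    by (rule jetA_has_derivative jetB_has_derivative jetC_has_derivative; rule jd; assumption)+
  let ?A = "\<lambda>d. djetA u v w (\<Theta> q) (jd d)" and ?B = "\<lambda>d. djetB u v w (\<Theta> q) (jd d)" and ?C = "\<lambda>d. djetC u v w (\<Theta> q) (jd d)"

  have umb0: "umb_a x q = 0" "umb_b x q = 0" "umb_c x q = 0" using umb by (auto simp: umbilic_at_def)
  have scale: "\<delta>' q * (\<Delta> q)\<^sup>2 \<noteq> 0" using dq by simp
  have ABC0: "A q = 0 \<and> B q = 0 \<and> C q = 0"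
  proof (rule quadratic_form_substitution_injective)
    show "p11 q * p22 q - p12 q * p21 q \<noteq> 0" using dq(2) by (simp add: \<Delta>_def)
    have "\<delta>' q * (\<Delta> q)\<^sup>2 * ?qc q = 0"
      "\<delta>' q * (\<Delta> q)\<^sup>2 * ?qb q = 0"
      "\<delta>' q * (\<Delta> q)\<^sup>2 * ?qa q = 0"
      using at_q umb0 by metis+
    with scale show "?qc q = 0"
      "?qb q = 0"
      "?qa q = 0"
      by (metis mult_eq_0_iff)+
  qed
  then have A0: "A q = 0" "B q = 0" "C q = 0" by auto
  note dI = differentiable_add differentiable_mult differentiable_power differentiable_const dP d\<Delta> d\<delta>
  have comb: "((\<lambda>z. \<delta>' z * (\<Delta> z)\<^sup>2 * (C z * \<kappa>1 z + B z * \<kappa>2 z + A z * \<kappa>3 z)) has_derivative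
     (\<lambda>d. \<delta>' q * (\<Delta> q)\<^sup>2 * (?C d * \<kappa>1 q + ?B d * \<kappa>2 q + ?A d * \<kappa>3 q))) (at q)"
    if "\<kappa>1 differentiable (at q)" "\<kappa>2 differentiable (at q)" "\<kappa>3 differentiable (at q)" for \<kappa>1 \<kappa>2 \<kappa>3
    by (rule has_derivative_combination_vanishing[OF dA dB dC A0 _ that]) (intro dI)
  have same: "fst d * pdu h q + snd d * pdv h q = \<delta>' q * (\<Delta> q)\<^sup>2 * (?C d * \<kappa>1 q + ?B d * \<kappa>2 q + ?A d * \<kappa>3 q)"
    if "analytic2_at h q" "\<forall>\<^sub>F z in nhds q. \<delta>' z * (\<Delta> z)\<^sup>2 * (C z * \<kappa>1 z + B z * \<kappa>2 z + A z * \<kappa>3 z) = h z"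
      "\<kappa>1 differentiable (at q)" "\<kappa>2 differentiable (at q)" "\<kappa>3 differentiable (at q)" for h \<kappa>1 \<kappa>2 \<kappa>3 d
  proof -
    have "(h has_derivative (\<lambda>d. \<delta>' q * (\<Delta> q)\<^sup>2 * (?C d * \<kappa>1 q + ?B d * \<kappa>2 q + ?A d * \<kappa>3 q))) (at q)"
      by (rule has_derivative_eventually_cong[OF comb[OF that(3-5)] that(2)])
    from has_derivative_unique[OF analytic2_has_derivative[OF that(1)] this] show ?thesis by (rule fun_cong)
  qed
  note an = analytic2_at_fundamental_forms(7-9)[OF D]
  have umb_ev:
    "\<forall>\<^sub>F z in nhds q. \<delta>' z * (\<Delta> z)\<^sup>2 * ?qa z = umb_a x z"
    "\<forall>\<^sub>F z in nhds q. \<delta>' z * (\<Delta> z)\<^sup>2 * ?qb z = umb_b x z"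
    "\<forall>\<^sub>F z in nhds q. \<delta>' z * (\<Delta> z)\<^sup>2 * ?qc z = umb_c x z"
    by (rule eventually_mono[OF main], simp only:)+
  have U: "umb_differential x q d = (
      \<delta>' q * (\<Delta> q)\<^sup>2 * (?C d * (p12 q)\<^sup>2 + ?B d * (p12 q * p22 q) + ?A d * (p22 q)\<^sup>2),
      \<delta>' q * (\<Delta> q)\<^sup>2 * (?C d * (2 * p11 q * p12 q) + ?B d * (p11 q * p22 q + p12 q * p21 q) + ?A d * (2 * p21 q * p22 q)),
      \<delta>' q * (\<Delta> q)\<^sup>2 * (?C d * (p11 q)\<^sup>2 + ?B d * (p11 q * p21 q) + ?A d * (p21 q)\<^sup>2))" for d
    unfolding umb_differential_def prod.inject
  proof (intro conjI)
    show "fst d * pdu (umb_a x) q + snd d * pdv (umb_a x) q = \<delta>' q * (\<Delta> q)\<^sup>2 * (?C d * (p12 q)\<^sup>2 + ?B d * (p12 q * p22 q) + ?A d * (p22 q)\<^sup>2)"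
      by (rule same[OF an(1) umb_ev(1)]; intro dI)
    show "fst d * pdu (umb_b x) q + snd d * pdv (umb_b x) q = \<delta>' q * (\<Delta> q)\<^sup>2 * (?C d * (2 * p11 q * p12 q) + ?B d * (p11 q * p22 q + p12 q * p21 q) + ?A d * (2 * p21 q * p22 q))"
      by (rule same[OF an(2) umb_ev(2)]; intro dI)
    show "fst d * pdu (umb_c x) q + snd d * pdv (umb_c x) q = \<delta>' q * (\<Delta> q)\<^sup>2 * (?C d * (p11 q)\<^sup>2 + ?B d * (p11 q * p21 q) + ?A d * (p21 q)\<^sup>2)"
      by (rule same[OF an(3) umb_ev(3)]; intro dI)
  qed
  have kernel: "umb_differential x q d = 0 \<longleftrightarrow> ?A d = 0 \<and> ?B d = 0 \<and> ?C d = 0" for d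
  proof
    assume 0: "umb_differential x q d = 0"
    show "?A d = 0 \<and> ?B d = 0 \<and> ?C d = 0"
    proof (rule quadratic_form_substitution_injective)
      show "p11 q * p22 q - p12 q * p21 q \<noteq> 0" using dq(2) by (simp add: \<Delta>_def)
      show "?C d * (p11 q)\<^sup>2 + ?B d * (p11 q * p21 q) + ?A d * (p21 q)\<^sup>2 = 0"
        "?C d * (2 * p11 q * p12 q) + ?B d * (p11 q * p22 q + p12 q * p21 q) + ?A d * (2 * p21 q * p22 q) = 0"
        "?C d * (p12 q)\<^sup>2 + ?B d * (p12 q * p22 q) + ?A d * (p22 q)\<^sup>2 = 0"
        using 0[unfolded U zero_prod_def prod.inject] scale by (metis mult_eq_0_iff)+
    qed
  qed (simp add: U zero_prod_def)

  let ?e = "jetE u v w (\<Theta> q)" and ?f = "jetF u v w (\<Theta> q)" and ?g = "jetG u v w (\<Theta> q)"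
  note reg = jet_induced_metric_nonzero[OF \<delta>, of "\<Theta> q"]
  note syz = djet_syzygy[OF A0[unfolded A_def B_def C_def]]
  have \<Theta>S: "\<Theta> q \<in> umbilic_stratum k u v w J"
    using dq A0 by (simp add: umbilic_stratum_def umbilic_at_jet_graph_iff[OF k \<delta>] A_def B_def C_def)
  have "(\<forall>d. umb_differential x q d = 0 \<longrightarrow> d = 0) \<longleftrightarrow>
     (\<forall>y1 y2 y3. ?e * y1 - ?f * y2 + ?g * y3 = 0 \<longrightarrow> (\<exists>d. ?A d = y1 \<and> ?B d = y2 \<and> ?C d = y3))"
    unfolding kernel
    by (rule injective_iff_onto_plane[OF derivative_on_pairs[OF dA] derivative_on_pairs[OF dB] derivative_on_pairs[OF dC] syz reg])
  also have "\<dots> \<longleftrightarrow> transverse_to \<theta> x q J (umbilic_stratum k u v w J)" (is "?onto \<longleftrightarrow> _")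
  proof
    assume onto: ?onto
    show "transverse_to \<theta> x q J (umbilic_stratum k u v w J)"
      unfolding transverse_to_def
    proof (intro impI ballI)
      fix a assume a: "a \<in> J"
      obtain d where d: "?A d = djetA u v w (\<Theta> q) a" "?B d = djetB u v w (\<Theta> q) a" "?C d = djetC u v w (\<Theta> q) a"
        using onto syz[of a] by blast
      let ?b = "\<lambda>s i. a s i - jd d s i"
      have bJ: "?b \<in> J" by (rule jet_space_diff[OF J a jdJ])
      have "?b \<in> jet_tangent (umbilic_stratum k u v w J) (\<Theta> q)"
        unfolding jet_tangent_umbilic_stratum[OF k \<delta> J \<Theta>S reg bJ] using d by (simp add: djet_diff)
      then show "\<exists>d. \<exists>b\<in>jet_tangent (umbilic_stratum k u v w J) (\<theta> (x q)). a = (\<lambda>s i. jet_differential (\<theta> \<circ> x) q d s i + b s i)"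
        by (intro exI[of _ d] bexI[of _ ?b]) (simp_all add: jd_def \<Theta>_def)
    qed
  next
    assume T: "transverse_to \<theta> x q J (umbilic_stratum k u v w J)"
    show ?onto
    proof (intro allI impI)
      fix y1 y2 y3 assume y: "?e * y1 - ?f * y2 + ?g * y3 = 0"
      obtain a where a: "a \<in> J" "djetA u v w (\<Theta> q) a = y1" "djetB u v w (\<Theta> q) a = y2" "djetC u v w (\<Theta> q) a = y3"
        using second_order_jet_exists[OF k J reg y] by blast
      obtain d b where b: "b \<in> jet_tangent (umbilic_stratum k u v w J) (\<Theta> q)" "a = (\<lambda>s i. jd d s i + b s i)"
        using T \<Theta>S a(1) unfolding transverse_to_def \<Theta>_def jd_def by blast
      have b': "b = (\<lambda>s i. a s i - jd d s i)" unfolding b(2) by simp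
      have "b \<in> J" unfolding b' by (rule jet_space_diff[OF J a(1) jdJ])
      from jet_tangent_umbilic_stratum[OF k \<delta> J \<Theta>S reg this] b(1)
      have "?A d = y1 \<and> ?B d = y2 \<and> ?C d = y3"
        by (simp add: b' djet_diff a)
      then show "\<exists>d. ?A d = y1 \<and> ?B d = y2 \<and> ?C d = y3" by blast
    qed
  qed
  finally show ?thesis .
qed

text \<open>The sign is that of the determinant of the pseudo-scalar product.\<close>

lemma Gram_determinant_mink:
  "(fdet a b c)\<^sup>2 = - (mink a a * mink b b * mink c c + 2 * mink a b * mink b c * mink a c
     - mink a a * (mink b c)\<^sup>2 - mink b b * (mink a c)\<^sup>2 - mink c c * (mink a b)\<^sup>2)"
  unfolding fdet_expand mink_def by algebra

lemma taylor_jet_in_jet_space: "taylor_jet k f \<in> jet_space k"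
  by (auto simp: taylor_jet_def jet_space_def split: if_splits)

lemma taylor_jet_in_jet_space2:
  assumes "taylor_jet k f 1 0 = 0" "taylor_jet k f 1 1 = 0"
  shows "taylor_jet k f \<in> jet_space2 k"
  unfolding jet_space2_def
proof (intro CollectI allI impI)
  fix s i assume n: "taylor_jet k f s i \<noteq> 0"
  then have si: "1 \<le> s" "s \<le> k" "i \<le> s" by (auto simp: taylor_jet_def split: if_splits)
  have "s \<noteq> 1"
  proof
    assume "s = 1"
    then have "i = 0 \<or> i = 1" using si by auto
    with n assms \<open>s = 1\<close> show False by auto
  qed
  then show "2 \<le> s \<and> s \<le> k \<and> i \<le> s" using si by auto
qed

lemma local_paramD:
  assumes "local_param M D x"
  shows "open D" "vec_analytic_on D x" "continuous_on D x" "x ` D \<subseteq> M"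
    "\<forall>z\<in>D. \<forall>\<alpha> \<beta>. \<alpha> *\<^sub>R pdu x z + \<beta> *\<^sub>R pdv x z = 0 \<longrightarrow> \<alpha> = 0 \<and> \<beta> = 0"
  using assms openin_subset[of "top_of_set M" "x ` D"]
  unfolding local_param_def vec_analytic_on_def homeomorphism_def by auto

lemma open_vimage_surface:
  assumes "local_param M D x" "openin (top_of_set M) W"
  shows "open (D \<inter> x -` W)"
proof -
  obtain T where T: "open T" "W = M \<inter> T" using assms(2) by (auto simp: openin_open)
  have "D \<inter> x -` W = D \<inter> x -` T" using T(2) local_paramD(4)[OF assms(1)] by auto
  then show ?thesis
    using continuous_open_preimage[OF local_paramD(3,1)[OF assms(1)] T(1)] by simp
qed

text \<open>In an adapted frame the third vector is normal to the surface, so that the linear part of the Monge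
  function vanishes.  The first fundamental form of the graph at the origin is then that of the first two
  frame vectors, which is the same for all adapted frames and for the standard one.\<close>

lemma umb_differential_injective_iff_transverse_moving:
  assumes x: "local_param M D x" and q: "q \<in> D" and umb: "umbilic_at x q" and k: "2 \<le> k"
    and \<epsilon>: "\<epsilon> \<noteq> 0" and mt: "moving_monge_taylor M k \<epsilon> (x q) \<theta>"
    and uvw: "mink u u = 1" "mink v v = \<epsilon>" "mink u v = 0" "fdet u v w \<noteq> 0"
  shows "(\<forall>d. umb_differential x q d = 0 \<longrightarrow> d = 0) \<longleftrightarrow> transverse_to \<theta> x q (jet_space2 k) (umbilic_stratum k u v w (jet_space2 k))"
proof -
  note D = local_paramD[OF x]
  obtain W e1 e2 e3 where W: "openin (top_of_set M) W" "x q \<in> W"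
    and sm: "smooth_on_surface M W e1" "smooth_on_surface M W e2" "smooth_on_surface M W e3"
    and fr: "\<And>p. p \<in> W \<Longrightarrow> adapted_frame M \<epsilon> p (e1 p) (e2 p) (e3 p) \<and>
       (\<exists>f. monge_function M p (e1 p) (e2 p) (e3 p) f \<and> \<theta> p = taylor_jet k f)"
    using mt unfolding moving_monge_taylor_def by blast
  have opn: "open (D \<inter> x -` W)" by (rule open_vimage_surface[OF x W(1)])
  have diff: "(\<lambda>z. e (x z)) differentiable (at q)" if "smooth_on_surface M W e" for e
  proof -
    have "smooth2_on (D \<inter> x -` W) (e \<circ> x)" using that x unfolding smooth_on_surface_def by blast
    then have "((pdu ^^ 0) ((pdv ^^ 0) (e \<circ> x))) differentiable_on (D \<inter> x -` W)"
      unfolding smooth2_on_def by blast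
    then have "(e \<circ> x) differentiable (at q within (D \<inter> x -` W))"
      using q W(2) by (simp add: differentiable_on_def)
    then show ?thesis using at_within_open[OF _ opn] q W(2) by (simp add: o_def)
  qed
  have "\<forall>\<^sub>F z in nhds q. z \<in> D \<inter> x -` W" using q W(2) by (intro eventually_nhds_in_open[OF opn]) auto
  then have "\<forall>\<^sub>F z in nhds q. z \<in> D \<and> Monge_jet_in_frame k (jet_space2 k) u v w (e1 (x z)) (e2 (x z)) (e3 (x z)) x z (\<theta> (x z))"
  proof eventually_elim
    case (elim z)
    then have z: "z \<in> D" "x z \<in> W" by auto
    let ?u = "e1 (x z)" and ?v = "e2 (x z)" and ?w = "e3 (x z)"
    obtain f where f: "monge_function M (x z) ?u ?v ?w f" "\<theta> (x z) = taylor_jet k f"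
      using fr[OF z(2)] by blast
    have ad: "mink ?u ?u = 1" "mink ?v ?v = \<epsilon>" "mink ?w ?w = - \<epsilon>" "mink ?u ?v = 0" "mink ?u ?w = 0" "mink ?v ?w = 0"
      "\<forall>t\<in>tangent_plane M (x z). mink ?w t = 0"
      using fr[OF z(2)] by (auto simp: adapted_frame_def)
    have "(fdet ?u ?v ?w)\<^sup>2 = \<epsilon>\<^sup>2" unfolding Gram_determinant_mink ad by (simp add: power2_eq_square)
    then have \<delta>: "fdet ?u ?v ?w \<noteq> 0" using \<epsilon> by auto
    have an: "analytic2_at f (0, 0)" using f(1) by (simp add: monge_function_def)
    note eq = coordinates_in_monge_chart[OF f(1) \<delta> D(1) z(1) D(4,3)]
    let ?a = "taylor_jet k f"
    let ?p11 = "frame_coord1 ?u ?v ?w (pdu x z)" and ?p12 = "frame_coord1 ?u ?v ?w (pdv x z)"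
    let ?p21 = "frame_coord2 ?u ?v ?w (pdu x z)" and ?p22 = "frame_coord2 ?u ?v ?w (pdv x z)"
    note X = umb_in_Monge_frame(1,2)[OF D(1,2) z(1) k \<delta> an eq]
    have "?p11 * ?p22 - ?p12 * ?p21 \<noteq> 0"
      by (rule Monge_frame_jacobian[OF D(1,2) z(1) k \<delta> an eq]) (use D(5) z in blast)
    moreover have "?p11 * ?a 1 0 + ?p21 * ?a 1 1 = 0" "?p12 * ?a 1 0 + ?p22 * ?a 1 1 = 0"
    proof -
      have t: "pdu x z \<in> tangent_plane M (x z)" "pdv x z \<in> tangent_plane M (x z)"
        unfolding tangent_plane_def using x z(1) span_superset by blast+
      have m: "mink ?w (r *\<^sub>R (?u + b *\<^sub>R ?w) + s *\<^sub>R (?v + c *\<^sub>R ?w)) = - \<epsilon> * (r * b + s * c)" for r s b c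
      proof -
        have "mink ?w (r *\<^sub>R (?u + b *\<^sub>R ?w) + s *\<^sub>R (?v + c *\<^sub>R ?w)) = r * mink ?u ?w + s * mink ?v ?w + (r * b + s * c) * mink ?w ?w"
          by (simp add: mink_def algebra_simps)
        then show ?thesis by (simp add: ad)
      qed
      have "mink ?w (pdu x z) = - \<epsilon> * (?p11 * ?a 1 0 + ?p21 * ?a 1 1)" "mink ?w (pdv x z) = - \<epsilon> * (?p12 * ?a 1 0 + ?p22 * ?a 1 1)"
        by (subst X, rule m)+
      then show "?p11 * ?a 1 0 + ?p21 * ?a 1 1 = 0" "?p12 * ?a 1 0 + ?p22 * ?a 1 1 = 0"
        using ad(7) t \<epsilon> by auto
    qed
    ultimately have a: "?a 1 0 = 0 \<and> ?a 1 1 = 0"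
      using det2_nonzero_iff_injective[of ?p11 ?p22 ?p21 ?p12] by (metis mult.commute)
    \<comment> \<open>the linear coefficients solve a homogeneous system with invertible matrix\<close>
    then have "\<theta> (x z) \<in> jet_space2 k" using f(2) taylor_jet_in_jet_space2 by simp
    moreover have "jetE ?u ?v ?w ?a = jetE u v w ?a" "jetF ?u ?v ?w ?a = jetF u v w ?a" "jetG ?u ?v ?w ?a = jetG u v w ?a"
      using a by (simp_all add: jetE_def jetF_def jetG_def ad uvw)
    ultimately show ?case using z \<delta> an eq f(2) by auto
  qed
  from umb_differential_injective_iff_transverse[OF D(1,2) q D(5) umb k diff[OF sm(1)] diff[OF sm(2)] diff[OF sm(3)] uvw(4) disjI2[OF refl] this]
  show ?thesis .
qed

lemma umb_differential_injective_iff_transverse_fixed: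
  assumes x: "local_param M D x" and q: "q \<in> D" and umb: "umbilic_at x q" and k: "2 \<le> k"
    and mt: "fixed_monge_taylor M k u v w (x q) \<theta>"
  shows "(\<forall>d. umb_differential x q d = 0 \<longrightarrow> d = 0) \<longleftrightarrow> transverse_to \<theta> x q (jet_space k) (umbilic_stratum k u v w (jet_space k))"
proof -
  note D = local_paramD[OF x]
  obtain W where W: "openin (top_of_set M) W" "x q \<in> W"
    and fr: "\<And>p. p \<in> W \<Longrightarrow> \<exists>f. monge_function M p u v w f \<and> \<theta> p = taylor_jet k f"
    and \<delta>: "fdet u v w \<noteq> 0"
    using mt unfolding fixed_monge_taylor_def fdet_def by blast
  have opn: "open (D \<inter> x -` W)" by (rule open_vimage_surface[OF x W(1)])
  have "\<forall>\<^sub>F z in nhds q. z \<in> D \<inter> x -` W" using q W(2) by (intro eventually_nhds_in_open[OF opn]) auto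
  then have "\<forall>\<^sub>F z in nhds q. z \<in> D \<and> Monge_jet_in_frame k (jet_space k) u v w u v w x z (\<theta> (x z))"
  proof eventually_elim
    case (elim z)
    then have z: "z \<in> D" "x z \<in> W" by auto
    obtain f where f: "monge_function M (x z) u v w f" "\<theta> (x z) = taylor_jet k f"
      using fr[OF z(2)] by blast
    have "analytic2_at f (0, 0)" using f(1) by (simp add: monge_function_def)
    then show ?case
      using z \<delta> f(2) coordinates_in_monge_chart[OF f(1) \<delta> D(1) z(1) D(4,3)] taylor_jet_in_jet_space by auto
  qed
  then show ?thesis
    by (intro umb_differential_injective_iff_transverse[where U = "\<lambda>_. u" and V = "\<lambda>_. v" and W = "\<lambda>_. w", OF D(1,2) q D(5) umb k _ _ _ \<delta> disjI1[OF refl]] differentiable_const)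
qed

theorem theorem3p9:
  fixes M :: "(real^3) set" and D :: "(real \<times> real) set" and x :: "real \<times> real \<Rightarrow> real^3"
    and q :: "real \<times> real" and k :: nat and \<theta> :: "real^3 \<Rightarrow> jet" and J S :: "jet set"
  assumes "regular_analytic_surface M"
    and "local_param M D x" and "q \<in> D"
    and "umbilic_at x q"
    and "k \<ge> 2"
    and "monge_taylor_map M k x q \<theta> J S"
  shows "umbilic_multiplicity x q = 1 \<longleftrightarrow> transverse_to \<theta> x q J S"
proof -
  note D = local_paramD[OF assms(2)]
  have "fffE x q \<noteq> 0 \<or> fffF x q \<noteq> 0 \<or> fffG x q \<noteq> 0"
    unfolding fffE_def fffF_def fffG_def by (rule no_isotropic_plane) (use D(5) assms(3) in blast)
  then have "umbilic_multiplicity x q = 1 \<longleftrightarrow> (\<forall>d. umb_differential x q d = 0 \<longrightarrow> d = 0)"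
    by (rule umbilic_multiplicity_eq_1_iff[OF D(1,2) assms(3,4)])
  also have "\<dots> \<longleftrightarrow> transverse_to \<theta> x q J S"
    using assms(6)
  proof cases
    case spacelike
    show ?thesis unfolding spacelike(1,2)
      by (rule umb_differential_injective_iff_transverse_moving[OF assms(2-5) _ spacelike(4)])
        (simp_all add: mink_def axis_def fdet_expand)
  next
    case timelike
    show ?thesis unfolding timelike(1,2)
      by (rule umb_differential_injective_iff_transverse_moving[OF assms(2-5) _ timelike(4)])
        (simp_all add: mink_def axis_def fdet_expand)
  next
    case (lightlike u v w)
    show ?thesis unfolding lightlike(1,2)
      by (rule umb_differential_injective_iff_transverse_fixed[OF assms(2-5) lightlike(4)])
  qed
  finally show ?thesis .
qed

end
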